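(* Let $p,q$ be integers greater than $1$, and let $g(p,q)$ be the Goeritz invariant of the torus link (or knot) $T(p,q)$. Let $r=\gcd(p,q)$ and write $p=p'r$, $q=q'r$. (1) If both $p$ and $q$ are odd, then $g(p,q)=(2,\dots,2)$ with $2$ repeated $r-1$ times. (If $p,q$ are coprime, then $g(p,q)=(1)$.) (2) If $p$ is odd and $q$ is even, then $g(p,q)=(p',0,\dots,0)$ with $0$ repeated $r-1$ times. (If $p,q$ are coprime, then $g(p,q)=(p)$. If $p'=1$, then $g(p,q)=(0,\dots,0)$ with $0$ repeated $r-1$ times.) (3) If both $p$ and $q$ are even, then $g(p,q)=(2p'q',0,\dots,0)$ with $0$ repeated $r-2$ times. (If $r=2$, then $g(p,q)=(2p'q')$.)
   Context: Goeritz matrix. Let $L\subset S^3$ be a link with diagram $D$. Colour the regions of $D$ in checkerboard fashion, and let $R_0,\dots,R_n$ be the coloured (black) regions. Each crossing gets a sign $\pm1$ depending on the position of the over-strand relative to the coloured regions: the sign is determined by whether or not the over-strand, rotated counterclockwise until it coincides with the under-strand, sweeps over the coloured regions (which of the two cases is called $+1$ only changes the matrix below by a global sign). For $i\ne j$ let $g_{ij}=g_{ji}$ be the sum of the signs of all crossings at which $R_i$ and $R_j$ meet, and let $g_{ii}$ be determined by $\sum_{k=0}^n g_{ik}=0$. The Goeritz matrix is $G(D)=(g_{ij})$. An irreducible Goeritz matrix $G_1(D)$ is obtained from $G(D)$ by deleting one arbitrary row and one arbitrary column. Integral elementary divisors. Two integral matrices are $\mathbb{Z}$-equivalent if one is transformed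 into the other by a finite sequence of: interchanging two rows (or two columns); multiplying a row (or a column) by $-1$; adding an integer multiple of a row (or column) to another row (or column); replacing $M$ by $(1)\oplus M$ or conversely. Every integral square matrix is $\mathbb{Z}$-equivalent to $(d_1)\oplus\cdots\oplus(d_k)$ for a unique sequence of non-negative integers $d_i\neq 1$ with $d_{i-1}\mid d_i$ for each $i$; $(d_1,\dots,d_k)$ is called its sequence of integral elementary divisors. Goeritz invariant. $g(L)$ is the sequence of integral elementary divisors (with all $1$'s removed) of an irreducible Goeritz matrix $G_1(D)$; it is known not to depend on the diagram, the colouring, or the deleted row and column. By convention, writing $g(L)=(1)$ means that all elementary divisors are equal to $1$ (the sequence is empty after removing $1$'s). Torus link. $T(p,q)$ is the closure of the $p$-strand braid $(\sigma_1\sigma_2\cdots\sigma_{p-1})^q$; it has $\gcd(p,q)$ components. $g(p,q)$ denotes $g(T(p,q))$. *)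

theory Defs
  imports "Jordan_Normal_Form.Column_Operations" "Jordan_Normal_Form.Determinant"
begin

section \<open>Link diagrams\<close>

text \<open>
  A diagram is encoded as a planar diagram code. A crossing \<open>c\<close> has four ends
  \<open>(c, 0), (c, 1), (c, 2), (c, 3)\<close>, listed counterclockwise, such that the ends 0 and 2
  belong to the under-strand and the ends 1 and 3 to the over-strand. The arcs between
  crossings are recorded as the set of unordered pairs of ends that they join.
\<close>

record 'c diagram =
  crossings :: "'c set"
  arcs :: "('c \<times> nat) set set"

definition ends :: "'c diagram \<Rightarrow> ('c \<times> nat) set" where
  "ends D = crossings D \<times> {..<4}"

text \<open>
  The pair \<open>(c, k)\<close> also names the corner at \<open>c\<close> between the ends \<open>k\<close> and \<open>k + 1\<close> (mod 4).
  Leaving \<open>c\<close> through the end \<open>k\<close>, this corner is on the left. If that arc enters \<open>c'\<close> at the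
  end \<open>k'\<close>, the corner on the left at \<open>c'\<close> is the one between the ends \<open>k' - 1\<close> and \<open>k'\<close>.
  The regions of the diagram are the resulting classes of corners.
\<close>

definition adjacent_corners :: "'c diagram \<Rightarrow> (('c \<times> nat) \<times> ('c \<times> nat)) set" where
  "adjacent_corners D =
     {((c, k), (c', (k' + 3) mod 4)) | c k c' k'. {(c, k), (c', k')} \<in> arcs D}"

definition region_of :: "'c diagram \<Rightarrow> 'c \<times> nat \<Rightarrow> ('c \<times> nat) set" where
  "region_of D x = {y. (x, y) \<in> (adjacent_corners D \<union> (adjacent_corners D)\<inverse>)\<^sup>*}"

definition regions :: "'c diagram \<Rightarrow> ('c \<times> nat) set set" where
  "regions D = region_of D ` ends D"

text \<open>
  The last two conditions say that the projection is connected and lies on the sphere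
  (Euler's formula). Connectedness is what makes the regions of the diagram the same as the
  classes of corners; every link has a connected diagram with at least one crossing.
\<close>

definition link_diagram :: "'c diagram \<Rightarrow> bool" where
  "link_diagram D \<longleftrightarrow>
     finite (crossings D) \<and> crossings D \<noteq> {} \<and>
     (\<forall>a\<in>arcs D. a \<subseteq> ends D \<and> card a = 2) \<and>
     (\<forall>x\<in>ends D. \<exists>!a. a \<in> arcs D \<and> x \<in> a) \<and>
     (\<forall>c\<in>crossings D. \<forall>c'\<in>crossings D.
        (c, c') \<in> {(b, b'). \<exists>k k'. {(b, k), (b', k')} \<in> arcs D}\<^sup>*) \<and>
     card (crossings D) + card (regions D) = card (arcs D) + 2"

section \<open>Goeritz matrices\<close>

text \<open>The corners \<open>k\<close> and \<open>k + 1\<close> (mod 4) at \<open>c\<close> are the two sides of the end \<open>k + 1\<close>.\<close>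

definition checkerboard :: "'c diagram \<Rightarrow> ('c \<times> nat) set set \<Rightarrow> bool" where
  "checkerboard D B \<longleftrightarrow> B \<subseteq> regions D \<and>
     (\<forall>(c, k)\<in>ends D. region_of D (c, k) \<in> B \<longleftrightarrow> region_of D (c, (k + 1) mod 4) \<notin> B)"

text \<open>
  Rotated counterclockwise, the over-strand (ends 1 and 3) reaches the under-strand (ends 2
  and 0) after sweeping over the corners 1 and 3, which have the same colour.
\<close>

definition goeritz_sign :: "'c diagram \<Rightarrow> ('c \<times> nat) set set \<Rightarrow> 'c \<Rightarrow> int" where
  "goeritz_sign D B c = (if region_of D (c, 1) \<in> B then 1 else - 1)"

definition meet_at :: "('c \<times> nat) set \<Rightarrow> ('c \<times> nat) set \<Rightarrow> 'c \<Rightarrow> bool" where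
  "meet_at R S c \<longleftrightarrow> (\<exists>k. (c, k) \<in> R) \<and> (\<exists>l. (c, l) \<in> S)"

definition goeritz_entry ::
  "'c diagram \<Rightarrow> ('c \<times> nat) set set \<Rightarrow> ('c \<times> nat) set \<Rightarrow> ('c \<times> nat) set \<Rightarrow> int" where
  "goeritz_entry D B R S = (\<Sum>c | c \<in> crossings D \<and> meet_at R S c. goeritz_sign D B c)"

text \<open>\<open>Rs\<close> enumerates the black regions.\<close>

definition goeritz_matrix :: "'c diagram \<Rightarrow> ('c \<times> nat) set list \<Rightarrow> int mat" where
  "goeritz_matrix D Rs = mat (length Rs) (length Rs) (\<lambda>(i, j).
     if i \<noteq> j then goeritz_entry D (set Rs) (Rs ! i) (Rs ! j)
     else - (\<Sum>k\<in>{..<length Rs} - {i}. goeritz_entry D (set Rs) (Rs ! i) (Rs ! k)))"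

definition irreducible_goeritz_matrix :: "'c diagram \<Rightarrow> int mat \<Rightarrow> bool" where
  "irreducible_goeritz_matrix D G \<longleftrightarrow>
     (\<exists>Rs i j. distinct Rs \<and> checkerboard D (set Rs) \<and> i < length Rs \<and> j < length Rs \<and>
        G = mat_delete (goeritz_matrix D Rs) i j)"

section \<open>Integral elementary divisors\<close>

inductive Z_step :: "int mat \<Rightarrow> int mat \<Rightarrow> bool" where
  swap_rows: "k < dim_row A \<Longrightarrow> l < dim_row A \<Longrightarrow> Z_step A (swaprows k l A)"
| swap_cols: "k < dim_col A \<Longrightarrow> l < dim_col A \<Longrightarrow> Z_step A (swapcols k l A)"
| neg_row: "k < dim_row A \<Longrightarrow> Z_step A (multrow k (- 1) A)"
| neg_col: "k < dim_col A \<Longrightarrow> Z_step A (multcol k (- 1) A)"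
| add_row: "k < dim_row A \<Longrightarrow> l < dim_row A \<Longrightarrow> k \<noteq> l \<Longrightarrow> Z_step A (addrow a k l A)"
| add_col: "k < dim_col A \<Longrightarrow> l < dim_col A \<Longrightarrow> k \<noteq> l \<Longrightarrow> Z_step A (addcol a k l A)"
| stabilise: "Z_step A
    (four_block_mat (1\<^sub>m 1) (0\<^sub>m 1 (dim_col A)) (0\<^sub>m (dim_row A) 1) A)"
| destabilise: "Z_step
    (four_block_mat (1\<^sub>m 1) (0\<^sub>m 1 (dim_col A)) (0\<^sub>m (dim_row A) 1) A) A"

definition Z_equivalent :: "int mat \<Rightarrow> int mat \<Rightarrow> bool" where
  "Z_equivalent = Z_step\<^sup>*\<^sup>*"

definition elementary_divisors :: "int mat \<Rightarrow> int list \<Rightarrow> bool" where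
  "elementary_divisors A ds \<longleftrightarrow>
     (\<forall>d\<in>set ds. 0 \<le> d \<and> d \<noteq> 1) \<and>
     (\<forall>i. Suc i < length ds \<longrightarrow> ds ! i dvd ds ! Suc i) \<and>
     Z_equivalent A (mat_diag (length ds) (\<lambda>i. ds ! i))"

section \<open>The Goeritz invariant\<close>

text \<open>
  All irreducible Goeritz matrices of \<open>D\<close>, for both colourings and for every choice of the
  deleted row and column, are required to have the elementary divisors \<open>ds\<close>. The empty list
  plays the role of the sequence that is customarily written \<open>(1)\<close>.
\<close>

definition goeritz_invariant :: "'c diagram \<Rightarrow> int list \<Rightarrow> bool" where
  "goeritz_invariant D ds \<longleftrightarrow> link_diagram D \<and>
     (\<exists>G. irreducible_goeritz_matrix D G) \<and>
     (\<forall>G. irreducible_goeritz_matrix D G \<longrightarrow> elementary_divisors G ds)"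

section \<open>Closed braids and torus links\<close>

text \<open>
  A positive braid word is a list of generator indices: the letter \<open>i\<close> stands for
  \<open>\<sigma>\<^sub>i\<close>, the right-handed crossing of the strands in the positions \<open>i\<close> and \<open>i + 1\<close>. The
  crossings of the closure are the positions in the word. The braid runs upwards, so the
  crossing has the ends 0 (bottom right), 1 (top right), 2 (top left), 3 (bottom left). The
  opposite convention for \<open>\<sigma>\<^sub>i\<close> gives the mirror image, whose Goeritz matrices are the
  negatives of the ones here. Every strand is assumed to take part in some crossing.
\<close>

definition touches :: "nat list \<Rightarrow> nat \<Rightarrow> nat \<Rightarrow> bool" where
  "touches w t j \<longleftrightarrow> j = w ! t \<or> j = w ! t + 1"

definition bottom_end :: "nat list \<Rightarrow> nat \<Rightarrow> nat \<Rightarrow> nat \<times> nat" where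
  "bottom_end w t j = (t, if j = w ! t then 3 else 0)"

definition top_end :: "nat list \<Rightarrow> nat \<Rightarrow> nat \<Rightarrow> nat \<times> nat" where
  "top_end w t j = (t, if j = w ! t then 2 else 1)"

text \<open>
  The next crossing met above the crossing \<open>t\<close> in the position \<open>j\<close>, continuing cyclically
  because the braid is closed up. It can be \<open>t\<close> itself.
\<close>

definition next_crossing :: "nat list \<Rightarrow> nat \<Rightarrow> nat \<Rightarrow> nat" where
  "next_crossing w t j =
     (t + (LEAST k. 0 < k \<and> touches w ((t + k) mod length w) j)) mod length w"

definition braid_closure :: "nat list \<Rightarrow> nat diagram" where
  "braid_closure w =
     \<lparr>crossings = {..<length w},
      arcs = {{top_end w t j, bottom_end w (next_crossing w t j) j} | t j.
                t < length w \<and> touches w t j}\<rparr>"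

definition torus_link :: "nat \<Rightarrow> nat \<Rightarrow> nat diagram" where
  "torus_link p q = braid_closure (concat (replicate q [1..<p]))"

end

theory Submission
  imports Defs
begin

text \<open>
  An integral square matrix \<open>A\<close> is determined up to \<open>\<int>\<close>-equivalence by the number of solutions
  of \<open>A x = 0\<close> in the \<open>k\<close>-torsion of \<open>\<rat>/\<int>\<close>, for all \<open>k > 0\<close>: this number is invariant, for
  \<open>(d\<^sub>1) \<oplus> \<dots> \<oplus> (d\<^sub>n)\<close> it is \<open>\<Prod> gcd(d\<^sub>i, k)\<close>, and these products determine a divisor chain
  without ones.

  In the standard diagram of \<open>T(p,q)\<close> the crossings are \<open>(i,a)\<close> with \<open>0 < i < p\<close> and
  \<open>a \<in> \<int>/q\<close>, and the regions are arranged in columns \<open>0, \<dots>, p\<close>; a colouring selects the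
  columns of one parity. With \<open>t\<close> denoting the shift of the rows, the equation at a region in the
  column \<open>i\<close> reads \<open>x\<^bsub>i+2\<^esub> - x\<^sub>i = t\<^sup>2 (x\<^sub>i - x\<^bsub>i-2\<^esub>)\<close>. Hence the solutions modulo constants
  correspond, for both colourings, to the \<open>q\<close>-periodic sequences \<open>y\<close> with
  \<open>y\<^sub>0 + \<dots> + y\<^bsub>q-1\<^esub> = 0\<close> that are annihilated by \<open>(t\<^sup>p - (-1)\<^sup>p) / (t + 1)\<close>. Such a
  sequence satisfies \<open>t\<^sup>p y = (-1)\<^sup>p y\<close> and \<open>t\<^sup>q y = y\<close>, so it is given by its first
  \<open>gcd(p,q)\<close> terms up to signs, and counting the sequences becomes elementary.
\<close>

section \<open>The group of rational numbers modulo one\<close>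

\<comment> \<open>Every colouring and every choice of the deleted row and column has to be covered,
  so no Goeritz matrix is reduced explicitly; a number of solutions can be transported along
  bijections instead. Deleting a row and a column is harmless for it: row and column sums vanish, so
  solutions are taken modulo constants and one equation follows from the others. A count identifies
  divisors only once some diagonal form exists, whence the elimination. Q/Z contains a copy of Z/k
  for each k, so one module serves all k. The factor (t^p - (-1)^p)/(t + 1) comes from telescoping:
  the recurrence gives x_{i+2} - x_i = t^i (t - 1) Y, the increment of (t^i - (-1)^i)/(t + 1) Y from
  i to i + 2. This formula fits columns of either parity, hence both colourings. Passing to y = (1 -
  t^{-1}) Y kills additive constants; a periodic Y exists exactly when y sums to 0 over a period.
  Column p is one region, so its values are constant, which says that y is annihilated; if column p
  is not coloured, the equations at column p - 1 say the same.\<close>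
quotient_type qmodz = rat / "\<lambda>x y :: rat. x - y \<in> \<int>"
proof (rule equivpI)
  show "reflp (\<lambda>x y :: rat. x - y \<in> \<int>)" by (auto simp: reflp_def)
  show "symp (\<lambda>x y :: rat. x - y \<in> \<int>)"
    by (auto simp: symp_def) (metis Ints_minus minus_diff_eq)
  show "transp (\<lambda>x y :: rat. x - y \<in> \<int>)"
    by (auto simp: transp_def) (metis Ints_add add_diff_eq diff_add_cancel)
qed

instantiation qmodz :: ab_group_add
begin
lift_definition zero_qmodz :: qmodz is 0 .
lift_definition plus_qmodz :: "qmodz \<Rightarrow> qmodz \<Rightarrow> qmodz" is "(+)"
  by (metis Ints_add add_diff_add)
lift_definition uminus_qmodz :: "qmodz \<Rightarrow> qmodz" is uminus
  by (metis Ints_minus minus_diff_minus)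
lift_definition minus_qmodz :: "qmodz \<Rightarrow> qmodz \<Rightarrow> qmodz" is "(-)"
  by (metis Ints_diff diff_diff_eq2 add_diff_eq diff_add_eq diff_diff_add)
instance
  by standard (transfer; simp)+
end

lift_definition zmul :: "int \<Rightarrow> qmodz \<Rightarrow> qmodz" is "\<lambda>n x. of_int n * x"
  by (metis Ints_mult Ints_of_int right_diff_distrib)

interpretation zmul: Modules.module zmul
  by standard (transfer; simp add: algebra_simps)+

text \<open>The fractions \<open>j / m\<close> with 0 <= j < m represent every torsion element once;
  the remainder of the numerator modulo \<open>m\<close> selects the fraction.\<close>

lemma torsion_card:
  assumes "m > 0"
  shows "card {x. zmul m x = 0} = nat m"
proof -
  have z: "(abs_qmodz x = 0) = (x \<in> \<int>)" for x :: rat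
    by (transfer; simp)
  define f where "f j = abs_qmodz (of_int j / of_int m)" for j :: int
  have "bij_betw f {0..<m} {x. zmul m x = 0}"
  proof (rule bij_betw_imageI)
    show "inj_on f {0..<m}"
    proof (rule inj_onI)
      fix i j assume ij: "i \<in> {0..<m}" "j \<in> {0..<m}" and "f i = f j"
      then have "(of_int i / of_int m - of_int j / of_int m :: rat) \<in> \<int>"
        unfolding f_def by (simp add: qmodz.abs_eq_iff)
      then obtain c where "of_int i / of_int m - of_int j / of_int m = (of_int c :: rat)"
        by (auto elim: Ints_cases)
      then have "(of_int (i - j) :: rat) = of_int (c * m)" using assms by (simp add: field_simps)
      then have "i - j = c * m" using of_int_eq_iff by blast
      with ij assms show "i = j"
        by (metis add.commute atLeastLessThan_iff diff_add_cancel mod_mult_self1 mod_pos_pos_trivial)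
    qed
    show "f ` {0..<m} = {x. zmul m x = 0}"
    proof (intro equalityI subsetI)
      fix x assume "x \<in> f ` {0..<m}"
      then show "x \<in> {x. zmul m x = 0}" using assms by (auto simp: f_def zmul.abs_eq z)
    next
      fix x assume "x \<in> {x. zmul m x = 0}"
      moreover obtain y where y: "x = abs_qmodz y" by (metis Quotient_qmodz Quotient_abs_rep)
      ultimately have "of_int m * y \<in> \<int>" by (simp add: zmul.abs_eq z)
      then obtain c where c: "of_int m * y = of_int c" by (auto elim: Ints_cases)
      have "y = of_int (c div m * m + c mod m) / of_int m"
        using c assms by (simp add: field_simps)
      also have "\<dots> = of_int (c div m) + of_int (c mod m) / of_int m"
        using assms by (simp only: of_int_add of_int_mult) (simp add: field_simps)
      finally have "y - of_int (c mod m) / of_int m = of_int (c div m)" by simp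
      then have "x = f (c mod m)" unfolding y f_def by (simp add: qmodz.abs_eq_iff)
      then show "x \<in> f ` {0..<m}" using assms by auto
    qed
  qed
  then show ?thesis by (auto dest: bij_betw_same_card)
qed

text \<open>Bezout writes the gcd as an integral combination of the two multipliers; conversely the
  gcd divides both.\<close>

lemma torsion_gcd: "zmul m x = 0 \<and> zmul n x = 0 \<longleftrightarrow> zmul (gcd m n) x = 0"
proof
  assume a: "zmul m x = 0 \<and> zmul n x = 0"
  obtain u v where "u * m + v * n = gcd m n" using bezout_int by blast
  then have "zmul (gcd m n) x = zmul u (zmul m x) + zmul v (zmul n x)"
    by (metis zmul.scale_left_distrib zmul.scale_scale)
  with a show "zmul (gcd m n) x = 0" by simp
next
  assume a: "zmul (gcd m n) x = 0"
  have "zmul c x = 0" if "gcd m n dvd c" for c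
  proof -
    from that obtain d where "c = d * gcd m n" by (metis dvd_def mult.commute)
    with a show ?thesis by (metis zmul.scale_scale zmul.scale_zero_right)
  qed
  then show "zmul m x = 0 \<and> zmul n x = 0" by simp
qed

lemma card_torsion_gcd:
  "k > 0 \<Longrightarrow> card {x. zmul d x = 0 \<and> zmul k x = 0} = nat (gcd d k)"
  by (simp add: torsion_gcd torsion_card)

section \<open>Torsion kernels of integer matrices\<close>

definition mat_act :: "int mat \<Rightarrow> (nat \<Rightarrow> qmodz) \<Rightarrow> nat \<Rightarrow> qmodz" where
  "mat_act A x i = (\<Sum>j<dim_col A. zmul (A $$ (i, j)) (x j))"

text \<open>Vectors are total functions; vanishing beyond \<open>dim_col A\<close> gives each vector
  a single representative, so that \<open>card\<close> counts vectors.\<close>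

definition torsion_kernel :: "int mat \<Rightarrow> int \<Rightarrow> (nat \<Rightarrow> qmodz) set" where
  "torsion_kernel A k = {x. (\<forall>j. zmul k (x j) = 0) \<and> (\<forall>j\<ge>dim_col A. x j = 0) \<and>
     (\<forall>i<dim_row A. mat_act A x i = 0)}"

lemma card_eq_of_inverse:
  assumes "\<And>x. x \<in> A \<Longrightarrow> f x \<in> B \<and> g (f x) = x" and "\<And>y. y \<in> B \<Longrightarrow> g y \<in> A \<and> f (g y) = y"
  shows "card A = card B"
proof -
  have "bij_betw f A B" by (rule bij_betw_byWitness[where f' = g]) (use assms in auto)
  then show ?thesis by (rule bij_betw_same_card)
qed

lemma mat_act_swaprows:
  "i < dim_row A \<Longrightarrow> mat_act (swaprows k l A) x i =
    (if k = i then mat_act A x l else if l = i then mat_act A x k else mat_act A x i)"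
  by (simp add: mat_act_def)

lemma mat_act_multrow:
  "i < dim_row A \<Longrightarrow> mat_act (multrow k a A) x i =
    (if k = i then zmul a (mat_act A x i) else mat_act A x i)"
  by (simp add: mat_act_def zmul.scale_sum_right)

lemma mat_act_addrow:
  "i < dim_row A \<Longrightarrow> mat_act (addrow a k l A) x i =
    (if k = i then zmul a (mat_act A x l) + mat_act A x i else mat_act A x i)"
  by (simp add: mat_act_def zmul.scale_sum_right zmul.scale_left_distrib sum.distrib)

lemma mat_act_swapcols:
  assumes "i < dim_row A" "k < dim_col A" "l < dim_col A"
  shows "mat_act (swapcols k l A) x i = mat_act A (x \<circ> transpose k l) i"
  unfolding mat_act_def
  by (rule sum.reindex_bij_witness[of _ "transpose k l" "transpose k l"])
    (use assms in \<open>auto simp: transpose_def\<close>)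

lemma mat_act_multcol:
  "i < dim_row A \<Longrightarrow> mat_act (multcol k a A) x i = mat_act A (x(k := zmul a (x k))) i"
  unfolding mat_act_def by (rule sum.cong) (auto simp: mult.commute)

text \<open>Adding \<open>a\<close> times column \<open>l\<close> to column \<open>k\<close> acts on
  the variables by the transposed substitution: \<open>x l\<close> absorbs \<open>a\<close> times
  \<open>x k\<close>.\<close>

lemma mat_act_addcol:
  assumes "i < dim_row A" "k < dim_col A" "l < dim_col A" "k \<noteq> l"
  shows "mat_act (addcol a k l A) x i = mat_act A (x(l := x l + zmul a (x k))) i"
proof -
  have "mat_act A (x(l := x l + zmul a (x k))) i =
    (\<Sum>j<dim_col A. zmul (A $$ (i, j)) (x j) + (if j = l then zmul (A $$ (i, l)) (zmul a (x k)) else 0))"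
    unfolding mat_act_def by (rule sum.cong) (auto simp: zmul.scale_right_distrib)
  also have "\<dots> = (\<Sum>j<dim_col A. zmul (A $$ (i, j)) (x j)) + zmul (a * A $$ (i, l)) (x k)"
    using assms by (simp add: sum.distrib mult.commute)
  also have "\<dots> = (\<Sum>j<dim_col A. zmul (A $$ (i, j)) (x j) +
      (if j = k then zmul (a * A $$ (i, l)) (x k) else 0))"
    using assms by (simp add: sum.distrib)
  also have "\<dots> = mat_act (addcol a k l A) x i"
    unfolding mat_act_def by (rule sum.cong) (use assms in \<open>auto simp: zmul.scale_left_distrib add.commute\<close>)
  finally show ?thesis by simp
qed

text \<open>A column operation is an invertible change of variables \<open>g\<close>. If it respects
  torsion and support in both directions, it matches the two solution sets. Row operations keep the
  solution set itself.\<close>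

lemma card_torsion_kernel_col_op:
  assumes "dim_row B = dim_row A" "dim_col B = dim_col A"
    and act: "\<And>x i. i < dim_row A \<Longrightarrow> mat_act B x i = mat_act A (g x) i"
    and inv: "\<And>x. g (h x) = x" "\<And>x. h (g x) = x"
    and g: "\<And>x. \<forall>j. zmul m (x j) = 0 \<Longrightarrow> \<forall>j. zmul m (g x j) = 0"
      "\<And>x. \<forall>j\<ge>dim_col A. x j = 0 \<Longrightarrow> \<forall>j\<ge>dim_col A. g x j = 0"
    and h: "\<And>x. \<forall>j. zmul m (x j) = 0 \<Longrightarrow> \<forall>j. zmul m (h x j) = 0"
      "\<And>x. \<forall>j\<ge>dim_col A. x j = 0 \<Longrightarrow> \<forall>j\<ge>dim_col A. h x j = 0"
  shows "card (torsion_kernel A m) = card (torsion_kernel B m)"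
proof (rule card_eq_of_inverse[where f = h and g = g])
  fix x assume x: "x \<in> torsion_kernel A m"
  have "mat_act B (h x) i = 0" if "i < dim_row A" for i
    using that x act[of i "h x"] by (simp add: inv torsion_kernel_def)
  with x h[of x] show "h x \<in> torsion_kernel B m \<and> g (h x) = x"
    using assms(1,2) by (simp add: torsion_kernel_def inv)
next
  fix x assume x: "x \<in> torsion_kernel B m"
  have "mat_act A (g x) i = 0" if "i < dim_row A" for i
    using that x act[of i "x"] assms(1) by (simp add: torsion_kernel_def)
  with x g[of x] show "g x \<in> torsion_kernel A m \<and> h (g x) = x"
    using assms(1,2) by (simp add: torsion_kernel_def inv)
qed

text \<open>The new row reads \<open>x 0 = 0\<close>, so the new variable is forced to vanish and
  the others are merely renumbered.\<close>

lemma card_torsion_kernel_stabilise: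
  "card (torsion_kernel (four_block_mat (1\<^sub>m 1) (0\<^sub>m 1 (dim_col A)) (0\<^sub>m (dim_row A) 1) A) m) =
    card (torsion_kernel A m)"
proof -
  define B where "B = four_block_mat (1\<^sub>m 1) (0\<^sub>m 1 (dim_col A)) (0\<^sub>m (dim_row A) 1) A"
  have dims: "dim_row B = Suc (dim_row A)" "dim_col B = Suc (dim_col A)" by (simp_all add: B_def)
  have act0: "mat_act B x 0 = x 0" for x
    by (simp add: B_def mat_act_def sum.lessThan_Suc_shift del: sum.lessThan_Suc)
  have actS: "mat_act B x (Suc i) = mat_act A (x \<circ> Suc) i" if "i < dim_row A" for x i
    using that by (simp add: B_def mat_act_def sum.lessThan_Suc_shift del: sum.lessThan_Suc)
  have act: "(\<forall>i<Suc (dim_row A). mat_act B x i = 0) \<longleftrightarrow>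
      x 0 = 0 \<and> (\<forall>i<dim_row A. mat_act A (x \<circ> Suc) i = 0)" for x
    by (auto simp: less_Suc_eq_0_disj act0 actS)
  show ?thesis unfolding B_def[symmetric]
  proof (rule card_eq_of_inverse[where f = "\<lambda>x. x \<circ> Suc" and g = "case_nat 0"])
    fix x assume "x \<in> torsion_kernel B m"
    then show "x \<circ> Suc \<in> torsion_kernel A m \<and> case_nat 0 (x \<circ> Suc) = x"
      unfolding torsion_kernel_def dims using act[of x] by (auto simp: fun_eq_iff split: nat.splits)
  next
    fix x assume x: "x \<in> torsion_kernel A m"
    have [simp]: "case_nat 0 x \<circ> Suc = x" by auto
    from x show "case_nat 0 x \<in> torsion_kernel B m \<and> case_nat 0 x \<circ> Suc = x"
      unfolding torsion_kernel_def dims using act[of "case_nat 0 x"] by (auto split: nat.splits)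
  qed
qed

lemma card_torsion_kernel_Z_step:
  assumes "Z_step A B"
  shows "card (torsion_kernel A m) = card (torsion_kernel B m)"
  using assms
proof cases
  case (swap_rows k l)
  have "(\<forall>i<dim_row A. mat_act B x i = 0) \<longleftrightarrow> (\<forall>i<dim_row A. mat_act A x i = 0)" for x
    using swap_rows by (auto simp: mat_act_swaprows)
  then show ?thesis using swap_rows by (simp add: torsion_kernel_def)
next
  case (swap_cols k l)
  show ?thesis
    by (rule card_torsion_kernel_col_op[where g = "\<lambda>x. x \<circ> transpose k l" and h = "\<lambda>x. x \<circ> transpose k l"])
      (use swap_cols in \<open>auto simp: mat_act_swapcols fun_eq_iff transpose_def\<close>)
next
  case (neg_row k)
  have "(\<forall>i<dim_row A. mat_act B x i = 0) \<longleftrightarrow> (\<forall>i<dim_row A. mat_act A x i = 0)" for x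
    using neg_row by (auto simp: mat_act_multrow)
  then show ?thesis using neg_row by (simp add: torsion_kernel_def)
next
  case (neg_col k)
  show ?thesis
    by (rule card_torsion_kernel_col_op[where g = "\<lambda>x. x(k := - x k)" and h = "\<lambda>x. x(k := - x k)"])
      (use neg_col in \<open>auto simp: mat_act_multcol\<close>)
next
  case (add_row k l a)
  have "(\<forall>i<dim_row A. mat_act B x i = 0) \<longleftrightarrow> (\<forall>i<dim_row A. mat_act A x i = 0)" for x
    using add_row by (smt (verit) mat_act_addrow add_0 zmul.scale_zero_right)
  then show ?thesis using add_row by (simp add: torsion_kernel_def)
next
  case (add_col k l a)
  show ?thesis
    by (rule card_torsion_kernel_col_op[where g = "\<lambda>x. x(l := x l + zmul a (x k))"
          and h = "\<lambda>x. x(l := x l + zmul (- a) (x k))"])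
      (use add_col in \<open>auto simp: mat_act_addcol fun_eq_iff zmul.scale_right_distrib zmul.scale_right_diff_distrib zmul.scale_left_commute[of m]
        simp del: zmul.scale_scale\<close>)
next
  case stabilise
  then show ?thesis by (metis card_torsion_kernel_stabilise)
next
  case destabilise
  then show ?thesis by (metis card_torsion_kernel_stabilise)
qed

lemma card_torsion_kernel_Z_equivalent:
  assumes "Z_equivalent A B"
  shows "card (torsion_kernel A m) = card (torsion_kernel B m)"
  using assms unfolding Z_equivalent_def
  by (induction rule: rtranclp_induct) (auto dest: card_torsion_kernel_Z_step)

lemma card_finite_support_functions:
  fixes S :: "nat \<Rightarrow> 'a :: zero set"
  shows "card {x. (\<forall>j<n. x j \<in> S j) \<and> (\<forall>j\<ge>n. x j = 0)} = (\<Prod>j<n. card (S j))"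
proof -
  have "card {x. (\<forall>j<n. x j \<in> S j) \<and> (\<forall>j\<ge>n. x j = 0)} = card (Pi\<^sub>E {..<n} S)"
    by (rule card_eq_of_inverse[where f = "\<lambda>x. restrict x {..<n}" and g = "\<lambda>x j. if j < n then x j else 0"])
      (auto simp: fun_eq_iff PiE_iff extensional_def not_less)
  then show ?thesis by (simp add: card_PiE)
qed

text \<open>The equations decouple: coordinate \<open>j\<close> ranges over the elements killed by
  both \<open>ds ! j\<close> and \<open>m\<close>. A zero divisor leaves its coordinate free, in
  accordance with \<open>gcd 0 m = m\<close>.\<close>

lemma card_torsion_kernel_diag:
  assumes "m > 0" "\<And>d. d \<in> set ds \<Longrightarrow> d \<ge> 0"
  shows "int (card (torsion_kernel (mat_diag (length ds) (\<lambda>i. ds ! i)) m)) = (\<Prod>d\<leftarrow>ds. gcd d m)"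
proof -
  let ?n = "length ds" and ?A = "mat_diag (length ds) (\<lambda>i. ds ! i)"
  have "mat_act ?A x i = zmul (ds ! i) (x i)" if "i < ?n" for x i
  proof -
    have "mat_act ?A x i = (\<Sum>j<?n. if j = i then zmul (ds ! i) (x i) else 0)"
      unfolding mat_act_def by (rule sum.cong) (use that in \<open>auto simp: mat_diag_def\<close>)
    then show ?thesis using that by simp
  qed
  then have "torsion_kernel ?A m = {x. (\<forall>j<?n. x j \<in> {z. zmul (ds ! j) z = 0 \<and> zmul m z = 0}) \<and>
      (\<forall>j\<ge>?n. x j = 0)}"
    unfolding torsion_kernel_def
    by (auto simp: mat_diag_def) (metis not_less zmul.scale_zero_right)
  then have "int (card (torsion_kernel ?A m)) = (\<Prod>j<?n. int (card {z. zmul (ds ! j) z = 0 \<and> zmul m z = 0}))"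
    by (simp only: card_finite_support_functions of_nat_prod)
  also have "\<dots> = (\<Prod>j<?n. gcd (ds ! j) m)"
    using assms by (simp add: card_torsion_gcd)
  also have "\<dots> = (\<Prod>d\<leftarrow>ds. gcd d m)"
    by (simp add: prod.list_conv_set_nth atLeast0LessThan)
  finally show ?thesis .
qed

section \<open>Deleting a row and a column of a matrix with zero row and column sums\<close>

lemma torsion_kernel_delete_mem:
  assumes A: "A \<in> carrier_mat n n" and rows: "\<And>i. i < n \<Longrightarrow> (\<Sum>j<n. A $$ (i, j)) = 0"
    and "i < n" "j < n"
    and tors: "\<And>l. zmul k (x l) = 0" and ker: "\<And>i. i < n \<Longrightarrow> mat_act A x i = 0"
  shows "(\<lambda>l. if l < n - 1 then x (insert_index j l) - x j else 0) \<in> torsion_kernel (mat_delete A i j) k"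
proof -
  define z where "z = (\<lambda>l. if l < n - 1 then x (insert_index j l) - x j else 0)"
  have n: "n = Suc (n - 1)" using assms by simp
  have "mat_act (mat_delete A i j) z l = 0" if l: "l < n - 1" for l
  proof -
    define i' where "i' = insert_index i l"
    have i': "i' < n" using l by (auto simp: i'_def insert_index_def)
    have "mat_act (mat_delete A i j) z l = (\<Sum>h<n - 1. zmul (A $$ (i', insert_index j h)) (x (insert_index j h) - x j))"
      unfolding mat_act_def
    proof (rule sum.cong)
      show "{..<dim_col (mat_delete A i j)} = {..<n - 1}" using A by simp
      fix h assume "h \<in> {..<n - 1}"
      then show "zmul (mat_delete A i j $$ (l, h)) (z h) = zmul (A $$ (i', insert_index j h)) (x (insert_index j h) - x j)"
        using A n mat_delete_index[of A "n - 1" i j l h] l assms by (simp add: z_def i'_def)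
    qed
    also have "\<dots> = (\<Sum>h\<in>insert_index j ` {0..<n - 1}. zmul (A $$ (i', h)) (x h - x j))"
      by (subst sum.reindex[OF insert_index_inj_on]) (simp add: atLeast0LessThan)
    \<comment> \<open>The term at \<open>j\<close> vanishes, so column \<open>j\<close> may be put
      back; the zero row sum then absorbs the subtracted constant \<open>x j\<close>.\<close>
    also have "\<dots> = (\<Sum>h<n. zmul (A $$ (i', h)) (x h - x j))"
      using n \<open>j < n\<close> insert_index_image[of j "n - 1"]
      by (intro sum.mono_neutral_left) (auto simp: atLeast0LessThan)
    also have "\<dots> = mat_act A x i' - zmul (\<Sum>h<n. A $$ (i', h)) (x j)"
      using A by (simp add: mat_act_def zmul.scale_right_diff_distrib sum_subtractf zmul.scale_sum_left)
    finally show ?thesis using ker[OF i'] rows[OF i'] by simp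
  qed
  moreover have "zmul k (z l) = 0" for l by (simp add: z_def zmul.scale_right_diff_distrib tors)
  ultimately show ?thesis
    unfolding z_def[symmetric] using A by (simp add: torsion_kernel_def) (simp add: z_def)
qed

text \<open>The deleted variable is set to 0. The deleted equation holds as well, because zero
  column sums make all equations add up to 0.\<close>

lemma torsion_kernel_delete_lift:
  assumes A: "A \<in> carrier_mat n n" and cols: "\<And>j. j < n \<Longrightarrow> (\<Sum>i<n. A $$ (i, j)) = 0"
    and "i < n" "j < n" and z: "z \<in> torsion_kernel (mat_delete A i j) k"
  obtains x where "\<And>l. zmul k (x l) = 0" "\<And>i. i < n \<Longrightarrow> mat_act A x i = 0"
    "z = (\<lambda>l. if l < n - 1 then x (insert_index j l) - x j else 0)"
proof -
  define x where "x h = (if h = j then 0 else z (delete_index j h))" for h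
  have n: "n = Suc (n - 1)" using assms by simp
  have xz: "x (insert_index j l) = z l" for l by (simp add: x_def)
  have xj: "x j = 0" by (simp add: x_def)
  have act: "mat_act A x (insert_index i l) = 0" if l: "l < n - 1" for l
  proof -
    define i' where "i' = insert_index i l"
    have "mat_act A x i' = (\<Sum>h\<in>insert_index j ` {0..<n - 1}. zmul (A $$ (i', h)) (x h))"
      unfolding mat_act_def using A n \<open>j < n\<close> insert_index_image[of j "n - 1"] xj
      by (intro sum.mono_neutral_right) (auto simp: atLeast0LessThan)
    also have "\<dots> = (\<Sum>h<n - 1. zmul (A $$ (i', insert_index j h)) (z h))"
      by (subst sum.reindex[OF insert_index_inj_on]) (simp add: atLeast0LessThan xz)
    also have "\<dots> = mat_act (mat_delete A i j) z l"
      unfolding mat_act_def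
    proof (rule sum.cong)
      show "{..<n - 1} = {..<dim_col (mat_delete A i j)}" using A by simp
      fix h assume "h \<in> {..<dim_col (mat_delete A i j)}"
      then show "zmul (A $$ (i', insert_index j h)) (z h) = zmul (mat_delete A i j $$ (l, h)) (z h)"
        using A n mat_delete_index[of A "n - 1" i j l h] l assms by (simp add: i'_def)
    qed
    also have "\<dots> = 0" using z l A by (simp add: torsion_kernel_def)
    finally show ?thesis by (simp add: i'_def)
  qed
  have total: "(\<Sum>h<n. mat_act A x h) = 0"
  proof -
    have "(\<Sum>h<n. mat_act A x h) = (\<Sum>l<n. \<Sum>h<n. zmul (A $$ (h, l)) (x l))"
      unfolding mat_act_def using A by (subst sum.swap) simp
    also have "\<dots> = (\<Sum>l<n. zmul (\<Sum>h<n. A $$ (h, l)) (x l))"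
      by (simp add: zmul.scale_sum_left)
    finally show ?thesis using cols by simp
  qed
  have others: "mat_act A x h = 0" if "h < n" "h \<noteq> i" for h
  proof -
    have "h \<in> insert_index i ` {0..<n - 1}" using insert_index_image[of i "n - 1"] that n \<open>i < n\<close> by auto
    then show ?thesis using act by auto
  qed
  have "mat_act A x i = 0"
  proof -
    have "(\<Sum>h<n. mat_act A x h) = mat_act A x i + (\<Sum>h\<in>{..<n} - {i}. mat_act A x h)"
      using \<open>i < n\<close> by (intro sum.remove) auto
    then show ?thesis using total others by simp
  qed
  with others have ker: "mat_act A x h = 0" if "h < n" for h using that by blast
  have "zmul k (x l) = 0" for l using z by (simp add: x_def torsion_kernel_def)
  moreover have "z = (\<lambda>l. if l < n - 1 then x (insert_index j l) - x j else 0)"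
    using z A by (auto simp: fun_eq_iff xz xj torsion_kernel_def)
  ultimately show thesis using ker that by blast
qed

section \<open>Smith normal form\<close>

text \<open>From \<open>i\<close> on, every factor \<open>gcd (e j) k\<close> has its largest
  possible value \<open>k\<close>. The products agree and so do the first \<open>i\<close> factors,
  so the factors of \<open>t\<close> from \<open>i\<close> on must be maximal as well, in particular
  the one at \<open>i\<close>.\<close>

lemma chain_dvd_transfer:
  fixes e t :: "nat \<Rightarrow> int"
  assumes chain: "\<And>j. Suc j < n \<Longrightarrow> e j dvd e (Suc j)"
    and eq: "(\<Prod>j<n. gcd (e j) k) = (\<Prod>j<n. gcd (t j) k)"
    and i: "i < n" and less: "\<And>j. j < i \<Longrightarrow> e j = t j" and k: "k > 0" "k dvd e i"
  shows "k dvd t i"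
proof (rule ccontr)
  assume nd: "\<not> k dvd t i"
  have split: "(\<Prod>j<n. f j) = (\<Prod>j<i. f j) * (\<Prod>j=i..<n. f j)" for f :: "nat \<Rightarrow> int"
    using i by (metis atLeast0LessThan less_imp_le_nat prod.atLeastLessThan_concat zero_le)
  have e: "e i dvd e j" if "i \<le> j" "j < n" for j
    using that by (induction j rule: dec_induct) (auto intro: dvd_trans chain)
  have "(\<Prod>j=i..<n. gcd (e j) k) = (\<Prod>j=i..<n. k)"
  proof (rule prod.cong)
    fix x assume "x \<in> {i..<n}"
    then have "k dvd e x" using e k(2) dvd_trans by auto
    then show "gcd (e x) k = k" using k(1) by (simp add: gcd_proj2_if_dvd_int)
  qed simp
  moreover have "(\<Prod>j<i. gcd (e j) k) = (\<Prod>j<i. gcd (t j) k)" by (simp add: less)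
  moreover have "(\<Prod>j<i. gcd (t j) k) > 0" using k by (intro prod_pos) auto
  ultimately have "(\<Prod>j=i..<n. k) = (\<Prod>j=i..<n. gcd (t j) k)"
    using eq unfolding split by (metis mult_left_cancel less_irrefl)
  moreover have "(\<Prod>j=i..<n. gcd (t j) k) < (\<Prod>j=i..<n. k)"
  proof -
    have "gcd (t i) k < k"
      using k nd by (metis gcd_dvd1 gcd_dvd2 zdvd_imp_le order_le_less)
    moreover have "(\<Prod>j=Suc i..<n. gcd (t j) k) \<le> (\<Prod>j=Suc i..<n. k)"
      using k by (intro prod_mono) (auto intro: zdvd_imp_le)
    moreover have "(\<Prod>j=Suc i..<n. gcd (t j) k) > 0" "(\<Prod>j=Suc i..<n. k) > 0"
      using k by (auto intro!: prod_pos)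
    ultimately have "gcd (t i) k * (\<Prod>j=Suc i..<n. gcd (t j) k) < k * (\<Prod>j=Suc i..<n. k)"
      using k by (intro mult_less_le_imp_less) auto
    then show ?thesis by (simp only: prod.atLeast_Suc_lessThan[OF i])
  qed
  ultimately show False by simp
qed

lemma nonneg_eq_of_dvd_iff:
  fixes a b :: int
  assumes "a \<ge> 0" "b \<ge> 0" "\<And>k. k > 0 \<Longrightarrow> k dvd a \<longleftrightarrow> k dvd b"
  shows "a = b"
proof (cases "a = 0 \<or> b = 0")
  case True
  \<comment> \<open>The number \<open>a + b + 1\<close> divides 0 but no positive number up to
    \<open>a + b\<close>, so it separates zero from nonzero.\<close>
  moreover have "\<not> a + b + 1 dvd a + b" if "a + b > 0" using that zdvd_imp_le by fastforce
  moreover have "a + b + 1 dvd a \<longleftrightarrow> a + b + 1 dvd b" using assms by simp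
  ultimately show ?thesis using assms(1,2) by (cases "a + b > 0") auto
next
  case False
  then have "a dvd b" "b dvd a" using assms(3)[of a] assms(3)[of b] assms(1,2) by auto
  then show ?thesis using assms(1,2) zdvd_antisym_nonneg by blast
qed

lemma chain_unique:
  fixes e t :: "nat \<Rightarrow> int"
  assumes "\<And>j. Suc j < n \<Longrightarrow> e j dvd e (Suc j)" "\<And>j. Suc j < n \<Longrightarrow> t j dvd t (Suc j)"
    and "\<And>j. j < n \<Longrightarrow> e j \<ge> 0" "\<And>j. j < n \<Longrightarrow> t j \<ge> 0"
    and eq: "\<And>k. k > 0 \<Longrightarrow> (\<Prod>j<n. gcd (e j) k) = (\<Prod>j<n. gcd (t j) k)"
    and "i < n"
  shows "e i = t i"
  using \<open>i < n\<close>
proof (induction i rule: less_induct)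
  case (less i)
  then have l: "e j = t j" if "j < i" for j using that by simp
  show ?case
  proof (rule nonneg_eq_of_dvd_iff)
    fix k :: int assume k: "k > 0"
    show "k dvd e i \<longleftrightarrow> k dvd t i"
      using chain_dvd_transfer[of n e k t i] chain_dvd_transfer[of n t k e i] assms(1,2) eq[OF k]
        less.prems l k by metis
  qed (use assms less.prems in auto)
qed

definition divisor_chain :: "int list \<Rightarrow> bool" where
  "divisor_chain ds \<longleftrightarrow> (\<forall>d\<in>set ds. 0 \<le> d) \<and> (\<forall>i. Suc i < length ds \<longrightarrow> ds ! i dvd ds ! Suc i)"

lemma divisor_chain_pad:
  assumes "divisor_chain ds" shows "divisor_chain (replicate c 1 @ ds)"
  using assms unfolding divisor_chain_def
  by (auto simp: nth_append Suc_diff_le not_less)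

lemma prod_list_nth: "prod_list (map f xs) = (\<Prod>j<length xs. f (xs ! j))"
  by (simp add: prod.list_conv_set_nth atLeast0LessThan)

lemma divisor_chain_unique_length:
  assumes "divisor_chain es" "divisor_chain ts" "length es = length ts"
    and "\<And>k. k > 0 \<Longrightarrow> (\<Prod>d\<leftarrow>es. gcd d k) = (\<Prod>d\<leftarrow>ts. gcd d k)"
  shows "es = ts"
proof (rule nth_equalityI[OF assms(3)])
  fix i assume "i < length es"
  then show "es ! i = ts ! i"
    by (intro chain_unique[of "length es" "(!) es" "(!) ts"])
      (use assms in \<open>auto simp: divisor_chain_def prod_list_nth\<close>)
qed

text \<open>Ones in front spoil neither the divisibilities nor the gcd products, so the shorter
  chain may be padded; as \<open>ts\<close> contains no 1, the padding is empty.\<close>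

lemma divisor_chain_unique_aux:
  assumes "divisor_chain es" "1 \<notin> set es" "divisor_chain ts" "1 \<notin> set ts"
    and "\<And>k. k > 0 \<Longrightarrow> (\<Prod>d\<leftarrow>es. gcd d k) = (\<Prod>d\<leftarrow>ts. gcd d k)"
    and "length es \<le> length ts"
  shows "es = ts"
proof -
  define c where "c = length ts - length es"
  have "replicate c 1 @ es = ts"
    by (rule divisor_chain_unique_length)
      (use assms in \<open>auto simp: c_def divisor_chain_pad\<close>)
  moreover from this have "c = 0" using assms(4) by (cases c) auto
  ultimately show ?thesis by simp
qed

lemma divisor_chain_unique:
  assumes "divisor_chain es" "1 \<notin> set es" "divisor_chain ts" "1 \<notin> set ts"
    and "\<And>k. k > 0 \<Longrightarrow> (\<Prod>d\<leftarrow>es. gcd d k) = (\<Prod>d\<leftarrow>ts. gcd d k)"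
  shows "es = ts"
  using assms divisor_chain_unique_aux[of es ts] divisor_chain_unique_aux[of ts es]
  by (metis nle_le)

section \<open>Reduction to diagonal form by elementary steps\<close>

lemma Z_equivalent_refl: "Z_equivalent A A"
  by (simp add: Z_equivalent_def)

lemma Z_equivalent_step: "Z_equivalent A B \<Longrightarrow> Z_step B C \<Longrightarrow> Z_equivalent A C"
  by (simp add: Z_equivalent_def)

lemma Z_equivalent_trans: "Z_equivalent A B \<Longrightarrow> Z_equivalent B C \<Longrightarrow> Z_equivalent A C"
  by (simp add: Z_equivalent_def)

text \<open>
  The elimination works in place: \<open>B\<close> is equivalent to \<open>A\<close>, its first \<open>k\<close> rows and columns are
  diagonal, and their diagonal entries divide everything that comes later.
\<close>

definition smith_upto :: "nat \<Rightarrow> nat \<Rightarrow> int mat \<Rightarrow> int mat \<Rightarrow> bool" where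
  "smith_upto n k A B \<longleftrightarrow> Z_equivalent A B \<and> B \<in> carrier_mat n n \<and>
     (\<forall>i<k. \<forall>j<n. j \<noteq> i \<longrightarrow> B $$ (i, j) = 0 \<and> B $$ (j, i) = 0) \<and>
     (\<forall>i<k. B $$ (i, i) \<ge> 0 \<and> (\<forall>a\<in>{i..<n}. \<forall>b\<in>{i..<n}. B $$ (i, i) dvd B $$ (a, b)))"

text \<open>With both indices at least \<open>k\<close>, the operation meets only zeros in the
  finished rows and columns, and integral combinations remain divisible by the finished diagonal
  entries.\<close>

lemma smith_upto_addrow:
  assumes "smith_upto n k A B" "k \<le> r" "k \<le> s" "r < n" "s < n" "r \<noteq> s"
  shows "smith_upto n k A (addrow c r s B)"
  using assms unfolding smith_upto_def
  by (auto intro: Z_equivalent_step[OF _ Z_step.add_row])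

lemma smith_upto_addcol:
  assumes "smith_upto n k A B" "k \<le> r" "k \<le> s" "r < n" "s < n" "r \<noteq> s"
  shows "smith_upto n k A (addcol c r s B)"
  using assms unfolding smith_upto_def
  by (auto intro: Z_equivalent_step[OF _ Z_step.add_col])

lemma smith_upto_swaprows:
  assumes "smith_upto n k A B" "k \<le> r" "k \<le> s" "r < n" "s < n"
  shows "smith_upto n k A (swaprows r s B)"
  using assms unfolding smith_upto_def
  by (auto intro: Z_equivalent_step[OF _ Z_step.swap_rows])

lemma smith_upto_swapcols:
  assumes "smith_upto n k A B" "k \<le> r" "k \<le> s" "r < n" "s < n"
  shows "smith_upto n k A (swapcols r s B)"
  using assms unfolding smith_upto_def
  by (auto intro: Z_equivalent_step[OF _ Z_step.swap_cols])

lemma smith_upto_negrow: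
  assumes "smith_upto n k A B" "k \<le> r" "r < n"
  shows "smith_upto n k A (multrow r (- 1) B)"
  using assms unfolding smith_upto_def
  by (auto intro: Z_equivalent_step[OF _ Z_step.neg_row])

lemma smith_upto_carrier: "smith_upto n k A B \<Longrightarrow> dim_row B = n \<and> dim_col B = n"
  by (auto simp: smith_upto_def)

lemma smith_upto_Suc:
  assumes "smith_upto n k A B" "k < n"
  shows "\<exists>C. smith_upto n (Suc k) A C"
proof (cases "\<forall>a\<in>{k..<n}. \<forall>b\<in>{k..<n}. B $$ (a, b) = 0")
  case True
  have "B $$ (k, j) = 0 \<and> B $$ (j, k) = 0" if "j < n" "j \<noteq> k" for j
    using assms True that unfolding smith_upto_def by (cases "j < k") auto
  then have "smith_upto n (Suc k) A B"
    using assms True unfolding smith_upto_def by (auto simp: less_Suc_eq)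
  then show ?thesis by blast
next
  case False
  \<comment> \<open>A nonzero entry of least absolute value among all matrices that can be reached divides every
    entry below and to the right: otherwise a remainder would be smaller.\<close>
  define S where "S = {nat \<bar>C $$ (a, b)\<bar> | C a b. smith_upto n k A C \<and> k \<le> a \<and> a < n \<and> k \<le> b \<and> b < n \<and> C $$ (a, b) \<noteq> 0}"
  define m where "m = (LEAST s. s \<in> S)"
  have "\<exists>s. s \<in> S" using False assms unfolding S_def by fastforce
  then have "m \<in> S" unfolding m_def by (rule LeastI_ex)
  then obtain C a b where C: "smith_upto n k A C" "k \<le> a" "a < n" "k \<le> b" "b < n"
    "C $$ (a, b) \<noteq> 0" and m: "m = nat \<bar>C $$ (a, b)\<bar>"
    unfolding S_def by blast
  define d where "d = int m"
  have d: "d > 0" "d = \<bar>C $$ (a, b)\<bar>" using C m by (auto simp: d_def)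
  have least: "D $$ (i, j) = 0 \<or> d \<le> \<bar>D $$ (i, j)\<bar>"
    if "smith_upto n k A D" "k \<le> i" "i < n" "k \<le> j" "j < n" for D i j
  proof (cases "D $$ (i, j) = 0")
    case False
    then have "nat \<bar>D $$ (i, j)\<bar> \<in> S" using that unfolding S_def by blast
    then have "m \<le> nat \<bar>D $$ (i, j)\<bar>" unfolding m_def by (rule Least_le)
    then show ?thesis unfolding d_def using False by linarith
  qed simp
  have mod: "D $$ (i, j) = 0"
    if "smith_upto n k A D" "k \<le> i" "i < n" "k \<le> j" "j < n" "D $$ (i, j) = e mod d" for D i j e
    using least[OF that(1-5)] that(6) d(1) pos_mod_bound[of d e] pos_mod_sign[of d e] by linarith
  \<comment> \<open>The minimal entry is brought to the corner with positive sign; then the column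
    below it is cleared one row at a time. Each remainder modulo \<open>d\<close> is an entry of a
    reachable matrix and smaller than \<open>d\<close>, hence 0.\<close>
  have "\<exists>D. smith_upto n k A D \<and> D $$ (k, k) = d \<and> (\<forall>i. k < i \<and> i < s \<longrightarrow> D $$ (i, k) = 0)"
    if "s \<le> n" for s
    using that
  proof (induction s)
    case 0
    define E where "E = swapcols k b (swaprows k a C)"
    have E: "smith_upto n k A E" unfolding E_def
      using C assms by (intro smith_upto_swapcols smith_upto_swaprows) auto
    have Ek: "E $$ (k, k) = C $$ (a, b)"
      unfolding E_def using C assms smith_upto_carrier[OF C(1)] by auto
    show ?case
    proof (cases "C $$ (a, b) > 0")
      case True
      then show ?thesis using E Ek d by auto
    next
      case False
      have "multrow k (- 1) E $$ (k, k) = d"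
        using E assms Ek d False smith_upto_carrier[OF E] by auto
      then show ?thesis using smith_upto_negrow[OF E] assms by blast
    qed
  next
    case (Suc s)
    then obtain D where D: "smith_upto n k A D" "D $$ (k, k) = d"
      "\<forall>i. k < i \<and> i < s \<longrightarrow> D $$ (i, k) = 0" by auto
    note dims = smith_upto_carrier[OF D(1)]
    show ?case
    proof (cases "k < s")
      case False
      then show ?thesis using D by (intro exI[of _ D]) auto
    next
      case True
      define E where "E = addrow (- (D $$ (s, k) div d)) s k D"
      have E: "smith_upto n k A E" unfolding E_def
        using D assms True Suc by (intro smith_upto_addrow) auto
      have idx: "E $$ (i, j) = (if s = i then - (D $$ (s, k) div d) * D $$ (k, j) + D $$ (i, j) else D $$ (i, j))"
        if "i < n" "j < n" for i j
        using that dims by (simp add: E_def)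
      have "E $$ (s, k) = D $$ (s, k) mod d"
        using idx[of s k] Suc.prems assms D(2) by (simp add: minus_div_mult_eq_mod[symmetric])
      then have "E $$ (s, k) = 0"
        using mod[OF E, of s k "D $$ (s, k)"] True Suc.prems assms by simp
      moreover have "E $$ (k, k) = d" using idx[of k k] D assms True by auto
      moreover have "E $$ (i, k) = 0" if "k < i" "i < s" for i
        using idx[of i k] D(3) that Suc.prems assms by auto
      ultimately show ?thesis using E by (intro exI[of _ E]) (auto simp: less_Suc_eq)
    qed
  qed
  from this[of n] obtain D where D: "smith_upto n k A D" "D $$ (k, k) = d"
    "\<forall>i. k < i \<and> i < n \<longrightarrow> D $$ (i, k) = 0" by auto
  \<comment> \<open>Apart from the corner, column \<open>k\<close> is now zero, so subtracting
    multiples of it from later columns alters only row \<open>k\<close>.\<close>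
  have "\<exists>D. smith_upto n k A D \<and> D $$ (k, k) = d \<and> (\<forall>i. k < i \<and> i < n \<longrightarrow> D $$ (i, k) = 0) \<and>
      (\<forall>i. k < i \<and> i < s \<longrightarrow> D $$ (k, i) = 0)"
    if "s \<le> n" for s
    using that
  proof (induction s)
    case 0
    then show ?case using D by blast
  next
    case (Suc s)
    then obtain D where D: "smith_upto n k A D" "D $$ (k, k) = d"
      "\<forall>i. k < i \<and> i < n \<longrightarrow> D $$ (i, k) = 0" "\<forall>i. k < i \<and> i < s \<longrightarrow> D $$ (k, i) = 0" by auto
    note dims = smith_upto_carrier[OF D(1)]
    show ?case
    proof (cases "k < s")
      case False
      then show ?thesis using D by (intro exI[of _ D]) auto
    next
      case True
      define E where "E = addcol (- (D $$ (k, s) div d)) s k D"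
      have E: "smith_upto n k A E" unfolding E_def
        using D assms True Suc by (intro smith_upto_addcol) auto
      have idx: "E $$ (i, j) = (if s = j then - (D $$ (k, s) div d) * D $$ (i, k) + D $$ (i, j) else D $$ (i, j))"
        if "i < n" "j < n" for i j
        using that dims by (simp add: E_def)
      have "E $$ (k, s) = D $$ (k, s) mod d"
        using idx[of k s] Suc.prems assms D(2) by (simp add: minus_div_mult_eq_mod[symmetric])
      then have "E $$ (k, s) = 0"
        using mod[OF E, of k s "D $$ (k, s)"] True Suc.prems assms by simp
      moreover have "E $$ (k, k) = d" using idx[of k k] D assms True by auto
      moreover have "E $$ (i, k) = 0" if "k < i" "i < n" for i
        using idx[of i k] D(3) that Suc.prems assms True by auto
      moreover have "E $$ (k, i) = 0" if "k < i" "i < s" for i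
        using idx[of k i] D(4) that Suc.prems assms by auto
      ultimately show ?thesis using E by (intro exI[of _ E]) (auto simp: less_Suc_eq)
    qed
  qed
  from this[of n] obtain E where E: "smith_upto n k A E" "E $$ (k, k) = d"
    "\<forall>i. k < i \<and> i < n \<longrightarrow> E $$ (i, k) = 0" "\<forall>i. k < i \<and> i < n \<longrightarrow> E $$ (k, i) = 0" by auto
  note dims = smith_upto_carrier[OF E(1)]
  \<comment> \<open>Adding row \<open>i\<close> to row \<open>k\<close> keeps the corner
    \<open>d\<close> and copies the entry at \<open>(i, j)\<close> to \<open>(k, j)\<close>;
    reducing it by column \<open>k\<close> leaves its remainder modulo \<open>d\<close>
    there.\<close>
  have dvd: "d dvd E $$ (i, j)" if "k < i" "i < n" "k < j" "j < n" for i j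
  proof -
    define F where "F = addrow 1 k i E"
    have F: "smith_upto n k A F" unfolding F_def
      using E assms that by (intro smith_upto_addrow) auto
    define G where "G = addcol (- (E $$ (i, j) div d)) j k F"
    have G: "smith_upto n k A G" unfolding G_def
      using F assms that by (intro smith_upto_addcol) auto
    have "G $$ (k, j) = E $$ (i, j) mod d"
      using that assms E dims by (simp add: G_def F_def minus_div_mult_eq_mod[symmetric])
    then have "G $$ (k, j) = 0"
      using mod[OF G, of k j "E $$ (i, j)"] that assms by simp
    with \<open>G $$ (k, j) = E $$ (i, j) mod d\<close> show ?thesis by auto
  qed
  have "d dvd E $$ (i, j)" if "k \<le> i" "i < n" "k \<le> j" "j < n" for i j
    using that dvd[of i j] E by (cases "i = k"; cases "j = k") auto
  moreover have "E $$ (k, j) = 0 \<and> E $$ (j, k) = 0" if "j < n" "j \<noteq> k" for j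
    using E assms that unfolding smith_upto_def by (cases "j < k") auto
  ultimately have "smith_upto n (Suc k) A E"
    using E d(1) unfolding smith_upto_def by (auto simp: less_Suc_eq)
  then show ?thesis by blast
qed

lemma smith_normal_form:
  assumes "A \<in> carrier_mat n n"
  shows "\<exists>f. Z_equivalent A (mat_diag n f) \<and> (\<forall>i<n. f i \<ge> 0) \<and> (\<forall>i. Suc i < n \<longrightarrow> f i dvd f (Suc i))"
proof -
  have "\<exists>B. smith_upto n k A B" if "k \<le> n" for k
    using that
  proof (induction k)
    case 0
    then show ?case using assms by (intro exI[of _ A]) (auto simp: smith_upto_def Z_equivalent_refl)
  next
    case (Suc k)
    then show ?case using smith_upto_Suc by auto
  qed
  from this[of n] obtain B where B: "smith_upto n n A B" by auto
  have "B = mat_diag n (\<lambda>i. B $$ (i, i))"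
    by (rule eq_matI) (use B in \<open>auto simp: smith_upto_def mat_diag_def\<close>)
  with B show ?thesis
    by (intro exI[of _ "\<lambda>i. B $$ (i, i)"]) (auto simp: smith_upto_def)
qed

lemma elementary_divisors_Z_equivalent:
  "Z_equivalent A B \<Longrightarrow> elementary_divisors B ds \<Longrightarrow> elementary_divisors A ds"
  by (auto simp: elementary_divisors_def intro: Z_equivalent_trans)

text \<open>In a chain the ones come first. A leading 1 is removed by one destabilisation; a head
  other than 1 rules out any 1 behind it, since it divides every later entry.\<close>

lemma elementary_divisors_mat_diag:
  assumes "\<forall>d\<in>set ds. 0 \<le> d" "\<forall>i. Suc i < length ds \<longrightarrow> ds ! i dvd ds ! Suc i"
  shows "\<exists>es. elementary_divisors (mat_diag (length ds) (\<lambda>i. ds ! i)) es"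
  using assms
proof (induction ds)
  case Nil
  then show ?case by (intro exI[of _ "[]"]) (auto simp: elementary_divisors_def Z_equivalent_refl)
next
  case (Cons d ds)
  show ?case
  proof (cases "d = 1")
    case True
    let ?A = "mat_diag (length ds) (\<lambda>i. ds ! i)"
    have "mat_diag (length (d # ds)) (\<lambda>i. (d # ds) ! i) =
      four_block_mat (1\<^sub>m 1) (0\<^sub>m 1 (dim_col ?A)) (0\<^sub>m (dim_row ?A) 1) ?A"
      by (rule eq_matI) (auto simp: True mat_diag_def nth_Cons split: nat.splits)
    then have "Z_step (mat_diag (length (d # ds)) (\<lambda>i. (d # ds) ! i)) ?A"
      using Z_step.destabilise[of ?A] by metis
    moreover have "\<exists>es. elementary_divisors ?A es"
      using Cons by (metis Suc_less_eq length_Cons list.set_intros(2) nth_Cons_Suc)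
    ultimately show ?thesis
      using elementary_divisors_Z_equivalent Z_equivalent_step[OF Z_equivalent_refl] by blast
  next
    case False
    have "d dvd (d # ds) ! i" if "i < length (d # ds)" for i
      using that by (induction i) (use Cons.prems(2) in \<open>auto intro: dvd_trans\<close>)
    then have "1 \<notin> set (d # ds)"
      using False Cons.prems(1) by (metis in_set_conv_nth list.set_intros(1) zdvd1_eq abs_of_nonneg)
    then show ?thesis using Cons.prems
      by (intro exI[of _ "d # ds"]) (auto simp: elementary_divisors_def Z_equivalent_refl)
  qed
qed

lemma elementary_divisors_exist:
  assumes "A \<in> carrier_mat n n"
  shows "\<exists>ds. elementary_divisors A ds"
proof -
  obtain f where f: "Z_equivalent A (mat_diag n f)" "\<forall>i<n. f i \<ge> 0" "\<forall>i. Suc i < n \<longrightarrow> f i dvd f (Suc i)"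
    using smith_normal_form[OF assms] by blast
  define ds where "ds = map f [0..<n]"
  have eq: "mat_diag n f = mat_diag (length ds) (\<lambda>i. ds ! i)"
    by (rule eq_matI) (auto simp: ds_def mat_diag_def)
  have "\<exists>es. elementary_divisors (mat_diag (length ds) (\<lambda>i. ds ! i)) es"
    by (rule elementary_divisors_mat_diag) (use f in \<open>auto simp: ds_def\<close>)
  then obtain es where es: "elementary_divisors (mat_diag n f) es" unfolding eq ..
  have "elementary_divisors A es"
    using es elementary_divisors_Z_equivalent[OF f(1)] by blast
  then show ?thesis ..
qed

text \<open>The Smith form supplies some list \<open>es\<close> of elementary divisors; the counts
  then force it to be \<open>ds\<close>.\<close>

lemma elementary_divisors_of_card_torsion_kernel:
  assumes A: "A \<in> carrier_mat n n" and ds: "divisor_chain ds" "1 \<notin> set ds"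
    and card: "\<And>k. k > 0 \<Longrightarrow> int (card (torsion_kernel A k)) = (\<Prod>d\<leftarrow>ds. gcd d k)"
  shows "elementary_divisors A ds"
proof -
  obtain es where es: "elementary_divisors A es" using elementary_divisors_exist[OF A] by blast
  then have nonneg: "\<And>d. d \<in> set es \<Longrightarrow> d \<ge> 0" by (simp add: elementary_divisors_def)
  have "es = ds"
  proof (rule divisor_chain_unique)
    show "divisor_chain es" "1 \<notin> set es"
      using es by (auto simp: elementary_divisors_def divisor_chain_def)
    fix k :: int assume k: "k > 0"
    have "(\<Prod>d\<leftarrow>es. gcd d k) = int (card (torsion_kernel A k))"
      using card_torsion_kernel_diag[OF k, of es] nonneg
        card_torsion_kernel_Z_equivalent[of A "mat_diag (length es) (\<lambda>i. es ! i)" k] es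
      by (simp add: elementary_divisors_def)
    then show "(\<Prod>d\<leftarrow>es. gcd d k) = (\<Prod>d\<leftarrow>ds. gcd d k)" using card[OF k] by simp
  qed (use ds in auto)
  with es show ?thesis by simp
qed

section \<open>Alternating sums and periodic sequences\<close>

text \<open>With \<open>t\<close> the shift, \<open>alt_sum i f\<close> is \<open>(t\<^sup>i - (-1)\<^sup>i) / (t + 1)\<close> applied to \<open>f\<close>.\<close>

primrec alt_sum :: "nat \<Rightarrow> (int \<Rightarrow> 'a :: ab_group_add) \<Rightarrow> int \<Rightarrow> 'a" where
  "alt_sum 0 f a = 0"
| "alt_sum (Suc i) f a = f (a + int i) - alt_sum i f a"

text \<open>This is t^(i+j) - (-1)^(i+j) = t^i (t^j - (-1)^j) + (-1)^j (t^i - (-1)^i), divided by t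
  + 1.\<close>

lemma alt_sum_add:
  "alt_sum (i + j) f a = alt_sum j f (a + int i) + (if even j then alt_sum i f a else - alt_sum i f a)"
  by (induction j) (auto simp: algebra_simps)

text \<open>Multiplication by t + 1 clears the denominator and leaves t^i - (-1)^i.\<close>

lemma alt_sum_plus_alt_sum_shift:
  "alt_sum i f a + alt_sum i f (a + 1) = f (a + int i) - (if even i then f a else - f a)"
  by (induction i) (auto simp: algebra_simps)

lemma alt_sum_diff: "alt_sum i (\<lambda>a. f a - g a) a = alt_sum i f a - alt_sum i g a"
  by (induction i) (auto simp: algebra_simps)

lemma alt_sum_shift: "alt_sum i (\<lambda>a. f (a + c)) a = alt_sum i f (a + c)"
  by (induction i) (auto simp: algebra_simps)

lemma alt_sum_uminus: "alt_sum i (\<lambda>a. - f a) a = - alt_sum i f a"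
  by (induction i) (auto simp: algebra_simps)

lemma alt_sum_torsion: "(\<And>a. zmul k (f a) = 0) \<Longrightarrow> zmul k (alt_sum i f a) = 0"
  by (induction i) (auto simp: zmul.scale_right_diff_distrib)

lemma alt_sum_cong: "(\<And>j. j < i \<Longrightarrow> f (a + int j) = g (b + int j)) \<Longrightarrow> alt_sum i f a = alt_sum i g b"
  by (induction i) auto

lemma alt_sum_Suc_first: "even i \<Longrightarrow> alt_sum (Suc i) f a = f a + alt_sum i f (a + 1)"
  using alt_sum_add[of 1 i f a] by simp

text \<open>Their number is the number of solutions for the Goeritz matrices of \<open>T(p,q)\<close>.\<close>

definition sequences :: "nat \<Rightarrow> nat \<Rightarrow> int \<Rightarrow> (int \<Rightarrow> qmodz) set" where
  "sequences p q k = {y. (\<forall>a. zmul k (y a) = 0) \<and> (\<forall>a. y (a + int q) = y a) \<and>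
     (\<Sum>j<q. y (int j)) = 0 \<and> (\<forall>a. alt_sum p y a = 0)}"

section \<open>Sequences that are periodic up to a sign\<close>

definition twisted :: "bool \<Rightarrow> nat \<Rightarrow> (int \<Rightarrow> qmodz) \<Rightarrow> bool" where
  "twisted s r y \<longleftrightarrow> (\<forall>a. y (a + int r) = (if s then - y a else y a))"

lemma twisted_nat_mult:
  "twisted s r y \<Longrightarrow> y (a + int r * int n) = (if s \<and> odd n then - y a else y a)"
proof (induction n)
  case (Suc n)
  have "y (a + int r * int (Suc n)) = y ((a + int r * int n) + int r)" by (simp add: algebra_simps)
  also have "\<dots> = (if s then - y (a + int r * int n) else y (a + int r * int n))"
    using Suc.prems unfolding twisted_def by blast
  finally show ?case using Suc by auto
qed simp

lemma twisted_mult: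
  assumes "twisted s r y"
  shows "y (a + int r * n) = (if s \<and> odd n then - y a else y a)"
proof (cases "n \<ge> 0")
  case True
  then show ?thesis using twisted_nat_mult[OF assms, of a "nat n"] by (simp add: even_nat_iff)
next
  case False
  then show ?thesis using twisted_nat_mult[OF assms, of "a + int r * n" "nat (- n)"]
    by (auto simp: even_nat_iff split: if_splits)
qed

text \<open>By Bezout the gcd is u p + v q, so a shift by it applies the sign u times. The sign
  survives only for odd u, and u p' + v q' = 1 with q' even makes u odd.\<close>

lemma twisted_gcd:
  assumes p: "twisted s p y" and q: "twisted False q y" and s: "s \<Longrightarrow> even (q div gcd p q)" and "p > 0"
  shows "twisted s (gcd p q) y"
proof -
  obtain u v where uv: "u * int p + v * int q = int (gcd p q)"
    using bezout_int[of "int p" "int q"] by auto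
  have odd: "odd u" if s
  proof -
    define r where "r = gcd p q"
    have r: "r > 0" "p = r * (p div r)" "q = r * (q div r)" using \<open>p > 0\<close> by (auto simp: r_def)
    have "u * (int r * int (p div r)) + v * (int r * int (q div r)) = int r"
      using uv r by (metis of_nat_mult r_def)
    then have "int r * (u * int (p div r) + v * int (q div r)) = int r * 1" by (simp add: algebra_simps)
    then have "u * int (p div r) + v * int (q div r) = 1" using r(1) by simp
    then have "odd (u * int (p div r) + v * int (q div r))" by simp
    then show "odd u" using s[OF that] by (simp add: r_def)
  qed
  show ?thesis unfolding twisted_def
  proof
    fix a
    have "y (a + int (gcd p q)) = y ((a + int p * u) + int q * v)"
      unfolding uv[symmetric] by (simp add: algebra_simps)
    also have "\<dots> = y (a + int p * u)" using twisted_mult[OF q] by simp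
    also have "\<dots> = (if s then - y a else y a)" using twisted_mult[OF p, of a u] odd by auto
    finally show "y (a + int (gcd p q)) = (if s then - y a else y a)" .
  qed
qed

text \<open>Extends the first \<open>r\<close> terms to a twisted sequence; the sign is the parity
  of the block of length \<open>r\<close> that contains the index.\<close>

definition twisted_ext :: "bool \<Rightarrow> nat \<Rightarrow> (nat \<Rightarrow> qmodz) \<Rightarrow> int \<Rightarrow> qmodz" where
  "twisted_ext s r x a = (if s \<and> odd (a div int r) then - x (nat (a mod int r)) else x (nat (a mod int r)))"

lemma twisted_twisted_ext: "r > 0 \<Longrightarrow> twisted s r (twisted_ext s r x)"
  by (auto simp: twisted_def twisted_ext_def)

text \<open>Turns a count of two-sided infinite sequences into a count of tuples: \<open>Q\<close>
  sees only the first \<open>r\<close> terms, padded with 0.\<close>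

lemma card_twisted:
  assumes "r > 0"
  shows "card {y. twisted s r y \<and> Q (\<lambda>j. if j < r then y (int j) else 0)} =
    card {x. (\<forall>j\<ge>r. x j = 0) \<and> Q x}"
proof (rule card_eq_of_inverse[where f = "\<lambda>y j. if j < r then y (int j) else 0" and g = "twisted_ext s r"])
  fix y assume y: "y \<in> {y. twisted s r y \<and> Q (\<lambda>j. if j < r then y (int j) else 0)}"
  have "twisted_ext s r (\<lambda>j. if j < r then y (int j) else 0) a = y a" for a
    using y twisted_mult[of s r y "a mod int r" "a div int r"] assms
    by (auto simp: twisted_ext_def nat_less_iff mult.commute)
  with y show "(\<lambda>j. if j < r then y (int j) else 0) \<in> {x. (\<forall>j\<ge>r. x j = 0) \<and> Q x} \<and>
      twisted_ext s r (\<lambda>j. if j < r then y (int j) else 0) = y" by auto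
next
  fix x assume x: "x \<in> {x. (\<forall>j\<ge>r. x j = 0) \<and> Q x}"
  have "(\<lambda>j. if j < r then twisted_ext s r x (int j) else 0) = x"
    using x by (auto simp: twisted_ext_def fun_eq_iff)
  with x show "twisted_ext s r x \<in> {y. twisted s r y \<and> Q (\<lambda>j. if j < r then y (int j) else 0)} \<and>
      (\<lambda>j. if j < r then twisted_ext s r x (int j) else 0) = x"
    using twisted_twisted_ext[OF assms] by auto
qed

text \<open>As \<open>g\<close> ignores coordinate \<open>i\<close>, subtracting it undoes adding
  it. Such shears turn a linear condition into a condition on a single coordinate.\<close>

lemma card_shear:
  fixes g :: "(nat \<Rightarrow> 'a) \<Rightarrow> 'a :: ab_group_add"
  assumes "\<And>x t. g (x(i := t)) = g x"
  shows "card {x. R (x(i := x i + g x))} = card {x. R x}"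
  by (rule card_eq_of_inverse[where f = "\<lambda>x. x(i := x i + g x)" and g = "\<lambda>x. x(i := x i - g x)"])
    (auto simp: assms)

text \<open>After the shear, coordinate 0 ranges over the elements killed by \<open>d\<close> and
  \<open>k\<close>, and each of the other coordinates over the \<open>k\<close>-torsion.\<close>

lemma card_sheared_subgroup:
  fixes g :: "(nat \<Rightarrow> qmodz) \<Rightarrow> qmodz"
  assumes "r > 0" and g: "\<And>x t. g (x(0 := t)) = g x"
    and gk: "\<And>x. \<forall>j<r. zmul k (x j) = 0 \<Longrightarrow> zmul k (g x) = 0" and "k > 0" "d \<ge> 0"
  shows "card {x. (\<forall>j\<ge>r. x j = 0) \<and> (\<forall>j<r. zmul k (x j) = 0) \<and> zmul d (x 0 + g x) = 0} =
    nat (gcd d k) * nat k ^ (r - 1)"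
proof -
  define S where "S j = {z. (j = 0 \<longrightarrow> zmul d z = 0) \<and> zmul k z = 0}" for j :: nat
  have "(\<forall>j\<ge>r. x j = 0) \<and> (\<forall>j<r. zmul k (x j) = 0) \<and> zmul d (x 0 + g x) = 0 \<longleftrightarrow>
      (\<forall>j<r. (x(0 := x 0 + g x)) j \<in> S j) \<and> (\<forall>j\<ge>r. (x(0 := x 0 + g x)) j = 0)" for x
  proof -
    have "zmul k (x 0 + g x) = 0 \<longleftrightarrow> zmul k (x 0) = 0" if "\<forall>j\<in>{0<..<r}. zmul k (x j) = 0"
    proof -
      \<comment> \<open>Coordinate 0 is not yet known to be torsion; since \<open>g\<close> ignores
        it, it may be replaced by 0 before \<open>gk\<close> is applied.\<close>
      have "zmul k (g x) = 0" using gk[of "x(0 := 0)"] that by (simp add: g)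
      then show ?thesis by (simp add: zmul.scale_right_distrib)
    qed
    then show ?thesis using \<open>r > 0\<close> unfolding S_def by (auto simp: Ball_def)
  qed
  then have "card {x. (\<forall>j\<ge>r. x j = 0) \<and> (\<forall>j<r. zmul k (x j) = 0) \<and> zmul d (x 0 + g x) = 0} =
      card {x. (\<forall>j<r. (x(0 := x 0 + g x)) j \<in> S j) \<and> (\<forall>j\<ge>r. (x(0 := x 0 + g x)) j = 0)}"
    by (intro arg_cong[where f = card] Collect_cong)
  also have "\<dots> = card {x. (\<forall>j<r. x j \<in> S j) \<and> (\<forall>j\<ge>r. x j = 0)}"
    by (rule card_shear) (rule g)
  also have "\<dots> = (\<Prod>j<r. card (S j))" by (rule card_finite_support_functions)
  also have "\<dots> = card (S 0) * (\<Prod>j\<in>{..<r} - {0}. card (S j))"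
    using \<open>r > 0\<close> by (intro prod.remove) auto
  also have "(\<Prod>j\<in>{..<r} - {0}. card (S j)) = (\<Prod>j\<in>{..<r} - {0}. nat k)"
    by (rule prod.cong) (use \<open>k > 0\<close> in \<open>auto simp: S_def torsion_card\<close>)
  also have "\<dots> = nat k ^ (r - 1)" using \<open>r > 0\<close> by simp
  also have "card (S 0) = nat (gcd d k)" using \<open>k > 0\<close> by (simp add: S_def card_torsion_gcd)
  finally show ?thesis .
qed

section \<open>Counting the sequences according to the parities of p and q\<close>

lemma sum_lessThan_add: "(\<Sum>j<m + n. f j) = (\<Sum>j<m. f j) + (\<Sum>j<n. f (m + j))" for f :: "nat \<Rightarrow> 'a :: comm_monoid_add"
  by (induction n) (auto simp: add.assoc)

lemma uminus_of_double: "zmul 2 z = 0 \<Longrightarrow> - z = z"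
proof -
  assume "zmul 2 z = 0"
  moreover have "zmul 2 z = z + z"
    using zmul.scale_left_distrib[of 1 1 z] by simp
  ultimately show "- z = z" by (simp add: eq_neg_iff_add_eq_0 minus_unique)
qed

lemma zmul_alternating:
  assumes "\<And>a :: int. f (a + 1) = - f a"
  shows "zmul c (f a) = 0 \<longleftrightarrow> zmul c (f 0) = 0"
proof (induction a rule: int_induct[where k = 0])
  case (step1 i)
  then show ?case by (simp add: assms)
next
  case (step2 i)
  then show ?case using assms[of "i - 1"] by simp
qed simp

lemma sequences_twisted:
  assumes "y \<in> sequences p q k"
  shows "twisted (odd p) p y" "twisted False q y"
proof -
  have "y (a + int p) - (if even p then y a else - y a) = 0" for a
    using assms alt_sum_plus_alt_sum_shift[of p y a] by (simp add: sequences_def)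
  then show "twisted (odd p) p y" by (auto simp: twisted_def)
  show "twisted False q y" using assms by (simp add: sequences_def twisted_def)
qed

text \<open>Here t + 1 times the alternating sum is (t^r - (-1)^r) y = 0.\<close>

lemma twisted_alt_sum_shift: "twisted (odd r) r y \<Longrightarrow> alt_sum r y (a + 1) = - alt_sum r y a"
  using alt_sum_plus_alt_sum_shift[of r y a] by (auto simp: twisted_def eq_neg_iff_add_eq_0 add.commute split: if_splits)

text \<open>On \<open>y\<close> the shift t^r acts as (-1)^r, so the quotient of t^(nr) - (-1)^(nr)
  by t^r - (-1)^r acts as n up to the sign (-1)^(r(n-1)).\<close>

lemma alt_sum_blocks:
  assumes "twisted (odd r) r y"
  shows "alt_sum (n * r) y a = (if even r \<or> odd n then zmul (int n) (alt_sum r y a) else - zmul (int n) (alt_sum r y a))"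
proof (induction n)
  case (Suc n)
  have s: "alt_sum r y (a + int (n * r)) = (if odd r \<and> odd n then - alt_sum r y a else alt_sum r y a)"
  proof -
    have "alt_sum r y (a + int (n * r)) = alt_sum r (\<lambda>b. y (b + int r * int n)) a"
      by (simp add: alt_sum_shift mult.commute)
    also have "\<dots> = alt_sum r (\<lambda>b. if odd r \<and> odd n then - y b else y b) a"
      using twisted_mult[OF assms] by simp
    finally show ?thesis by (auto simp: alt_sum_uminus)
  qed
  have "alt_sum (Suc n * r) y a = alt_sum r y (a + int (n * r)) + (if even r then alt_sum (n * r) y a else - alt_sum (n * r) y a)"
    using alt_sum_add[of "n * r" r y a] by (simp add: add.commute)
  then show ?case unfolding s Suc by (auto simp: zmul.scale_left_distrib algebra_simps)
qed simp

lemma alt_sum_zero_iff: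
  assumes "twisted (odd r) r y" "even r \<or> odd n"
  shows "(\<forall>a. alt_sum (n * r) y a = 0) \<longleftrightarrow> zmul (int n) (alt_sum r y 0) = 0"
  using alt_sum_blocks[OF assms(1), of n] assms(2) zmul_alternating[of "alt_sum r y" "int n"] twisted_alt_sum_shift[OF assms(1)]
  by auto

text \<open>For odd \<open>r\<close> the first term enters with coefficient 1, which permits a shear
  at coordinate 0. The case distinctions reproduce the padding in
  \<open>card_twisted\<close>.\<close>

lemma alt_sum_first:
  assumes "odd r"
  shows "alt_sum r y 0 = (if 0 < r then y (int 0) else 0) + alt_sum (r - 1) (\<lambda>a. if nat a < r then y (int (nat a)) else 0) 1"
proof -
  have "alt_sum r y 0 = y 0 + alt_sum (r - 1) y 1"
    using alt_sum_Suc_first[of "r - 1" y 0] assms by (simp add: odd_pos)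
  also have "alt_sum (r - 1) y 1 = alt_sum (r - 1) (\<lambda>a. if nat a < r then y (int (nat a)) else 0) 1"
    by (rule alt_sum_cong) auto
  finally show ?thesis using assms by (simp add: odd_pos)
qed

lemma twisted_torsion_iff:
  assumes y: "twisted s r y" and r: "r > 0"
  shows "(\<forall>a. zmul k (y a) = 0) \<longleftrightarrow> (\<forall>j<r. zmul k (y (int j)) = 0)"
proof
  assume *: "\<forall>j<r. zmul k (y (int j)) = 0"
  show "\<forall>a. zmul k (y a) = 0"
  proof
    fix a
    have "zmul k (y (a mod int r)) = 0"
      using *[rule_format, of "nat (a mod int r)"] r by (simp add: nat_less_iff)
    then show "zmul k (y a) = 0"
      using twisted_mult[OF y, of "a mod int r" "a div int r"] by (simp split: if_splits)
  qed
qed simp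

text \<open>The shear at coordinate 0 applies for either sign \<open>s\<close>: period
  \<open>r\<close> occurs when p and q are both odd, the sign -1 when p is odd and q is
  even.\<close>

lemma card_twisted_odd:
  assumes "odd r" "k > 0" "d \<ge> 0"
  shows "card {y. twisted s r y \<and> (\<forall>a. zmul k (y a) = 0) \<and> zmul d (alt_sum r y 0) = 0} =
    nat (gcd d k) * nat k ^ (r - 1)"
proof -
  define g where "g x = alt_sum (r - 1) (\<lambda>a. x (nat a)) 1" for x :: "nat \<Rightarrow> qmodz"
  define Q where "Q x \<longleftrightarrow> (\<forall>j<r. zmul k (x j) = 0) \<and> zmul d (x 0 + g x) = 0" for x
  have r: "r > 0" using assms by (simp add: odd_pos)
  have "{y. twisted s r y \<and> (\<forall>a. zmul k (y a) = 0) \<and> zmul d (alt_sum r y 0) = 0} =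
      {y. twisted s r y \<and> Q (\<lambda>j. if j < r then y (int j) else 0)}"
    using twisted_torsion_iff[OF _ r] unfolding Q_def g_def alt_sum_first[OF \<open>odd r\<close>] by (auto simp: r)
  also have "card \<dots> = card {x. (\<forall>j\<ge>r. x j = 0) \<and> Q x}"
    by (rule card_twisted) (rule r)
  also have "\<dots> = nat (gcd d k) * nat k ^ (r - 1)"
    unfolding Q_def
  proof (rule card_sheared_subgroup[OF r])
    show "g (x(0 := t)) = g x" for x t
      unfolding g_def by (rule alt_sum_cong) auto
    show "zmul k (g x) = 0" if "\<forall>j<r. zmul k (x j) = 0" for x
    proof -
      have "g x = alt_sum (r - 1) (\<lambda>a. if nat a < r then x (nat a) else 0) 1"
        unfolding g_def by (rule alt_sum_cong) auto
      then show ?thesis using that by (simp add: alt_sum_torsion)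
    qed
  qed (use assms in auto)
  finally show ?thesis .
qed

lemma sum_eq_alt_sum:
  assumes "\<And>a. zmul 2 (y a) = 0"
  shows "(\<Sum>j<n. y (int j)) = alt_sum n y 0"
proof (induction n)
  case (Suc n)
  have "- alt_sum n y 0 = alt_sum n y 0" by (intro uminus_of_double alt_sum_torsion assms)
  then show ?case using Suc by (metis add.commute add.left_neutral alt_sum.simps(2) diff_conv_add_uminus sum.lessThan_Suc)
qed simp

text \<open>The shift by \<open>p * q\<close> acts as 1 and as -1 at once, so all values are
  2-torsion and signs become irrelevant. The odd numbers p/r and q/r act as 1 there, so the sum
  condition and the alternating condition shrink to one and the same alternating sum of length r,
  which fixes one of r terms.\<close>

lemma card_sequences_odd_odd:
  assumes "odd p" "odd q" "k > 0"
  shows "card (sequences p q k) = nat (gcd 2 k) ^ (gcd p q - 1)"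
proof -
  define r where "r = gcd p q"
  obtain p' q' where p': "p = p' * r" and q': "q = q' * r"
    by (metis dvd_def gcd_dvd1 gcd_dvd2 mult.commute r_def)
  have odds: "odd r" "odd p'" "odd q'" using assms p' q' by auto
  have two: "zmul 2 z = 0 \<and> zmul k z = 0 \<longleftrightarrow> zmul (gcd 2 k) z = 0" for z by (rule torsion_gcd)
  have neg: "- y a = y a" if "\<forall>a. zmul 2 (y a) = 0" for y and a :: int
    using that uminus_of_double by blast
  have cond: "(\<forall>a. alt_sum (n * r) y a = 0) \<longleftrightarrow> alt_sum r y 0 = 0"
    if "twisted True r y" "\<forall>a. zmul 2 (y a) = 0" "odd n" for y n
  proof -
    have "zmul 2 (alt_sum r y 0) = 0" by (rule alt_sum_torsion) (use that in auto)
    moreover obtain h where "int n = h * 2 + 1" using \<open>odd n\<close> by (metis even_of_nat mult.commute oddE)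
    ultimately have "zmul (int n) (alt_sum r y 0) = alt_sum r y 0"
      by (metis add_0 zmul.scale_left_distrib zmul.scale_one zmul.scale_scale zmul.scale_zero_right)
    then show ?thesis using alt_sum_zero_iff[of r y n] that odds by simp
  qed
  have "sequences p q k = {y. twisted False r y \<and> (\<forall>a. zmul (gcd 2 k) (y a) = 0) \<and> zmul 1 (alt_sum r y 0) = 0}"
  proof (intro Set.set_eqI iffI CollectI conjI allI)
    fix y assume y: "y \<in> sequences p q k"
    note tw = sequences_twisted[OF y]
    have "y a = - y a" for a
      using twisted_mult[OF tw(1), of a "int q"] twisted_mult[OF tw(2), of a "int p"] assms
      by (simp add: mult.commute)
    then have "y a + y a = 0" for a by (metis add.right_inverse)
    then have y2: "\<forall>a. zmul 2 (y a) = 0"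
      using zmul.scale_left_distrib[of 1 1] by simp
    then have "twisted False p y" using tw(1) assms(1) neg[OF y2] by (simp add: twisted_def)
    then show twr: "twisted False r y"
      unfolding r_def using tw(2) assms by (intro twisted_gcd) (auto simp: odd_pos)
    then have "twisted True r y" using neg[OF y2] by (simp add: twisted_def)
    then show "zmul 1 (alt_sum r y 0) = 0"
      using cond[of y p'] y2 odds y p' by (simp add: sequences_def)
    show "zmul (gcd 2 k) (y a) = 0" for a
      using y y2 two by (auto simp: sequences_def)
  next
    fix y assume "y \<in> {y. twisted False r y \<and> (\<forall>a. zmul (gcd 2 k) (y a) = 0) \<and> zmul 1 (alt_sum r y 0) = 0}"
    then have y: "twisted False r y" "\<forall>a. zmul 2 (y a) = 0" "\<forall>a. zmul k (y a) = 0" "alt_sum r y 0 = 0"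
      using two by auto
    then have t: "twisted True r y" using neg[OF y(2)] by (simp add: twisted_def)
    have "y (a + int q) = y a" for a
      using twisted_mult[OF y(1), of a "int q'"] q' by (simp add: mult.commute)
    moreover have "(\<Sum>j<q. y (int j)) = 0"
      using sum_eq_alt_sum[of y q] y(2) cond[OF t y(2), of q'] odds y(4) q' by simp
    moreover have "\<forall>a. alt_sum p y a = 0" using cond[OF t y(2), of p'] odds y(4) p' by simp
    ultimately show "y \<in> sequences p q k" using y(3) by (simp add: sequences_def)
  qed
  then have "card (sequences p q k) = nat (gcd 1 (gcd 2 k)) * nat (gcd 2 k) ^ (r - 1)"
    using card_twisted_odd[of r "gcd 2 k" 1 False] odds assms by simp
  then show ?thesis by (simp add: r_def)
qed

lemma twisted_sum_zero:
  assumes "twisted True r y"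
  shows "(\<Sum>j<2 * n * r. y (int j)) = 0"
proof (induction n)
  case (Suc n)
  have s: "y (int (2 * n * r + j)) = y (int j)" for j
    using twisted_mult[OF assms, of "int j" "int (2 * n)"] by (simp add: algebra_simps)
  have s': "y (int (r + j)) = - y (int j)" for j
    using assms by (simp add: twisted_def add.commute)
  have "2 * Suc n * r = 2 * n * r + (r + r)" by simp
  then have "(\<Sum>j<2 * Suc n * r. y (int j)) = (\<Sum>j<2 * n * r. y (int j)) + (\<Sum>j<r + r. y (int (2 * n * r + j)))"
    by (simp only: sum_lessThan_add)
  also have "\<dots> = 0" unfolding s Suc sum_lessThan_add s' by (simp add: sum_negf)
  finally show ?case .
qed simp

text \<open>Consecutive blocks of length r cancel and q/r is even, so the sum condition is
  automatic. What remains is that \<open>p'\<close> kills an alternating sum of odd length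
  r.\<close>

lemma card_sequences_odd_even:
  assumes "odd p" "even q" "q > 0" "k > 0" "p = p' * gcd p q"
  shows "card (sequences p q k) = nat (gcd (int p') k) * nat k ^ (gcd p q - 1)"
proof -
  define r where "r = gcd p q"
  have p': "p = p' * r" using assms by (simp add: r_def)
  obtain q' where q': "q = q' * r"
    by (metis dvd_def gcd_dvd2 mult.commute r_def)
  have odds: "odd r" "odd p'" "even q'" using assms p' q' by auto
  have r: "r > 0" using odds by (simp add: odd_pos)
  have "sequences p q k = {y. twisted True r y \<and> (\<forall>a. zmul k (y a) = 0) \<and> zmul (int p') (alt_sum r y 0) = 0}"
  proof (intro Set.set_eqI iffI CollectI conjI)
    fix y assume y: "y \<in> sequences p q k"
    note tw = sequences_twisted[OF y]
    have "q div r = q'" using q' r by simp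
    then show twr: "twisted True r y"
      unfolding r_def using tw assms odds by (intro twisted_gcd) (auto simp: odd_pos r_def)
    show "zmul (int p') (alt_sum r y 0) = 0"
      using alt_sum_zero_iff[of r y p'] odds twr y p' by (simp add: sequences_def)
    show "\<forall>a. zmul k (y a) = 0" using y by (auto simp: sequences_def)
  next
    fix y assume "y \<in> {y. twisted True r y \<and> (\<forall>a. zmul k (y a) = 0) \<and> zmul (int p') (alt_sum r y 0) = 0}"
    then have y: "twisted True r y" "\<forall>a. zmul k (y a) = 0" "zmul (int p') (alt_sum r y 0) = 0" by auto
    have "y (a + int q) = y a" for a
      using twisted_mult[OF y(1), of a "int q'"] q' odds by (simp add: mult.commute)
    moreover have "(\<Sum>j<q. y (int j)) = 0"
      using twisted_sum_zero[OF y(1), of "q' div 2"] odds q' by simp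
    moreover have "\<forall>a. alt_sum p y a = 0" using alt_sum_zero_iff[of r y p'] odds y p' by simp
    ultimately show "y \<in> sequences p q k" using y(2) by (simp add: sequences_def)
  qed
  then show ?thesis
    using card_twisted_odd[of r k "int p'" True] odds assms(4) by (simp add: r_def)
qed

text \<open>The last term has the sign +, so the terms at even offsets are the negative ones. This
  expresses the alternating condition through the two sums used in
  \<open>even_conditions\<close>.\<close>

lemma alt_sum_even_length:
  "alt_sum (2 * n) y a = (\<Sum>j<2 * n. y (a + int j)) - zmul 2 (\<Sum>j<n. y (a + int (2 * j)))"
proof (induction n)
  case (Suc n)
  have two: "zmul 2 z = z + z" for z using zmul.scale_left_distrib[of 1 1 z] by simp
  show ?case using Suc by (simp add: two algebra_simps)
qed simp

lemma twisted_False_sum: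
  assumes "twisted False r y"
  shows "(\<Sum>j<n * r. y (int j)) = zmul (int n) (\<Sum>j<r. y (int j))"
proof (induction n)
  case (Suc n)
  have s: "y (int (n * r + j)) = y (int j)" for j
    using twisted_mult[OF assms, of "int j" "int n"] by (simp add: algebra_simps)
  have "Suc n * r = n * r + r" by simp
  then have "(\<Sum>j<Suc n * r. y (int j)) = (\<Sum>j<n * r. y (int j)) + (\<Sum>j<r. y (int (n * r + j)))"
    by (simp only: sum_lessThan_add)
  then show ?case unfolding s Suc by (simp add: zmul.scale_left_distrib algebra_simps)
qed simp

lemma sum_zmul_zero: "(\<And>j. j \<in> A \<Longrightarrow> zmul k (f j) = 0) \<Longrightarrow> zmul k (sum f A) = 0"
  by (simp add: zmul.scale_sum_right)

text \<open>
  For \<open>t\<close> the sum and \<open>e\<close> the sum of the terms with even index over one period; the matrix of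
  the two conditions on the left has the determinant \<open>\<plusminus>2pq\<close> and coprime entries.
\<close>

lemma even_conditions:
  assumes uv: "u * p + v * q = (1 :: int)"
  shows "zmul q t = 0 \<and> zmul p (t - zmul 2 e) = 0 \<longleftrightarrow> t = zmul (2 * u * p) e \<and> zmul (2 * p * q) e = 0"
proof
  assume *: "zmul q t = 0 \<and> zmul p (t - zmul 2 e) = 0"
  then have p: "zmul p t = zmul p (zmul 2 e)" by (simp add: zmul.scale_right_diff_distrib del: zmul.scale_scale)
  \<comment> \<open>Bezout splits \<open>t\<close> into two parts, one for each condition.\<close>
  have "t = zmul (u * p + v * q) t" using uv by simp
  also have "\<dots> = zmul u (zmul p t) + zmul v (zmul q t)" by (simp only: zmul.scale_left_distrib zmul.scale_scale)
  also have "\<dots> = zmul (2 * u * p) e" using * by (simp only: p) (simp add: algebra_simps)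
  finally have t: "t = zmul (2 * u * p) e" .
  have "zmul (2 * p * q) e = zmul q (zmul p (zmul 2 e))" by (simp add: algebra_simps)
  also have "\<dots> = zmul p (zmul q t)" unfolding p[symmetric] by (simp add: mult.commute)
  also have "\<dots> = 0" using * by (simp only: zmul.scale_zero_right)
  finally show "t = zmul (2 * u * p) e \<and> zmul (2 * p * q) e = 0" using t by blast
next
  assume *: "t = zmul (2 * u * p) e \<and> zmul (2 * p * q) e = 0"
  have "zmul q t = zmul u (zmul (2 * p * q) e)" using *[THEN conjunct1] by (simp add: algebra_simps)
  moreover have "zmul p (t - zmul 2 e) = zmul (- v) (zmul (2 * p * q) e)"
  proof -
    have "p * (2 * u * p) - p * 2 = - v * (2 * p * q)"
    proof -
      have "p * (2 * u * p) - p * 2 = 2 * p * (u * p - 1)" by (simp add: algebra_simps)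
      also have "u * p - 1 = - (v * q)" using uv by simp
      finally show ?thesis by (simp add: algebra_simps)
    qed
    then have "zmul (p * (2 * u * p) - p * 2) e = zmul (- v) (zmul (2 * p * q) e)" by simp
    then show ?thesis
      unfolding *[THEN conjunct1] by (simp only: zmul.scale_right_diff_distrib zmul.scale_left_diff_distrib zmul.scale_scale)
  qed
  ultimately show "zmul q t = 0 \<and> zmul p (t - zmul 2 e) = 0"
    by (simp only: *[THEN conjunct2] zmul.scale_zero_right simp_thms)
qed

text \<open>Two shears make the system triangular: coordinate 0 absorbs the sum over even indices,
  and coordinate 1, which occurs only in the total, absorbs the first relation. Then coordinate 1 is
  0, coordinate 0 is killed by \<open>e\<close> and \<open>k\<close>, and the remaining
  \<open>2 * h - 2\<close> range over the \<open>k\<close>-torsion.\<close>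

lemma card_even_system:
  assumes "h > 0" "k > 0" "e \<ge> 0"
  shows "card {x. (\<forall>j\<ge>2 * h. x j = 0) \<and> (\<forall>j<2 * h. zmul k (x j) = 0) \<and>
      (\<Sum>j<2 * h. x j) = zmul c (\<Sum>j<h. x (2 * j)) \<and> zmul e (\<Sum>j<h. x (2 * j)) = 0} =
    nat (gcd e k) * nat k ^ (2 * h - 2)" (is "card {x. ?P x} = _")
proof -
  define S where "S j = {z. zmul k z = 0 \<and> (j = 0 \<longrightarrow> zmul e z = 0) \<and> (j = 1 \<longrightarrow> z = 0)}" for j :: nat
  define R where "R z \<longleftrightarrow> (\<forall>j<2 * h. z j \<in> S j) \<and> (\<forall>j\<ge>2 * h. z j = 0)" for z
  define g0 where "g0 x = (\<Sum>j=1..<h. x (2 * j))" for x :: "nat \<Rightarrow> qmodz"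
  define f where "f x = (\<Sum>j=2..<2 * h. x j)" for x :: "nat \<Rightarrow> qmodz"
  \<comment> \<open>Written for the already sheared \<open>z\<close>, in which the old value at 0 is
    \<open>z 0 - g0 z\<close>.\<close>
  define g1 where "g1 z = z 0 - g0 z + f z - zmul c (z 0)" for z
  have E: "(\<Sum>j<h. x (2 * j)) = x 0 + g0 x" for x :: "nat \<Rightarrow> qmodz"
    using \<open>h > 0\<close> by (simp add: g0_def lessThan_atLeast0 sum.atLeast_Suc_lessThan)
  have O: "(\<Sum>j<2 * h. x j) = x 0 + (x 1 + f x)" for x :: "nat \<Rightarrow> qmodz"
    using \<open>h > 0\<close> by (simp add: f_def lessThan_atLeast0 sum.atLeast_Suc_lessThan numeral_2_eq_2)
  have g0_upd: "g0 (x(i := t)) = g0 x" if "i < 2" for x i t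
    unfolding g0_def by (rule sum.cong) (use that in auto)
  have f_upd: "f (x(i := t)) = f x" if "i < 2" for x i t
    unfolding f_def by (rule sum.cong) (use that in auto)
  have g1_upd: "g1 (x(1 := t)) = g1 x" for x t
    by (simp add: g1_def g0_upd f_upd)
  define h0 where "h0 x = x(0 := x 0 + g0 x)" for x
  define h1 where "h1 z = z(1 := z 1 + g1 z)" for z
  have val: "h1 (h0 x) j = (if j = 0 then x 0 + g0 x else if j = 1 then
      (\<Sum>j<2 * h. x j) - zmul c (\<Sum>j<h. x (2 * j)) else x j)" for x j
    unfolding h1_def h0_def g1_def E O by (simp add: g0_upd f_upd)
  have P: "?P x \<longleftrightarrow> R (h1 (h0 x))" for x
  proof -
    have g0k: "zmul k (g0 x) = 0" and fk: "zmul k (f x) = 0" if "\<forall>j\<in>{2..<2 * h}. zmul k (x j) = 0"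
      unfolding g0_def f_def by (rule sum_zmul_zero, use that in auto)+
    \<comment> \<open>The relation expresses \<open>x 1\<close> through the other terms, so its
      torsion follows from theirs.\<close>
    have tors: "zmul k (x 0) = 0 \<and> zmul k (x 1) = 0 \<longleftrightarrow> zmul k (x 0 + g0 x) = 0"
      if "\<forall>j\<in>{2..<2 * h}. zmul k (x j) = 0" "x 0 + (x 1 + f x) = zmul c (x 0 + g0 x)"
    proof -
      define z where "z = x 0 + g0 x"
      have "zmul k z = zmul k (x 0)" using g0k[OF that(1)] by (simp add: z_def zmul.scale_right_distrib)
      moreover have "zmul k (x 1) = zmul k (zmul c z) - zmul k (x 0) - zmul k (f x)"
        unfolding zmul.scale_right_diff_distrib[symmetric] z_def that(2)[symmetric] by simp
      moreover have "zmul k (zmul c z) = zmul c (zmul k z)" by (simp add: mult.commute)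
      ultimately show ?thesis using fk[OF that(1)] unfolding z_def[symmetric]
        by (auto simp del: zmul.scale_scale)
    qed
    have all: "(\<forall>j<2 * h. Q j) \<longleftrightarrow> Q 0 \<and> Q 1 \<and> (\<forall>j\<in>{2..<2 * h}. Q j)" for Q
      using \<open>h > 0\<close> by (auto simp: Ball_def) (metis less_2_cases not_less One_nat_def)
    have "R (h1 (h0 x)) \<longleftrightarrow> zmul k (x 0 + g0 x) = 0 \<and> zmul e (x 0 + g0 x) = 0 \<and>
        x 0 + (x 1 + f x) = zmul c (x 0 + g0 x) \<and> (\<forall>j\<in>{2..<2 * h}. zmul k (x j) = 0) \<and> (\<forall>j\<ge>2 * h. x j = 0)"
      unfolding R_def all val S_def E O using \<open>h > 0\<close> by auto
    moreover have "?P x \<longleftrightarrow> (zmul k (x 0) = 0 \<and> zmul k (x 1) = 0) \<and> zmul e (x 0 + g0 x) = 0 \<and>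
        x 0 + (x 1 + f x) = zmul c (x 0 + g0 x) \<and> (\<forall>j\<in>{2..<2 * h}. zmul k (x j) = 0) \<and> (\<forall>j\<ge>2 * h. x j = 0)"
      unfolding all E O by blast
    ultimately show ?thesis using tors by blast
  qed
  have "card {x. ?P x} = card {x. R (h1 (h0 x))}" by (simp only: P)
  also have "\<dots> = card {x. R (h1 x)}"
    unfolding h0_def by (rule card_shear[where R = "\<lambda>x. R (h1 x)"]) (simp add: g0_upd)
  also have "\<dots> = card {x. R x}"
    unfolding h1_def by (rule card_shear) (rule g1_upd)
  also have "\<dots> = (\<Prod>j<2 * h. card (S j))"
    unfolding R_def by (rule card_finite_support_functions)
  also have "\<dots> = card (S 0) * (card (S 1) * (\<Prod>j=2..<2 * h. card (S j)))"
    using \<open>h > 0\<close> by (simp add: lessThan_atLeast0 prod.atLeast_Suc_lessThan numeral_2_eq_2)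
  also have "(\<Prod>j=2..<2 * h. card (S j)) = (\<Prod>j=2..<2 * h. nat k)"
    by (rule prod.cong) (use \<open>k > 0\<close> in \<open>auto simp: S_def torsion_card\<close>)
  also have "\<dots> = nat k ^ (2 * h - 2)" by simp
  also have "S 1 = {0}" by (auto simp: S_def)
  also have "S 0 = {z. zmul e z = 0 \<and> zmul k z = 0}" by (auto simp: S_def)
  also have "card \<dots> = nat (gcd e k)" using \<open>k > 0\<close> by (rule card_torsion_gcd)
  finally show ?thesis by simp
qed

text \<open>No sign occurs, so y has period r. With the total t and the even-indexed sum e over one
  period, the conditions are q' t = 0 and p' (t - 2 e) = 0; as p' and q' are coprime, they amount to
  a relation that determines t from e and to 2 p' q' e = 0.\<close>

lemma card_sequences_even_even:
  assumes "even p" "even q" "p > 0" "k > 0" "p = p' * gcd p q" "q = q' * gcd p q"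
  shows "card (sequences p q k) = nat (gcd (int (2 * p' * q')) k) * nat k ^ (gcd p q - 2)"
proof -
  define r where "r = gcd p q"
  have p': "p = p' * r" and q': "q = q' * r" using assms by (simp_all add: r_def)
  have r: "r > 0" "even r" using assms by (simp_all add: r_def)
  then obtain h where h: "r = 2 * h" "h > 0" by (auto elim: evenE)
  have "int r * gcd (int p') (int q') = int r * 1"
  proof -
    have "r * gcd p' q' = gcd (r * p') (r * q')" by (simp add: gcd_mult_distrib_nat)
    also have "\<dots> = r" using p' q' r_def by (metis mult.commute)
    finally show ?thesis by (metis gcd_int_int_eq mult.right_neutral of_nat_mult)
  qed
  then have "gcd (int p') (int q') = 1" using r(1) by simp
  then obtain u v where uv: "u * int p' + v * int q' = 1" using bezout_int by metis
  define Q where "Q x \<longleftrightarrow> (\<forall>j<2 * h. zmul k (x j) = 0) \<and>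
    (\<Sum>j<2 * h. x j) = zmul (2 * u * int p') (\<Sum>j<h. x (2 * j)) \<and>
    zmul (2 * int p' * int q') (\<Sum>j<h. x (2 * j)) = 0" for x
  have rest: "Q (\<lambda>j. if j < r then y (int j) else 0) \<longleftrightarrow> (\<forall>j<r. zmul k (y (int j)) = 0) \<and>
      zmul (int q') (\<Sum>j<r. y (int j)) = 0 \<and> zmul (int p') (alt_sum r y 0) = 0" for y
  proof -
    have "(\<Sum>j<2 * h. if j < r then y (int j) else 0) = (\<Sum>j<r. y (int j))"
      "(\<Sum>j<h. if 2 * j < r then y (int (2 * j)) else 0) = (\<Sum>j<h. y (int (2 * j)))"
      by (rule sum.cong; simp add: h)+
    then show ?thesis unfolding Q_def using even_conditions[OF uv] alt_sum_even_length[of h y 0]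
      by (simp add: h)
  qed
  have "sequences p q k = {y. twisted False r y \<and> Q (\<lambda>j. if j < r then y (int j) else 0)}"
  proof (intro Set.set_eqI iffI CollectI conjI)
    fix y assume y: "y \<in> sequences p q k"
    note tw = sequences_twisted[OF y]
    show twr: "twisted False r y"
      unfolding r_def using tw assms by (intro twisted_gcd) auto
    have "zmul (int p') (alt_sum r y 0) = 0"
      using alt_sum_zero_iff[of r y p'] r twr y p' by (simp add: sequences_def)
    moreover have "zmul (int q') (\<Sum>j<r. y (int j)) = 0"
      using twisted_False_sum[OF twr, of q'] y q' by (simp add: sequences_def)
    ultimately show "Q (\<lambda>j. if j < r then y (int j) else 0)"
      using y unfolding rest by (simp add: sequences_def)
  next
    fix y assume "y \<in> {y. twisted False r y \<and> Q (\<lambda>j. if j < r then y (int j) else 0)}"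
    then have y: "twisted False r y" "\<forall>j<r. zmul k (y (int j)) = 0"
      "zmul (int q') (\<Sum>j<r. y (int j)) = 0" "zmul (int p') (alt_sum r y 0) = 0" unfolding rest by auto
    have "y (a + int q) = y a" for a
      using twisted_mult[OF y(1), of a "int q'"] q' by (simp add: mult.commute)
    moreover have "(\<Sum>j<q. y (int j)) = 0"
      using twisted_False_sum[OF y(1), of q'] y(3) q' by simp
    moreover have "\<forall>a. alt_sum p y a = 0" using alt_sum_zero_iff[of r y p'] r y p' by simp
    ultimately show "y \<in> sequences p q k"
      using y(2) twisted_torsion_iff[OF y(1) r(1)] by (simp add: sequences_def)
  qed
  also have "card \<dots> = card {x. (\<forall>j\<ge>r. x j = 0) \<and> Q x}"
    by (rule card_twisted) (rule r)
  also have "\<dots> = nat (gcd (2 * int p' * int q') k) * nat k ^ (2 * h - 2)"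
    unfolding Q_def h(1) by (rule card_even_system) (use h assms in auto)
  finally show ?thesis by (simp add: r_def[symmetric] h mult.assoc)
qed

section \<open>The equations of a cylindrical grid\<close>

text \<open>Inverts the difference operator on the \<open>q\<close>-periodic sequences whose terms sum up to 0.\<close>

definition antidiff :: "nat \<Rightarrow> (int \<Rightarrow> qmodz) \<Rightarrow> int \<Rightarrow> qmodz" where
  "antidiff q y a = (\<Sum>j<nat (a mod int q). y (int (Suc j)))"

lemma periodic_mod:
  assumes "\<And>a. f (a + int q) = f a"
  shows "f (a mod int q) = f a"
proof -
  have *: "f (a + int q * int n) = f a" for a n
  proof (induction n)
    case (Suc n)
    have "f (a + int q * int (Suc n)) = f (a + int q * int n + int q)" by (simp add: algebra_simps)
    then show ?case using Suc assms by simp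
  qed simp
  show ?thesis
  proof (cases "a div int q \<ge> 0")
    case True
    then show ?thesis using *[of "a mod int q" "nat (a div int q)"] by simp
  next
    case False
    then show ?thesis using *[of a "nat (- (a div int q))"]
      by (simp add: minus_mult_div_eq_mod)
  qed
qed

lemma antidiff_periodic: "antidiff q y (a + int q) = antidiff q y a"
  by (simp add: antidiff_def)

lemma antidiff_of_diff:
  assumes q: "q > 0" and per: "\<And>a. f (a + int q) = f a"
  shows "antidiff q (\<lambda>a. f a - f (a - 1)) a = f a - f 0"
proof -
  have "(\<Sum>j<n. f (int (Suc j)) - f (int (Suc j) - 1)) = f (int n) - f 0" for n
    by (induction n) auto
  moreover have "f (a mod int q) = f a" by (rule periodic_mod) (rule per)
  ultimately show ?thesis using q by (simp add: antidiff_def)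
qed

lemma antidiff_diff:
  assumes q: "q > 0" and per: "\<And>a. y (a + int q) = y a" and sum: "(\<Sum>j<q. y (int j)) = 0"
  shows "antidiff q y a - antidiff q y (a - 1) = y a"
proof (cases "a mod int q = 0")
  \<comment> \<open>The predecessor of a multiple of \<open>q\<close> sits at the end of the
    preceding period; this is where the vanishing sum enters.\<close>
  case True
  have "(a - 1) mod int q = (a mod int q - 1) mod int q" by (simp add: mod_diff_left_eq)
  also have "\<dots> = int q - 1" unfolding True using q by (simp add: zmod_minus1)
  finally have "nat ((a - 1) mod int q) = q - 1" by simp
  then have "antidiff q y (a - 1) = (\<Sum>j<q - 1. y (int (Suc j)))" by (simp only: antidiff_def)
  also have "\<dots> = (\<Sum>j<Suc (q - 1). y (int j)) - y 0" by (subst sum.lessThan_Suc_shift) simp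
  also have "\<dots> = - y 0" using q sum by simp
  also have "y 0 = y a" using periodic_mod[of y q a] per True by simp
  finally show ?thesis using True by (simp add: antidiff_def)
next
  case False
  have "0 \<le> a mod int q" "a mod int q < int q" using q by auto
  with False have "(a mod int q - 1) mod int q = a mod int q - 1" by (intro mod_pos_pos_trivial) auto
  then have "(a - 1) mod int q = a mod int q - 1" by (simp add: mod_diff_left_eq)
  then have n: "nat (a mod int q) = Suc (nat ((a - 1) mod int q))"
    using False \<open>0 \<le> a mod int q\<close> by simp
  have "antidiff q y a = antidiff q y (a - 1) + y (int (nat (a mod int q)))"
    unfolding antidiff_def n by simp
  also have "y (int (nat (a mod int q))) = y a"
    using periodic_mod[of y q a] per \<open>0 \<le> a mod int q\<close> by simp
  finally show ?thesis by simp
qed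

lemma alt_sum_periodic: "(\<And>a. f (a + c) = f a) \<Longrightarrow> alt_sum i f (a + c) = alt_sum i f a"
  using alt_sum_shift[of i f c a] by simp

lemma alt_sum_step: "alt_sum (i + 2) f a = f (a + int i + 1) - f (a + int i) + alt_sum i f a"
  by (simp add: algebra_simps)

lemma alt_sum_step':
  assumes "2 \<le> i"
  shows "alt_sum i f a = f (a + int i - 1) - f (a + int i - 2) + alt_sum (i - 2) f a"
proof -
  obtain j where "i = j + 2" using assms by (metis le_add_diff_inverse2)
  then show ?thesis using alt_sum_step[of j f a] by (simp add: ac_simps)
qed

text \<open>Both increments, from column \<open>i - 2\<close> to \<open>i\<close> in row
  \<open>a + 1\<close> and from \<open>i\<close> to \<open>i + 2\<close> in row
  \<open>a - 1\<close>, equal \<open>f (a + i) - f (a + i - 1)\<close>.\<close>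

lemma alt_sum_interior:
  assumes "2 \<le> i"
  shows "alt_sum i f (a - 1) + alt_sum i f (a + 1) = alt_sum (i + 2) f (a - 1) + alt_sum (i - 2) f (a + 1)"
  using alt_sum_step[of i f "a - 1"] alt_sum_step'[OF assms, of f "a + 1"]
  by (simp add: algebra_simps)

text \<open>
  Here \<open>X i a\<close> is the value at the region in the column \<open>i\<close> and the row \<open>a\<close>. It meets \<open>(i, a - 1)\<close>
  and \<open>(i, a + 1)\<close> with one sign, and \<open>(i + 2, a - 1)\<close> and \<open>(i - 2, a + 1)\<close> with the other.
  The outermost columns \<open>0\<close> and \<open>p\<close> are single regions.
\<close>

definition kirchhoff :: "nat \<Rightarrow> nat \<Rightarrow> bool \<Rightarrow> (nat \<Rightarrow> int \<Rightarrow> qmodz) \<Rightarrow> bool" where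
  "kirchhoff p q b X \<longleftrightarrow>
     (\<forall>i a. 0 < i \<and> i < p \<and> even i = b \<longrightarrow>
        X i (a - 1) - X i a + (X i (a + 1) - X i a) -
        (if i + 1 < p then X (i + 2) (a - 1) - X i a else 0) -
        (if 1 < i then X (i - 2) (a + 1) - X i a else 0) = 0) \<and>
     (b \<longrightarrow> (\<Sum>j<q. X 2 (int j - 1) - X 0 0) = 0) \<and>
     (even p = b \<longrightarrow> (\<Sum>j<q. X (p - 2) (int j) - X p 0) = 0)"

lemma sum_periodic_shift:
  fixes f :: "int \<Rightarrow> qmodz"
  assumes "\<And>a. f (a + int q) = f a"
  shows "(\<Sum>j<q. f (int j + int c)) = (\<Sum>j<q. f (int j))"
proof (induction c)
  case (Suc c)
  have "(\<Sum>j<q. f (int j + int (Suc c))) = (\<Sum>j<Suc q. f (int j + int c)) - f (int c)"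
    by (subst sum.lessThan_Suc_shift) (simp add: algebra_simps)
  also have "\<dots> = (\<Sum>j<q. f (int j + int c)) + f (int c + int q) - f (int c)"
    by (simp add: add.commute)
  finally show ?case using Suc assms by simp
qed simp

section \<open>Solutions of the grid equations\<close>

context
  fixes p q :: nat
  assumes p: "p > 1" and q: "q > 0"
begin

lemma sequences_antidiff:
  assumes "y \<in> sequences p q k"
  shows "antidiff q y a - antidiff q y (a - 1) = y a"
  by (rule antidiff_diff) (use assms q in \<open>auto simp: sequences_def\<close>)

lemma alt_sum_antidiff_diff:
  assumes "y \<in> sequences p q k"
  shows "alt_sum i (antidiff q y) a - alt_sum i (antidiff q y) (a - 1) = alt_sum i y a"
proof -
  have "alt_sum i (\<lambda>a. antidiff q y a - antidiff q y (a - 1)) a = alt_sum i (antidiff q y) a - alt_sum i (antidiff q y) (a - 1)"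
    using alt_sum_diff[of i "antidiff q y" "\<lambda>a. antidiff q y (a - 1)" a] alt_sum_shift[of i "antidiff q y" "- 1" a] by simp
  then show ?thesis using sequences_antidiff[OF assms] by simp
qed

text \<open>A shift changes the value by an alternating sum of \<open>y\<close>, which is 0. So the
  formula is compatible with column \<open>p\<close> being a single region.\<close>

lemma alt_sum_antidiff_const:
  assumes "y \<in> sequences p q k"
  shows "alt_sum p (antidiff q y) a = alt_sum p (antidiff q y) 0"
proof -
  have *: "alt_sum p (antidiff q y) a = alt_sum p (antidiff q y) (a - 1)" for a
    using alt_sum_antidiff_diff[OF assms, of p a] assms by (simp add: sequences_def)
  show ?thesis
  proof (induction a rule: int_induct[where k = 0])
    case (step1 i)
    then show ?case using *[of "i + 1"] by simp
  next
    case (step2 i)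
    then show ?case using *[of i] by simp
  qed simp
qed

text \<open>The value in row \<open>a + 1\<close> exceeds the left neighbour by \<open>d\<close>,
  and the value in row \<open>a - 1\<close> falls short of the right neighbour by \<open>d\<close>.
  Where a neighbour is missing, the region itself takes its place; at the right end this uses the
  constancy of the alternating sum of length \<open>p\<close>.\<close>

lemma kirchhoff_alt_sum_antidiff:
  assumes y: "y \<in> sequences p q k"
  shows "kirchhoff p q b (\<lambda>i. alt_sum i (antidiff q y))"
  unfolding kirchhoff_def
proof (intro conjI allI impI; (elim conjE)?)
  let ?Y = "antidiff q y"
  fix i a assume i: "0 < i" "i < p" "even i = b"
  define d where "d = ?Y (a + int i) - ?Y (a + int i - 1)"
  have left: "alt_sum i ?Y (a + 1) = (if 1 < i then alt_sum (i - 2) ?Y (a + 1) else alt_sum i ?Y a) + d"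
  proof (cases "1 < i")
    case True
    then show ?thesis using alt_sum_step'[of i ?Y "a + 1"] by (simp add: d_def algebra_simps)
  next
    case False
    then have "i = 1" using i by simp
    then show ?thesis by (simp add: d_def)
  qed
  have right: "alt_sum i ?Y (a - 1) = (if i + 1 < p then alt_sum (i + 2) ?Y (a - 1) else alt_sum i ?Y a) - d"
  proof (cases "i + 1 < p")
    case True
    then show ?thesis using alt_sum_step[of i ?Y "a - 1"] by (simp add: d_def algebra_simps)
  next
    case False
    then have "p = Suc i" using i by simp
    then have "?Y (a + int i) - alt_sum i ?Y a = ?Y (a - 1 + int i) - alt_sum i ?Y (a - 1)"
      using alt_sum_antidiff_const[OF y, of a] alt_sum_antidiff_const[OF y, of "a - 1"] by simp
    then show ?thesis using False by (simp add: d_def algebra_simps)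
  qed
  show "alt_sum i ?Y (a - 1) - alt_sum i ?Y a + (alt_sum i ?Y (a + 1) - alt_sum i ?Y a) -
      (if i + 1 < p then alt_sum (i + 2) ?Y (a - 1) - alt_sum i ?Y a else 0) -
      (if 1 < i then alt_sum (i - 2) ?Y (a + 1) - alt_sum i ?Y a else 0) = 0"
    unfolding left right by simp
next
  have "alt_sum 2 (antidiff q y) (a - 1) = y a" for a
    using sequences_antidiff[OF y, of a] by (simp add: numeral_2_eq_2)
  then show "(\<Sum>j<q. alt_sum 2 (antidiff q y) (int j - 1) - alt_sum 0 (antidiff q y) 0) = 0"
    using y by (simp add: sequences_def)
next
  have "alt_sum (p - 2) (antidiff q y) a - alt_sum p (antidiff q y) 0 = - y (a + int (p - 1))" for a
    using alt_sum_step'[of p "antidiff q y" a] alt_sum_antidiff_const[OF y, of a] p sequences_antidiff[OF y, of "a + int (p - 1)"]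
    by (simp add: algebra_simps of_nat_diff)
  then have "(\<Sum>j<q. alt_sum (p - 2) (antidiff q y) (int j) - alt_sum p (antidiff q y) 0) = - (\<Sum>j<q. y (int j + int (p - 1)))"
    by (simp add: sum_negf)
  also have "(\<Sum>j<q. y (int j + int (p - 1))) = (\<Sum>j<q. y (int j))"
    by (rule sum_periodic_shift) (use y in \<open>simp add: sequences_def\<close>)
  finally show "(\<Sum>j<q. alt_sum (p - 2) (antidiff q y) (int j) - alt_sum p (antidiff q y) 0) = 0"
    using y by (simp add: sequences_def)
qed

text \<open>The equations at the column \<open>i\<close> determine the column \<open>i + 2\<close> from the two previous ones.\<close>

lemma kirchhoff_columns:
  assumes K: "kirchhoff p q b X"
    and start: "b \<Longrightarrow> \<forall>a. X 0 a = c" "b \<Longrightarrow> \<forall>a. X 2 a = alt_sum 2 Y a + c" "\<not> b \<Longrightarrow> \<forall>a. X 1 a = alt_sum 1 Y a + c"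
  shows "i \<le> p \<Longrightarrow> even i = b \<Longrightarrow> X i a = alt_sum i Y a + c"
proof (induction i arbitrary: a rule: less_induct)
  case (less i)
  have eq: "X j (a - 1) - X j a + (X j (a + 1) - X j a) -
        (if j + 1 < p then X (j + 2) (a - 1) - X j a else 0) -
        (if 1 < j then X (j - 2) (a + 1) - X j a else 0) = 0" if "0 < j" "j < p" "even j = b" for j a
    using K that unfolding kirchhoff_def by blast
  \<comment> \<open>Column 3 comes from the equation at column 1, which has no left neighbour; from
    column 4 on, the equation at \<open>i - 2\<close> involves \<open>i - 4\<close> as well.\<close>
  consider "i = 0" | "i = 1" | "i = 2" | "i = 3" | "i > 3" by linarith
  then show ?case
  proof cases
    case 1
    then show ?thesis using start(1) less.prems by simp
  next
    case 2
    then show ?thesis using start(3) less.prems by simp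
  next
    case 3
    then show ?thesis using start(2) less.prems by simp
  next
    case 4
    then have "\<not> b" using less.prems by simp
    then have "X 3 a = X 1 a + X 1 (a + 2) - X 1 (a + 1)"
      using eq[of 1 "a + 1"] less.prems 4 by (simp add: algebra_simps numeral_3_eq_3)
    moreover have "alt_sum 3 Y a = alt_sum 1 Y a + alt_sum 1 Y (a + 2) - alt_sum 1 Y (a + 1)"
      by (simp add: numeral_3_eq_3 algebra_simps)
    ultimately show ?thesis using start(3) \<open>\<not> b\<close> 4 by (simp del: alt_sum.simps)
  next
    case 5
    define j where "j = i - 2"
    have j: "i = j + 2" "1 < j" "j < p" "even j = b" using 5 less.prems by (auto simp: j_def)
    have IH: "X j a = alt_sum j Y a + c" "X (j - 2) a = alt_sum (j - 2) Y a + c" for a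
      using less.IH[of j a] less.IH[of "j - 2" a] j less.prems by auto
    have "X (j + 2) a = X j a + X j (a + 2) - X (j - 2) (a + 2)"
      using eq[of j "a + 1"] j less.prems by (simp add: algebra_simps)
    also have "\<dots> = alt_sum (j + 2) Y a + c"
      unfolding IH using alt_sum_interior[of j Y "a + 1"] j by (simp add: algebra_simps del: alt_sum.simps)
    finally show ?thesis using j by simp
  qed
qed

lemma kirchhoff_imp_alt_sum_antidiff:
  assumes K: "kirchhoff p q b X" and per: "\<And>i a. X i (a + int q) = X i a"
    and const: "\<And>a. X 0 a = X 0 0" "\<And>a. X p a = X p 0"
    and tors: "\<And>i a. zmul k (X i a) = 0"
  obtains y c where "y \<in> sequences p q k"
    and "\<And>i a. i \<le> p \<Longrightarrow> even i = b \<Longrightarrow> X i a = alt_sum i (antidiff q y) a + c"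
proof -
  \<comment> \<open>Among the even columns, column 0 is constant, so column 2 shows the first
    increment; among the odd ones, column 1 is the antidifference up to a constant, so its vertical
    differences give \<open>y\<close>.\<close>
  define y where "y a = (if b then X 2 (a - 1) - X 0 0 else X 1 a - X 1 (a - 1))" for a
  define c where "c = (if b then X 0 0 else X 1 0)"
  have yper: "y (a + int q) = y a" for a
    using per[of _ "a - 1"] per[of 1 a] by (simp add: y_def algebra_simps)
  have ysum: "(\<Sum>j<q. y (int j)) = 0"
  proof (cases b)
    case True
    then show ?thesis using K by (simp add: y_def kirchhoff_def)
  next
    case False
    have "(\<Sum>j<n. X 1 (int j) - X 1 (int j - 1)) = X 1 (int n - 1) - X 1 (- 1)" for n
      by (induction n) auto
    from this[of q] show ?thesis using False per[of 1 "- 1"] by (simp add: y_def)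
  qed
  have ydiff: "antidiff q y a - antidiff q y (a - 1) = y a" for a
    by (rule antidiff_diff) (use q yper ysum in auto)
  have col: "X i a = alt_sum i (antidiff q y) a + c" if "i \<le> p" "even i = b" for i a
  proof (rule kirchhoff_columns[OF K])
    show "\<forall>a. X 0 a = c" if b using that const(1) by (simp add: c_def)
    show "\<forall>a. X 2 a = alt_sum 2 (antidiff q y) a + c" if b
    proof
      fix a
      show "X 2 a = alt_sum 2 (antidiff q y) a + c"
        using that ydiff[of "a + 1"] by (simp add: y_def c_def numeral_2_eq_2 algebra_simps)
    qed
    show "\<forall>a. X 1 a = alt_sum 1 (antidiff q y) a + c" if "\<not> b"
    proof -
      have "y = (\<lambda>a. X 1 a - X 1 (a - 1))" using that by (simp add: y_def fun_eq_iff)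
      then show ?thesis using antidiff_of_diff[OF q, of "X 1"] per that by (simp add: c_def)
    qed
  qed (use that in auto)
  \<comment> \<open>Either column \<open>p\<close> is coloured and is one region, or column
    \<open>p - 1\<close> is coloured and its equation lacks a right neighbour.\<close>
  have end_const: "alt_sum p (antidiff q y) a = alt_sum p (antidiff q y) (a - 1)" for a
  proof (cases "even p = b")
    case True
    then show ?thesis using col[of p a] col[of p "a - 1"] const(2)[of a] const(2)[of "a - 1"] by simp
  next
    case False
    define m where "m = p - 1"
    have m: "p = Suc m" "0 < m" "even m = b" using p False by (auto simp: m_def)
    have eq: "X m (a - 1) - X m a + (X m (a + 1) - X m a) -
        (if 1 < m then X (m - 2) (a + 1) - X m a else 0) = 0"
      using K[unfolded kirchhoff_def, THEN conjunct1, rule_format, of m a] m by simp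
    show ?thesis
    proof (cases "1 < m")
      case True
      have "alt_sum m (antidiff q y) (a - 1) - alt_sum m (antidiff q y) a + (alt_sum m (antidiff q y) (a + 1) - alt_sum (m - 2) (antidiff q y) (a + 1)) = 0"
        using eq True m col[of m] col[of "m - 2"] by (simp add: algebra_simps)
      moreover have "alt_sum m (antidiff q y) (a + 1) - alt_sum (m - 2) (antidiff q y) (a + 1) =
          antidiff q y (a + int m) - antidiff q y (a - 1 + int m)"
        using alt_sum_step'[of m "antidiff q y" "a + 1"] True by (simp add: algebra_simps)
      ultimately have "alt_sum m (antidiff q y) (a - 1) - alt_sum m (antidiff q y) a +
          (antidiff q y (a + int m) - antidiff q y (a - 1 + int m)) = 0" by metis
      then show ?thesis unfolding m by (simp add: algebra_simps)
    next
      case False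
      then have "m = 1" using m by simp
      then show ?thesis using eq m col[of 1] by (simp add: algebra_simps)
    qed
  qed
  have "alt_sum p y a = 0" for a
  proof -
    have "alt_sum p (\<lambda>a. antidiff q y a - antidiff q y (a - 1)) a = alt_sum p (antidiff q y) a - alt_sum p (antidiff q y) (a - 1)"
      using alt_sum_diff[of p "antidiff q y" "\<lambda>a. antidiff q y (a - 1)" a] alt_sum_shift[of p "antidiff q y" "- 1" a] by simp
    then show ?thesis using end_const[of a] by (simp add: ydiff)
  qed
  moreover have "zmul k (y a) = 0" for a
    using tors by (simp add: y_def zmul.scale_right_diff_distrib)
  ultimately have "y \<in> sequences p q k" using yper ysum by (simp add: sequences_def)
  then show thesis using col by (rule that)
qed

end

lemma sum_periodic_delta:
  fixes F :: "int \<Rightarrow> qmodz"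
  assumes "q > 0" "\<And>a. F (a + int q) = F a"
  shows "(\<Sum>j<q. if int j mod int q = a mod int q then F (int j) else 0) = F a"
proof -
  have a: "0 \<le> a mod int q" "a mod int q < int q" using assms(1) by auto
  have "(\<Sum>j<q. if int j mod int q = a mod int q then F (int j) else 0) =
      (\<Sum>j<q. if j = nat (a mod int q) then F (a mod int q) else 0)"
    by (rule sum.cong) (use a in auto)
  also have "\<dots> = F (a mod int q)" using a by (simp add: nat_less_iff)
  finally show ?thesis using periodic_mod[of F q a] assms(2) by simp
qed

lemma sum_periodic_delta_pred:
  fixes F :: "int \<Rightarrow> qmodz"
  assumes "q > 0" "\<And>a. F (a + int q) = F a"
  shows "(\<Sum>j<q. if (int j - 1) mod int q = a mod int q then F (int j) else 0) = F (a + 1)"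
proof -
  have "(int j - 1) mod int q = a mod int q \<longleftrightarrow> int j mod int q = (a + 1) mod int q" for j
    by (metis add_diff_cancel_right' diff_add_cancel mod_add_left_eq mod_diff_left_eq)
  then show ?thesis using sum_periodic_delta[of q F "a + 1"] assms by simp
qed

lemma kirchhoff_cong:
  assumes "p > 1" "\<And>i a. i \<le> p \<Longrightarrow> X i a = X' i a" "kirchhoff p q b X"
  shows "kirchhoff p q b X'"
  using assms(3) unfolding kirchhoff_def
proof (elim conjE, intro conjI allI impI)
  have eq: "X' i a = X i a" if "i \<le> p" for i a using assms(2) that by simp
  fix i a
  assume "\<forall>i a. 0 < i \<and> i < p \<and> even i = b \<longrightarrow> X i (a - 1) - X i a + (X i (a + 1) - X i a) -
        (if i + 1 < p then X (i + 2) (a - 1) - X i a else 0) -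
        (if 1 < i then X (i - 2) (a + 1) - X i a else 0) = 0"
    and i: "0 < i \<and> i < p \<and> even i = b"
  then have "X i (a - 1) - X i a + (X i (a + 1) - X i a) -
        (if i + 1 < p then X (i + 2) (a - 1) - X i a else 0) -
        (if 1 < i then X (i - 2) (a + 1) - X i a else 0) = 0" by blast
  then show "X' i (a - 1) - X' i a + (X' i (a + 1) - X' i a) -
        (if i + 1 < p then X' (i + 2) (a - 1) - X' i a else 0) -
        (if 1 < i then X' (i - 2) (a + 1) - X' i a else 0) = 0"
    using eq i by (auto split: if_splits)
next
  assume "b \<longrightarrow> (\<Sum>j<q. X 2 (int j - 1) - X 0 0) = 0" b
  then show "(\<Sum>j<q. X' 2 (int j - 1) - X' 0 0) = 0" using assms(1,2) by simp
next
  assume "even p = b \<longrightarrow> (\<Sum>j<q. X (p - 2) (int j) - X p 0) = 0" "even p = b"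
  then show "(\<Sum>j<q. X' (p - 2) (int j) - X' p 0) = 0" using assms(1,2) by simp
qed

section \<open>Goeritz matrices\<close>

lemma goeritz_entry_sym: "goeritz_entry D B R S = goeritz_entry D B S R"
  unfolding goeritz_entry_def meet_at_def by (rule sum.cong) auto

lemma goeritz_matrix_carrier: "goeritz_matrix D Rs \<in> carrier_mat (length Rs) (length Rs)"
  by (simp add: goeritz_matrix_def)

lemma goeritz_matrix_row_sum:
  assumes "i < length Rs"
  shows "(\<Sum>j<length Rs. goeritz_matrix D Rs $$ (i, j)) = 0"
proof -
  have "(\<Sum>j<length Rs. goeritz_matrix D Rs $$ (i, j)) =
    goeritz_matrix D Rs $$ (i, i) + (\<Sum>j\<in>{..<length Rs} - {i}. goeritz_matrix D Rs $$ (i, j))"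
    using assms by (intro sum.remove) auto
  also have "(\<Sum>j\<in>{..<length Rs} - {i}. goeritz_matrix D Rs $$ (i, j)) =
    (\<Sum>j\<in>{..<length Rs} - {i}. goeritz_entry D (set Rs) (Rs ! i) (Rs ! j))"
    by (rule sum.cong) (use assms in \<open>auto simp: goeritz_matrix_def\<close>)
  finally show ?thesis using assms by (simp add: goeritz_matrix_def)
qed

lemma goeritz_matrix_col_sum:
  assumes "j < length Rs"
  shows "(\<Sum>i<length Rs. goeritz_matrix D Rs $$ (i, j)) = 0"
proof -
  have "(\<Sum>i<length Rs. goeritz_matrix D Rs $$ (i, j)) = (\<Sum>i<length Rs. goeritz_matrix D Rs $$ (j, i))"
    by (rule sum.cong) (use assms goeritz_entry_sym in \<open>auto simp: goeritz_matrix_def\<close>)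
  then show ?thesis using goeritz_matrix_row_sum[OF assms] by simp
qed

text \<open>The zero row sum removes the diagonal entry and leaves a weighted graph Laplacian in the
  differences \<open>x j - x i\<close>.\<close>

lemma mat_act_goeritz_matrix:
  assumes "i < length Rs"
  shows "mat_act (goeritz_matrix D Rs) x i =
    (\<Sum>j\<in>{..<length Rs} - {i}. zmul (goeritz_entry D (set Rs) (Rs ! i) (Rs ! j)) (x j - x i))"
proof -
  define A where "A = goeritz_matrix D Rs"
  have A: "dim_col A = length Rs" by (simp add: A_def goeritz_matrix_def)
  have "mat_act A x i = (\<Sum>j<length Rs. zmul (A $$ (i, j)) (x j - x i)) + zmul (\<Sum>j<length Rs. A $$ (i, j)) (x i)"
    by (simp add: mat_act_def A zmul.scale_right_diff_distrib sum_subtractf zmul.scale_sum_left)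
  also have "\<dots> = (\<Sum>j<length Rs. zmul (A $$ (i, j)) (x j - x i))"
    using goeritz_matrix_row_sum[OF assms] by (simp add: A_def)
  also have "\<dots> = (\<Sum>j\<in>{..<length Rs} - {i}. zmul (A $$ (i, j)) (x j - x i))"
    by (rule sum.mono_neutral_right) auto
  also have "\<dots> = (\<Sum>j\<in>{..<length Rs} - {i}. zmul (goeritz_entry D (set Rs) (Rs ! i) (Rs ! j)) (x j - x i))"
    by (rule sum.cong) (use assms in \<open>auto simp: A_def goeritz_matrix_def\<close>)
  finally show ?thesis by (simp add: A_def)
qed

section \<open>The standard diagram of a torus link\<close>

lemma length_concat_replicate: "length (concat (replicate n xs)) = n * length xs"
  by (induction n) auto

lemma nth_concat_replicate:
  "t < n * length xs \<Longrightarrow> concat (replicate n xs) ! t = xs ! (t mod length xs)"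
proof (induction n arbitrary: t)
  case (Suc n)
  then show ?case
    by (cases "t < length xs") (auto simp: nth_append le_mod_geq not_less)
qed simp

text \<open>In a closed braid every arc joins a top end to a bottom end, so the conditions on arcs
  reduce to a bijection between the two kinds of ends.\<close>

lemma arcs_of_bij:
  assumes f: "bij_betw f T B" and disj: "T \<inter> B = {}"
  shows "\<forall>a\<in>{{x, f x} | x. x \<in> T}. a \<subseteq> T \<union> B \<and> card a = 2"
    and "\<forall>x\<in>T \<union> B. \<exists>!a. a \<in> {{x, f x} | x. x \<in> T} \<and> x \<in> a"
    and "card {{x, f x} | x. x \<in> T} = card T"
proof -
  have B: "f x \<in> B" if "x \<in> T" for x using f that by (auto dest: bij_betwE)
  have ne: "x \<noteq> f y" if "x \<in> T" "y \<in> T" for x y using B that disj by blast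
  have inj: "x = y" if "x \<in> T" "y \<in> T" "f x = f y" for x y
    using f that by (meson bij_betw_imp_inj_on inj_onD)
  show "\<forall>a\<in>{{x, f x} | x. x \<in> T}. a \<subseteq> T \<union> B \<and> card a = 2"
    using B ne by auto
  show "\<forall>x\<in>T \<union> B. \<exists>!a. a \<in> {{x, f x} | x. x \<in> T} \<and> x \<in> a"
  proof
    fix x assume "x \<in> T \<union> B"
    then obtain y where y: "y \<in> T" "x \<in> {y, f y}"
      using f by (auto simp: bij_betw_def)
    show "\<exists>!a. a \<in> {{x, f x} | x. x \<in> T} \<and> x \<in> a"
    proof (rule ex1I[of _ "{y, f y}"])
      fix a assume "a \<in> {{x, f x} | x. x \<in> T} \<and> x \<in> a"
      then obtain z where z: "z \<in> T" "a = {z, f z}" "x \<in> {z, f z}" by blast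
      then have "z = y" using y ne inj by auto
      then show "a = {y, f y}" using z by simp
    qed (use y in auto)
  qed
  have "inj_on (\<lambda>x. {x, f x}) T"
    by (rule inj_onI) (use ne in \<open>auto simp: doubleton_eq_iff\<close>)
  then show "card {{x, f x} | x. x \<in> T} = card T"
    by (simp add: card_image Setcompr_eq_image)
qed

locale torus_diagram =
  fixes p q :: nat
  assumes p: "p > 1" and q: "q > 1"
begin

abbreviation "D \<equiv> torus_link p q"

definition w :: "nat list" where "w = concat (replicate q [1..<p])"

definition m :: nat where "m = p - 1"

lemma m: "m > 0" "p = Suc m"
  using p by (auto simp: m_def)

text \<open>
  The crossing of the column \<open>i\<close>, where \<open>0 < i < p\<close>, in the row \<open>a\<close> modulo \<open>q\<close>, as a position
  in the braid word.
\<close>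

definition cr :: "nat \<Rightarrow> int \<Rightarrow> nat" where
  "cr i a = nat (a mod int q) * m + (i - 1)"

section \<open>Positions of the crossings in the braid word\<close>

lemma cr_less:
  assumes "0 < i" "i < p"
  shows "cr i a < q * m"
proof -
  have "nat (a mod int q) < q" using q by (simp add: nat_less_iff)
  then have "(nat (a mod int q) + 1) * m \<le> q * m" by (intro mult_right_mono) auto
  then show ?thesis using assms m by (simp add: cr_def)
qed

lemma cr_mod: "cr i (a mod int q) = cr i a"
  by (simp add: cr_def)

lemma cr_mod_eq: "0 < i \<Longrightarrow> i < p \<Longrightarrow> cr i a mod m = i - 1"
  using m by (cases i) (auto simp: cr_def)

lemma cr_div_eq: "0 < i \<Longrightarrow> i < p \<Longrightarrow> cr i a div m = nat (a mod int q)"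
  using m by (cases i) (auto simp: cr_def)

lemma cr_eq_iff:
  assumes "0 < i" "i < p" "0 < i'" "i' < p"
  shows "cr i a = cr i' a' \<longleftrightarrow> i = i' \<and> a mod int q = a' mod int q"
proof
  assume *: "cr i a = cr i' a'"
  from arg_cong[OF *, of "\<lambda>t. t mod m"] have "i = i'"
    using assms by (simp add: cr_mod_eq[simplified])
  moreover from arg_cong[OF *, of "\<lambda>t. t div m"] have "a mod int q = a' mod int q"
    using assms q by (simp add: cr_div_eq eq_nat_nat_iff)
  ultimately show "i = i' \<and> a mod int q = a' mod int q" ..
qed (auto simp: cr_def)

lemma cr_surj:
  assumes "t < q * m"
  obtains i a where "0 < i" "i < p" "0 \<le> a" "a < int q" "t = cr i a"
proof
  have "t div m < q" using assms by (simp add: less_mult_imp_div_less)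
  then show "0 \<le> int (t div m)" "int (t div m) < int q" by auto
  show "t = cr (t mod m + 1) (int (t div m))"
    using \<open>t div m < q\<close> by (simp add: cr_def)
  have "t mod m < m" using m by simp
  then show "t mod m + 1 < p" "0 < t mod m + 1" using m by linarith+
qed

lemma length_w: "length w = q * m"
  by (simp add: w_def m_def length_concat_replicate)

lemma nth_w: "t < q * m \<Longrightarrow> w ! t = t mod m + 1"
proof -
  assume t: "t < q * m"
  have l: "length [1..<p] = m" by (simp add: m_def)
  have "t mod m < m" using m by simp
  then have "[1..<p] ! (t mod m) = t mod m + 1" using m(2) by (subst nth_upt) auto
  with t show "w ! t = t mod m + 1"
    unfolding w_def by (subst nth_concat_replicate) (simp_all only: l)
qed

lemma nth_w_cr: "0 < i \<Longrightarrow> i < p \<Longrightarrow> w ! cr i a = i"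
  using nth_w[OF cr_less[of i a]] by (simp add: cr_mod_eq[simplified])

lemma touches_shift:
  assumes "0 < i" "i < p"
  shows "touches w ((cr i a + k) mod length w) j \<longleftrightarrow>
    j = (i - 1 + k) mod m + 1 \<or> j = (i - 1 + k) mod m + 2"
proof -
  have "(cr i a + k) mod length w < q * m" using m q by (simp add: length_w)
  then have "w ! ((cr i a + k) mod length w) = (cr i a + k) mod length w mod m + 1"
    by (rule nth_w)
  also have "(cr i a + k) mod length w mod m = (cr i a + k) mod m"
    by (simp add: length_w mod_mod_cancel)
  also have "\<dots> = (i - 1 + k) mod m"
    using assms by (metis cr_mod_eq mod_add_left_eq)
  finally show ?thesis by (simp add: touches_def)
qed

text \<open>A row has \<open>m\<close> letters, so \<open>m + i' - i\<close> letters lead from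
  column \<open>i\<close> to column \<open>i'\<close> of the next row; the wrap at the end of the
  word matches that of the rows modulo \<open>q\<close>.\<close>

lemma cr_shift:
  assumes "0 < i" "i < p" "0 < i'" "i' < p" "i + k = i' + m"
  shows "(cr i a + k) mod length w = cr i' (a + 1)"
proof -
  define b where "b = nat (a mod int q)"
  have b: "b < q" using q by (simp add: b_def nat_less_iff)
  have eq: "cr i a + k = (b + 1) * m + (i' - 1)"
  proof -
    have "i - 1 + k = m + (i' - 1)" using assms by linarith
    then show ?thesis by (simp add: cr_def flip: b_def)
  qed
  have b1: "nat ((a + 1) mod int q) = (b + 1) mod q"
  proof -
    have "int (nat ((a + 1) mod int q)) = (int b + 1) mod int q"
      using q by (simp add: b_def mod_add_left_eq)
    then show ?thesis by (metis of_nat_1 of_nat_add of_nat_eq_iff of_nat_mod)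
  qed
  have c: "cr i' (a + 1) = (b + 1) mod q * m + (i' - 1)" by (simp only: cr_def b1)
  show ?thesis
  proof (cases "b + 1 < q")
    case True
    then have "cr i a + k = cr i' (a + 1)" unfolding eq c by simp
    then show ?thesis using cr_less[of i' "a + 1"] assms by (simp add: length_w)
  next
    case False
    then have "b + 1 = q" using b by simp
    then have "cr i a + k = length w + cr i' (a + 1)"
      unfolding eq c length_w by simp
    then show ?thesis using cr_less[of i' "a + 1"] assms by (simp add: length_w)
  qed
qed

lemma mod_below_double: "t < 2 * m \<Longrightarrow> t mod m = (if t < m then t else t - m)"
  by (simp add: le_mod_geq)

text \<open>The strand in position \<open>i\<close> next meets the generator \<open>i - 1\<close>,
  which occurs \<open>m - 1\<close> letters later; position 1 is touched only by the generator 1,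
  which recurs after \<open>m\<close> letters.\<close>

lemma next_crossing_left:
  assumes "0 < i" "i < p"
  shows "next_crossing w (cr i a) i = (if i = 1 then cr 1 (a + 1) else cr (i - 1) (a + 1))"
proof -
  define k where "k = (if i = 1 then m else m - 1)"
  have k: "0 < k" "k \<le> m" using assms m by (auto simp: k_def)
  have "(LEAST k. 0 < k \<and> touches w ((cr i a + k) mod length w) i) = k"
  proof (rule Least_equality)
    show "0 < k \<and> touches w ((cr i a + k) mod length w) i"
      unfolding touches_shift[OF assms] using assms m k mod_below_double[of "i - 1 + k"]
      by (auto simp: k_def)
    fix y assume "0 < y \<and> touches w ((cr i a + y) mod length w) i"
    then show "k \<le> y"
      unfolding touches_shift[OF assms] using assms m mod_below_double[of "i - 1 + y"]
      by (cases "y < m") (auto simp: k_def split: if_splits)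
  qed
  then have "next_crossing w (cr i a) i = (cr i a + k) mod length w"
    unfolding next_crossing_def by simp
  also have "\<dots> = cr (if i = 1 then 1 else i - 1) (a + 1)"
    using assms m by (intro cr_shift) (auto simp: k_def)
  finally show ?thesis by simp
qed

text \<open>The generator \<open>i + 1\<close> is the very next letter; the last position is touched
  only by the generator \<open>p - 1\<close>, which recurs after \<open>m\<close> letters.\<close>

lemma next_crossing_right:
  assumes "0 < i" "i < p"
  shows "next_crossing w (cr i a) (i + 1) = (if i + 1 = p then cr i (a + 1) else cr (i + 1) a)"
proof -
  define k where "k = (if i + 1 = p then m else 1)"
  have k: "0 < k" "k \<le> m" using assms m by (auto simp: k_def)
  have "(LEAST k. 0 < k \<and> touches w ((cr i a + k) mod length w) (i + 1)) = k"
  proof (rule Least_equality)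
    show "0 < k \<and> touches w ((cr i a + k) mod length w) (i + 1)"
      unfolding touches_shift[OF assms] using assms m k mod_below_double[of "i - 1 + k"]
      by (auto simp: k_def)
    fix y assume "0 < y \<and> touches w ((cr i a + y) mod length w) (i + 1)"
    then show "k \<le> y"
      unfolding touches_shift[OF assms] using assms m mod_below_double[of "i - 1 + y"]
      by (cases "y < m") (auto simp: k_def split: if_splits)
  qed
  moreover have "(cr i a + 1) mod length w = cr (i + 1) a" if "i + 1 \<noteq> p"
  proof -
    have "cr i a + 1 = cr (i + 1) a" using assms by (simp add: cr_def)
    then show ?thesis using cr_less[of "i + 1" a] assms that by (simp add: length_w)
  qed
  moreover have "(cr i a + m) mod length w = cr i (a + 1)"
    using assms by (intro cr_shift) auto
  ultimately show ?thesis
    unfolding next_crossing_def by (auto simp: k_def)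
qed

lemma torus_link_eq: "D = braid_closure w"
  by (simp only: torus_link_def w_def)

lemma crossings_D: "crossings D = {cr i a | i a. 0 < i \<and> i < p}"
proof -
  have "crossings D = {..<q * m}"
    by (simp add: torus_link_eq braid_closure_def length_w)
  also have "\<dots> = {cr i a | i a. 0 < i \<and> i < p}"
    using cr_less cr_surj by (auto, metis)
  finally show ?thesis .
qed

text \<open>The ends that are joined to the ends 2 and 1 of the crossing \<open>(i, a)\<close>.\<close>

definition above_left :: "nat \<Rightarrow> int \<Rightarrow> nat \<times> nat" where
  "above_left i a = (if i = 1 then (cr 1 (a + 1), 3) else (cr (i - 1) (a + 1), 0))"

definition above_right :: "nat \<Rightarrow> int \<Rightarrow> nat \<times> nat" where
  "above_right i a = (if i + 1 = p then (cr i (a + 1), 0) else (cr (i + 1) a, 3))"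

lemma arcs_D: "arcs D = {{(cr i a, 2), above_left i a} | i a. 0 < i \<and> i < p} \<union>
  {{(cr i a, 1), above_right i a} | i a. 0 < i \<and> i < p}"
proof -
  have l: "{top_end w (cr i a) i, bottom_end w (next_crossing w (cr i a) i) i} =
      {(cr i a, 2), above_left i a}" if "0 < i" "i < p" for i a
    using that nth_w_cr[of "i - 1" "a + 1"] nth_w_cr[of i] nth_w_cr[of i "a + 1"]
    by (auto simp: next_crossing_left top_end_def bottom_end_def above_left_def)
  have r: "{top_end w (cr i a) (i + 1), bottom_end w (next_crossing w (cr i a) (i + 1)) (i + 1)} =
      {(cr i a, 1), above_right i a}" if "0 < i" "i < p" for i a
    unfolding next_crossing_right[OF that]
    using that nth_w_cr[of "i + 1" "a"] nth_w_cr[of i] nth_w_cr[of i "a + 1"]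
    by (auto simp: top_end_def bottom_end_def above_right_def)
  have "arcs D = {{top_end w t j, bottom_end w (next_crossing w t j) j} | t j.
      t < length w \<and> touches w t j}"
    by (simp add: torus_link_eq braid_closure_def)
  also have "\<dots> = {{top_end w (cr i a) j, bottom_end w (next_crossing w (cr i a) j) j} | i a j.
      0 < i \<and> i < p \<and> (j = i \<or> j = i + 1)}" (is "?L = ?R")
  proof (intro equalityI subsetI)
    fix x assume "x \<in> ?L"
    then obtain t j where t: "t < length w" "touches w t j"
      "x = {top_end w t j, bottom_end w (next_crossing w t j) j}" by blast
    from t(1) obtain i a where "0 < i" "i < p" "t = cr i a"
      unfolding length_w by (rule cr_surj)
    with t(2,3) show "x \<in> ?R" by (auto simp: touches_def nth_w_cr)
  next
    fix x assume "x \<in> ?R"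
    then obtain i a j where "0 < i" "i < p" "j = i \<or> j = i + 1"
      "x = {top_end w (cr i a) j, bottom_end w (next_crossing w (cr i a) j) j}" by blast
    moreover from this have "cr i a < length w" "touches w (cr i a) j"
      using cr_less[of i a] by (auto simp: length_w touches_def nth_w_cr)
    ultimately show "x \<in> ?L" by blast
  qed
  also have "\<dots> = {{(cr i a, 2), above_left i a} | i a. 0 < i \<and> i < p} \<union>
      {{(cr i a, 1), above_right i a} | i a. 0 < i \<and> i < p}"
    using l r by blast
  finally show ?thesis .
qed

text \<open>
  Regions are labelled by a column and a row: the region \<open>(i, a)\<close> lies directly above the crossing
  \<open>(i, a)\<close>. The junk row 0 is used for the outer columns \<open>0\<close> and \<open>p\<close>, which are single regions.
\<close>

definition pt :: "nat \<Rightarrow> int \<Rightarrow> nat \<times> int" where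
  "pt i a = (i, if i = 0 \<or> i = p then 0 else a mod int q)"

definition pts :: "(nat \<times> int) set" where
  "pts = {pt i a | i a. i \<le> p}"

text \<open>The corners 0, 1, 2, 3 lie to the right of, above, to the left of and below the
  crossing. A row climbs to the right, so the region on the right lies directly above the crossing
  \<open>(i + 1, a - 1)\<close>.\<close>

definition lab :: "nat \<times> nat \<Rightarrow> nat \<times> int" where
  "lab x = (let i = fst x mod m + 1; a = int (fst x div m) in
     if snd x = 0 then pt (i + 1) (a - 1) else if snd x = 1 then pt i a
     else if snd x = 2 then pt (i - 1) a else pt i (a - 1))"

definition reg :: "nat \<times> int \<Rightarrow> (nat \<times> nat) set" where
  "reg l = {y \<in> ends D. lab y = l}"

section \<open>Regions as classes of corners\<close>

lemma pt_mod: "pt i (a mod int q) = pt i a" "pt i (a mod int q - 1) = pt i (a - 1)"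
  by (simp_all add: pt_def mod_diff_left_eq)

lemma pt_0: "pt 0 a = pt 0 0" and pt_p: "pt p a = pt p 0"
  by (simp_all add: pt_def)

lemma pt_eq_iff: "0 < i \<Longrightarrow> i < p \<Longrightarrow> pt i a = pt j b \<longleftrightarrow> i = j \<and> a mod int q = b mod int q"
  by (auto simp: pt_def)

lemma lab_cr:
  assumes "0 < i" "i < p"
  shows "lab (cr i a, 0) = pt (i + 1) (a - 1)" "lab (cr i a, 1) = pt i a"
    "lab (cr i a, 2) = pt (i - 1) a" "lab (cr i a, 3) = pt i (a - 1)"
    "lab (cr i a, Suc 0) = pt i a"
  using q by (simp_all add: lab_def cr_mod_eq[OF assms, simplified] cr_div_eq[OF assms] Let_def pt_mod assms)

lemma ends_D: "ends D = {(cr i a, k) | i a k. 0 < i \<and> i < p \<and> k < 4}"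
  unfolding ends_def crossings_D by auto

lemma lab_in_pts: "x \<in> ends D \<Longrightarrow> lab x \<in> pts"
proof -
  assume "x \<in> ends D"
  then obtain i a k where x: "x = (cr i a, k)" "0 < i" "i < p" "k < 4" unfolding ends_D by blast
  then have "k \<in> {0, 1, 2, 3}" by auto
  then show ?thesis unfolding x(1) pts_def using lab_cr[of i a] x(2,3)
    by (elim insertE emptyE; simp only:) (auto intro: exI[of _ "i + 1"] exI[of _ i] exI[of _ "i - 1"])
qed

lemma pts_obtain_end:
  assumes "l \<in> pts"
  obtains x where "x \<in> ends D" "lab x = l"
proof -
  from assms obtain i a where l: "l = pt i a" "i \<le> p" unfolding pts_def by blast
  consider "i = 0" | "i = p" | "0 < i" "i < p" using l(2) by linarith
  then show thesis
  proof cases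
    case 1
    have "(cr 1 a, 2) \<in> ends D" "lab (cr 1 a, 2) = l"
      using p lab_cr[of 1 a] l 1 unfolding ends_D by fastforce+
    then show thesis by (rule that)
  next
    case 2
    have "lab (cr m (a + 1), 0) = l"
      using lab_cr(1)[of m "a + 1"] m l 2 by simp
    moreover have "(cr m (a + 1), 0) \<in> ends D"
      unfolding ends_D using m by fastforce
    ultimately show thesis using that by blast
  next
    case 3
    have "(cr i a, 1) \<in> ends D" unfolding ends_D using 3 by fastforce
    with lab_cr(2)[OF 3, of a] l show thesis using that by blast
  qed
qed

abbreviation "adj \<equiv> adjacent_corners D"

lemma left_arc: "0 < i \<Longrightarrow> i < p \<Longrightarrow> {(cr i a, 2), above_left i a} \<in> arcs D"
  and right_arc: "0 < i \<Longrightarrow> i < p \<Longrightarrow> {(cr i a, 1), above_right i a} \<in> arcs D"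
  unfolding arcs_D by blast+

lemma adjI: "{(c, k), (c', k')} \<in> arcs D \<Longrightarrow> ((c, k), (c', (k' + 3) mod 4)) \<in> adj"
  and adjI': "{(c, k), (c', k')} \<in> arcs D \<Longrightarrow> ((c', k'), (c, (k + 3) mod 4)) \<in> adj"
  unfolding adjacent_corners_def by (auto simp: insert_commute)

lemma adj_left:
  assumes "1 < i" "i < p"
  shows "((cr i a, 2), (cr (i - 1) (a + 1), 3)) \<in> adj" "((cr (i - 1) (a + 1), 0), (cr i a, 1)) \<in> adj"
  using left_arc[of i a] adjI[of "cr i a" 2 "cr (i - 1) (a + 1)" 0] adjI'[of "cr i a" 2 "cr (i - 1) (a + 1)" 0] assms
  by (auto simp: above_left_def)

lemma adj_left_1:
  shows "((cr 1 a, 2), (cr 1 (a + 1), 2)) \<in> adj" "((cr 1 (a + 1), 3), (cr 1 a, 1)) \<in> adj"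
  using left_arc[of 1 a] adjI[of "cr 1 a" 2 "cr 1 (a + 1)" 3] adjI'[of "cr 1 a" 2 "cr 1 (a + 1)" 3] p
  by (auto simp: above_left_def)

lemma adj_right:
  assumes "0 < i" "i + 1 < p"
  shows "((cr i a, 1), (cr (i + 1) a, 2)) \<in> adj" "((cr (i + 1) a, 3), (cr i a, 0)) \<in> adj"
  using right_arc[of i a] adjI[of "cr i a" 1 "cr (i + 1) a" 3] adjI'[of "cr i a" 1 "cr (i + 1) a" 3] assms
  by (auto simp: above_right_def)

lemma adj_right_p:
  assumes "i + 1 = p" "0 < i"
  shows "((cr i a, 1), (cr i (a + 1), 3)) \<in> adj" "((cr i (a + 1), 0), (cr i a, 0)) \<in> adj"
  using right_arc[of i a] adjI[of "cr i a" 1 "cr i (a + 1)" 0] adjI'[of "cr i a" 1 "cr i (a + 1)" 0] assms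
  by (auto simp: above_right_def)

lemma end_eq_cr: "0 < i \<Longrightarrow> i < p \<Longrightarrow> k < 4 \<Longrightarrow> (cr i a, k) \<in> ends D"
  by (auto simp: ends_D)

text \<open>On each side of the arc, the corners at its two ends carry the same label; this makes
  \<open>lab\<close> constant on regions.\<close>

lemma lab_above_left:
  assumes "0 < i" "i < p" "above_left i a = (c, k)"
  shows "lab (cr i a, 2) = lab (c, (k + 3) mod 4)" "lab (c, k) = lab (cr i a, 1)" "(c, k) \<in> ends D"
proof -
  have "i = 1 \<or> 1 < i" using assms(1) by auto
  then show "lab (cr i a, 2) = lab (c, (k + 3) mod 4)" "lab (c, k) = lab (cr i a, 1)" "(c, k) \<in> ends D"
    using assms lab_cr[of 1 a] lab_cr[of 1 "a + 1"] pt_0[of a] pt_0[of "a + 1"] p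
    by (auto simp: above_left_def lab_cr intro!: end_eq_cr)
qed

lemma lab_above_right:
  assumes "0 < i" "i < p" "above_right i a = (c, k)"
  shows "lab (cr i a, 1) = lab (c, (k + 3) mod 4)" "lab (c, k) = lab (cr i a, 0)" "(c, k) \<in> ends D"
proof -
  have "lab (cr i a, 1) = lab (c, (k + 3) mod 4) \<and> lab (c, k) = lab (cr i a, 0) \<and> (c, k) \<in> ends D"
  proof (cases "i + 1 = p")
    case True
    have ck: "c = cr i (a + 1)" "k = 0" using assms(3) True by (auto simp: above_right_def)
    have "pt (i + 1) a = pt (i + 1) (a - 1)" using True pt_p by metis
    then show ?thesis
      unfolding ck using lab_cr[OF assms(1,2), of a] lab_cr[OF assms(1,2), of "a + 1"] end_eq_cr[OF assms(1,2)]
      by simp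
  next
    case False
    then have ck: "c = cr (i + 1) a" "k = 3" and i: "0 < i + 1" "i + 1 < p"
      using assms by (auto simp: above_right_def)
    show ?thesis
      unfolding ck using lab_cr[OF assms(1,2), of a] lab_cr[OF i, of a] end_eq_cr[OF i] by simp
  qed
  then show "lab (cr i a, 1) = lab (c, (k + 3) mod 4)" "lab (c, k) = lab (cr i a, 0)" "(c, k) \<in> ends D"
    by blast+
qed

lemma ends_corner: "(c, k) \<in> ends D \<Longrightarrow> (c, (l + 3) mod 4) \<in> ends D"
  by (simp add: ends_def)

lemma adjacent_lab:
  assumes "(x, y) \<in> adj"
  shows "lab x = lab y \<and> x \<in> ends D \<and> y \<in> ends D"
proof -
  from assms obtain c k c' k' where xy: "x = (c, k)" "y = (c', (k' + 3) mod 4)" "{(c, k), (c', k')} \<in> arcs D"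
    unfolding adjacent_corners_def by blast
  have "(\<exists>i a. {(c, k), (c', k')} = {(cr i a, 2), above_left i a} \<and> 0 < i \<and> i < p) \<or>
      (\<exists>i a. {(c, k), (c', k')} = {(cr i a, 1), above_right i a} \<and> 0 < i \<and> i < p)"
    using xy(3) unfolding arcs_D Un_iff mem_Collect_eq .
  then show ?thesis
  proof (elim disjE exE conjE)
    fix i a assume i: "0 < i" "i < p" and eq: "{(c, k), (c', k')} = {(cr i a, 2), above_left i a}"
    have e: "(cr i a, 2) \<in> ends D" "(cr i a, 1) \<in> ends D" using i by (auto intro: end_eq_cr)
    from eq have "c = cr i a \<and> k = 2 \<and> above_left i a = (c', k') \<or> c' = cr i a \<and> k' = 2 \<and> above_left i a = (c, k)"
      by (auto simp: doubleton_eq_iff)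
    then show ?thesis
    proof (elim disjE conjE)
      assume "c = cr i a" "k = 2" "above_left i a = (c', k')"
      then show ?thesis using lab_above_left[OF i, of a c' k'] e ends_corner by (simp add: xy)
    next
      assume "c' = cr i a" "k' = 2" "above_left i a = (c, k)"
      then show ?thesis using lab_above_left[OF i, of a c k] e ends_corner by (simp add: xy)
    qed
  next
    fix i a assume i: "0 < i" "i < p" and eq: "{(c, k), (c', k')} = {(cr i a, 1), above_right i a}"
    have e: "(cr i a, 0) \<in> ends D" "(cr i a, 1) \<in> ends D" using i by (auto intro: end_eq_cr)
    from eq have "c = cr i a \<and> k = 1 \<and> above_right i a = (c', k') \<or> c' = cr i a \<and> k' = 1 \<and> above_right i a = (c, k)"
      by (auto simp: doubleton_eq_iff)
    then show ?thesis
    proof (elim disjE conjE)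
      assume "c = cr i a" "k = 1" "above_right i a = (c', k')"
      then show ?thesis using lab_above_right[OF i, of a c' k'] e ends_corner by (simp add: xy)
    next
      assume "c' = cr i a" "k' = 1" "above_right i a = (c, k)"
      then show ?thesis using lab_above_right[OF i, of a c k] e ends_corner by (simp add: xy)
    qed
  qed
qed

definition same :: "((nat \<times> nat) \<times> (nat \<times> nat)) set" where
  "same = (adj \<union> adj\<inverse>)\<^sup>*"

lemma same_sym: "(x, y) \<in> same \<Longrightarrow> (y, x) \<in> same"
  unfolding same_def by (meson sym_Un_converse sym_rtrancl symD)

lemma same_lab:
  assumes "(x, y) \<in> same" "x \<in> ends D"
  shows "lab y = lab x \<and> y \<in> ends D"
  using assms unfolding same_def by (induction rule: rtrancl_induct) (auto dest: adjacent_lab)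

lemma adj_same: "(x, y) \<in> adj \<Longrightarrow> (x, y) \<in> same" and adj_same': "(x, y) \<in> adj \<Longrightarrow> (y, x) \<in> same"
  unfolding same_def by auto

lemma same_trans: "(x, y) \<in> same \<Longrightarrow> (y, z) \<in> same \<Longrightarrow> (x, z) \<in> same"
  unfolding same_def by (rule rtrancl_trans)

lemma same_refl: "(x, x) \<in> same"
  by (simp add: same_def)

lemma same_left_1: "((cr 1 a, 2), (cr 1 b, 2)) \<in> same"
proof -
  have "((cr 1 a, 2), (cr 1 (a + int n), 2)) \<in> same" for a n
  proof (induction n)
    case (Suc n)
    have "a + int (Suc n) = a + int n + 1" by simp
    then show ?case using same_trans[OF Suc adj_same[OF adj_left_1(1)[of "a + int n"]]] by argo
  qed (simp add: same_refl)
  from this[of a "nat (b - a)"] same_sym[OF this[of b "nat (a - b)"]] show ?thesis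
    by (cases "a \<le> b") simp_all
qed

lemma same_right_p:
  assumes "i + 1 = p" "0 < i"
  shows "((cr i a, 0), (cr i b, 0)) \<in> same"
proof -
  have "((cr i a, 0), (cr i (a + int n), 0)) \<in> same" for a n
  proof (induction n)
    case (Suc n)
    have "a + int (Suc n) = a + int n + 1" by simp
    then show ?case
      using same_trans[OF Suc adj_same'[OF adj_right_p(2)[OF assms, of "a + int n"]]] by argo
  qed (simp add: same_refl)
  from this[of a "nat (b - a)"] same_sym[OF this[of b "nat (a - b)"]] show ?thesis
    by (cases "a \<le> b") simp_all
qed

text \<open>The top corner of the crossing just below the region. The outer columns have no such
  crossing and are represented by a left corner of column 1 and a right corner of column
  \<open>m\<close>.\<close>

definition rep :: "nat \<times> int \<Rightarrow> nat \<times> nat" where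
  "rep l = (if fst l = 0 then (cr 1 0, 2) else if fst l = p then (cr m 0, 0) else (cr (fst l) (snd l), 1))"

lemma rep_pt:
  "rep (pt 0 a) = (cr 1 0, 2)" "rep (pt p a) = (cr m 0, 0)" "0 < i \<Longrightarrow> i < p \<Longrightarrow> rep (pt i a) = (cr i a, 1)"
  using p by (auto simp: rep_def pt_def cr_mod)

text \<open>Equal labels must imply equal regions, so each corner is walked to the chosen one: an
  inner region has at most four corners, an outer one a whole cycle of them.\<close>

lemma same_rep:
  assumes "x \<in> ends D"
  shows "(x, rep (lab x)) \<in> same"
proof -
  from assms obtain i a k where x: "x = (cr i a, k)" "0 < i" "i < p" "k < 4" unfolding ends_D by blast
  have "k = 0 \<or> k = 1 \<or> k = 2 \<or> k = 3" "i = 1 \<or> 1 < i" "i + 1 = p \<or> i + 1 < p"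
    using x(2-4) by linarith+
  then consider "k = 0" "i + 1 < p" | "k = 0" "i + 1 = p" | "k = 1" | "k = 2" "i = 1" | "k = 2" "1 < i"
    | "k = 3" "i = 1" | "k = 3" "i + 1 = p" | "k = 3" "1 < i" "i + 1 < p"
    by blast
  then show ?thesis
  proof cases
    case 1
    then have "rep (lab x) = (cr (i + 1) (a - 1), 1)" by (simp add: x lab_cr rep_pt)
    then show ?thesis using adj_same[OF adj_left(2)[of "i + 1" "a - 1"]] 1 x by simp
  next
    case 2
    then have "i = m" using m by simp
    have "lab x = pt p 0" using 2 lab_cr(1)[OF x(2,3), of a] pt_p[of "a - 1"] by (simp add: x)
    then have "rep (lab x) = (cr i 0, 0)" using \<open>i = m\<close> by (simp only: rep_pt)
    then show ?thesis using same_right_p[OF 2(2) x(2), of a 0] 2(1) by (simp only: x(1))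
  next
    case 3
    then show ?thesis using x by (simp add: lab_cr rep_pt same_refl)
  next
    case 4
    then have "lab x = pt 0 a" using lab_cr(3)[OF x(2,3), of a] by (simp add: x)
    then have "rep (lab x) = (cr 1 0, 2)" by (simp only: rep_pt)
    then show ?thesis using same_left_1[of a 0] 4 by (simp only: x(1))
  next
    case 5
    then have "rep (lab x) = (cr (i - 1) a, 1)"
      using x(3) lab_cr(3)[OF x(2,3), of a] rep_pt(3)[of "i - 1" a] by (simp add: x(1))
    then show ?thesis using adj_same'[OF adj_right(1)[of "i - 1" a]] 5 x by simp
  next
    case 6
    then have "rep (lab x) = (cr 1 (a - 1), 1)" using p by (simp add: x lab_cr rep_pt)
    moreover have "((cr 1 a, 3), (cr 1 (a - 1), 1)) \<in> same"
      using adj_same[OF adj_left_1(2)[of "a - 1"]] by simp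
    ultimately show ?thesis using 6 by (simp add: x(1))
  next
    case 7
    then have "rep (lab x) = (cr i (a - 1), 1)" using x by (simp add: lab_cr rep_pt)
    moreover have "((cr i a, 3), (cr i (a - 1), 1)) \<in> same"
      using adj_same'[OF adj_right_p(1)[OF 7(2) x(2), of "a - 1"]] by simp
    ultimately show ?thesis using 7(1) by (simp add: x(1))
  next
    case 8
    have "((cr i a, 3), (cr (i + 1) (a - 1), 2)) \<in> same"
      using adj_same'[OF adj_left(1)[of "i + 1" "a - 1"]] 8 by simp
    moreover have "((cr (i + 1) (a - 1), 2), (cr i (a - 1), 1)) \<in> same"
      using adj_same'[OF adj_right(1)[of i "a - 1"]] 8 by simp
    ultimately have "((cr i a, 3), (cr i (a - 1), 1)) \<in> same" by (rule same_trans)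
    moreover have "rep (lab x) = (cr i (a - 1), 1)" using 8 x by (simp add: lab_cr rep_pt)
    ultimately show ?thesis using 8 by (simp add: x)
  qed
qed

lemma region_of_D: "x \<in> ends D \<Longrightarrow> region_of D x = reg (lab x)"
  unfolding region_of_def reg_def same_def[symmetric]
proof (intro equalityI subsetI CollectI; elim CollectE)
  fix y assume x: "x \<in> ends D"
  show "y \<in> ends D \<and> lab y = lab x" if "(x, y) \<in> same" using same_lab[OF that x] by simp
  show "(x, y) \<in> same" if "y \<in> ends D \<and> lab y = lab x"
  proof -
    have "(rep (lab x), y) \<in> same" using that same_sym[OF same_rep[of y]] by simp
    then show ?thesis by (rule same_trans[OF same_rep[OF x]])
  qed
qed

lemma regions_D: "regions D = reg ` pts"
proof -
  have "regions D = (\<lambda>x. reg (lab x)) ` ends D"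
    unfolding regions_def by (rule image_cong) (auto simp: region_of_D)
  moreover have "lab ` ends D = pts"
    using lab_in_pts pts_obtain_end by blast
  ultimately show ?thesis by (metis image_image)
qed

lemma inj_on_reg: "inj_on reg pts"
proof (rule inj_onI)
  fix l l' assume "l \<in> pts" "l' \<in> pts" "reg l = reg l'"
  then show "l = l'" by (metis (mono_tags, lifting) mem_Collect_eq pts_obtain_end reg_def)
qed

lemma pts_eq: "pts = {pt 0 0, pt p 0} \<union> ({0<..<p} \<times> {0..<int q})"
proof (intro equalityI subsetI)
  fix l assume "l \<in> pts"
  then obtain i a where l: "l = pt i a" "i \<le> p" unfolding pts_def by blast
  have "l = pt 0 0 \<or> l = pt p 0 \<or> l \<in> {0<..<p} \<times> {0..<int q}"
    using l q pt_0[of a] pt_p[of a] by (cases "i = 0 \<or> i = p") (auto simp: pt_def)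
  then show "l \<in> {pt 0 0, pt p 0} \<union> ({0<..<p} \<times> {0..<int q})" by blast
next
  fix l assume "l \<in> {pt 0 0, pt p 0} \<union> ({0<..<p} \<times> {0..<int q})"
  moreover have "(i, a) = pt i a" if "i \<in> {0<..<p}" "a \<in> {0..<int q}" for i a
    using that by (simp add: pt_def)
  ultimately show "l \<in> pts" unfolding pts_def by fastforce
qed

section \<open>Validity of the diagram: Euler's formula, arcs, connectedness\<close>

lemma finite_pts: "finite pts"
  unfolding pts_eq by simp

lemma card_pts: "card pts = q * m + 2"
proof -
  have "card ({pt 0 0, pt p 0} \<union> ({0<..<p} \<times> {0..<int q})) = card {pt 0 0, pt p 0} + card ({0<..<p} \<times> {0..<int q})"
    by (rule card_Un_disjoint) (auto simp: pt_def)
  moreover have "pt 0 0 \<noteq> pt p 0" using p by (simp add: pt_def)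
  ultimately show ?thesis unfolding pts_eq by (simp add: m_def card_cartesian_product)
qed

lemma card_regions: "card (regions D) = q * m + 2"
  by (simp add: regions_D card_image inj_on_reg card_pts)

lemma card_crossings: "card (crossings D) = q * m"
  by (simp add: torus_link_eq braid_closure_def length_w)

text \<open>The arcs as a function on the top ends, in the form that \<open>arcs_of_bij\<close> asks
  for.\<close>

definition above :: "nat \<times> nat \<Rightarrow> nat \<times> nat" where
  "above x = (if snd x = 2 then above_left else above_right) (fst x mod m + 1) (int (fst x div m))"

lemma above_cr:
  assumes "0 < i" "i < p"
  shows "above (cr i a, 2) = above_left i a" "above (cr i a, 1) = above_right i a"
    "above (cr i a, Suc 0) = above_right i a"
proof -
  have c: "cr j (a mod int q) = cr j a" "cr j (a mod int q + 1) = cr j (a + 1)" for j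
    by (simp_all add: cr_def mod_add_left_eq)
  show "above (cr i a, 2) = above_left i a" "above (cr i a, 1) = above_right i a"
    "above (cr i a, Suc 0) = above_right i a"
    using assms q by (simp_all add: above_def cr_mod_eq[OF assms, simplified] cr_div_eq[OF assms]
      above_left_def above_right_def c)
qed

lemma arcs_above: "arcs D = {{x, above x} | x. x \<in> crossings D \<times> {1, 2}}" (is "_ = ?R")
proof (intro equalityI subsetI)
  have in_R: "{(c, k), above (c, k)} \<in> ?R" if "c \<in> crossings D" "k \<in> {1, 2}" for c k
    using that by blast
  have cr: "cr i a \<in> crossings D" if "0 < i" "i < p" for i a
    unfolding crossings_D using that by blast
  fix x assume "x \<in> arcs D"
  then consider i a where "x = {(cr i a, 2), above_left i a}" "0 < i" "i < p"
    | i a where "x = {(cr i a, 1), above_right i a}" "0 < i" "i < p"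
    unfolding arcs_D by (elim UnE CollectE exE conjE) metis+
  then show "x \<in> ?R"
  proof cases
    case (1 i a)
    then show ?thesis using in_R[OF cr[of i a], of 2] by (simp add: above_cr)
  next
    case (2 i a)
    then show ?thesis using in_R[OF cr[of i a], of 1] by (simp add: above_cr)
  qed
next
  fix x assume "x \<in> ?R"
  then obtain c k where x: "x = {(c, k), above (c, k)}" "c \<in> crossings D" "k = 1 \<or> k = 2" by auto
  then obtain i a where i: "c = cr i a" "0 < i" "i < p" unfolding crossings_D by blast
  show "x \<in> arcs D"
    using x(3) left_arc[OF i(2,3), of a] right_arc[OF i(2,3), of a]
    by (elim disjE) (simp_all add: x(1) i above_cr)
qed

lemma mod_q_add_cancel: "(a + 1) mod int q = (b + 1) mod int q \<Longrightarrow> a mod int q = b mod int q"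
  by (metis add_diff_cancel_right' mod_diff_left_eq)

lemma bij_above: "bij_betw above (crossings D \<times> {1, 2::nat}) (crossings D \<times> {0, 3::nat})"
proof -
  have inj: "inj_on above (crossings D \<times> {1, 2::nat})"
  proof (rule inj_onI)
    fix x y assume "x \<in> crossings D \<times> {1, 2::nat}" "y \<in> crossings D \<times> {1, 2::nat}" and eq: "above x = above y"
    then obtain i a k j b l where x: "x = (cr i a, k)" "0 < i" "i < p" "k = 1 \<or> k = 2"
      and y: "y = (cr j b, l)" "0 < j" "j < p" "l = 1 \<or> l = 2"
      unfolding crossings_D by auto
    have "i = j \<and> a mod int q = b mod int q \<and> k = l"
      using eq x y
      by (auto simp: above_cr above_left_def above_right_def cr_eq_iff split: if_splits dest: mod_q_add_cancel)
    then show "x = y" using x y by (simp add: cr_eq_iff)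
  qed
  have sub: "above ` (crossings D \<times> {1, 2::nat}) \<subseteq> crossings D \<times> {0, 3::nat}"
  proof (rule image_subsetI)
    fix x assume "x \<in> crossings D \<times> {1, 2::nat}"
    then obtain i a k where x: "x = (cr i a, k)" "0 < i" "i < p" "k = 1 \<or> k = 2"
      unfolding crossings_D by auto
    have c: "cr j b \<in> crossings D" if "0 < j" "j < p" for j b unfolding crossings_D using that by blast
    show "above x \<in> crossings D \<times> {0, 3::nat}"
      using x c[OF x(2,3), of "a + 1"] by (auto simp: above_cr above_left_def above_right_def intro!: c)
  qed
  have fin: "finite (crossings D)" by (simp add: torus_link_eq braid_closure_def)
  \<comment> \<open>Surjectivity by counting: both sets have twice as many elements as there are
    crossings.\<close>
  have "above ` (crossings D \<times> {1, 2::nat}) = crossings D \<times> {0, 3::nat}"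
  proof (rule card_subset_eq[OF _ sub])
    show "card (above ` (crossings D \<times> {1, 2})) = card (crossings D \<times> {0, 3::nat})"
      unfolding card_image[OF inj] by (simp add: card_cartesian_product)
  qed (use fin in simp)
  with inj show ?thesis by (simp add: bij_betw_def)
qed

abbreviation "joined \<equiv> {(b, b'). \<exists>k k'. {(b, k), (b', k')} \<in> arcs D}"

lemma joined_sym: "(x, y) \<in> joined\<^sup>* \<Longrightarrow> (y, x) \<in> joined\<^sup>*"
proof -
  have "sym joined" by (auto simp: sym_def) (metis insert_commute)
  then show "(x, y) \<in> joined\<^sup>* \<Longrightarrow> (y, x) \<in> joined\<^sup>*" by (meson sym_rtrancl symD)
qed

lemma joined_row:
  assumes "0 < i" "i < p"
  shows "(cr 1 a, cr i a) \<in> joined\<^sup>*"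
  using assms
proof (induction i rule: nat_induct_non_zero)
  case (Suc i)
  then have "(cr i a, cr (i + 1) a) \<in> joined"
    using right_arc[of i a] by (auto simp: above_right_def)
  then show ?case using Suc by (auto intro: rtrancl_into_rtrancl)
qed simp

lemma joined_column: "(cr 1 0, cr 1 (int n)) \<in> joined\<^sup>*"
proof (induction n)
  case (Suc n)
  have "(cr 1 (int n), cr 1 (int n + 1)) \<in> joined"
    using left_arc[of 1 "int n"] p by (auto simp: above_left_def)
  then show ?case using Suc by (auto intro: rtrancl_into_rtrancl simp: add.commute)
qed simp

lemma joined_all:
  assumes "c \<in> crossings D" "c' \<in> crossings D"
  shows "(c, c') \<in> joined\<^sup>*"
proof -
  have "(cr 1 0, c) \<in> joined\<^sup>*" if c: "c \<in> crossings D" for c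
  proof -
    from c obtain i a where i: "0 < i" "i < p" "c = cr i a" unfolding crossings_D by blast
    have "c = cr i (int (nat (a mod int q)))" using q i by (simp add: cr_mod)
    then show ?thesis
      using rtrancl_trans[OF joined_column joined_row[OF i(1,2), of "int (nat (a mod int q))"]] by simp
  qed
  from rtrancl_trans[OF joined_sym[OF this[OF assms(1)]] this[OF assms(2)]] show ?thesis .
qed

text \<open>Each crossing has two top ends, so there are 2qm arcs, and qm - 2qm + (qm + 2) =
  2.\<close>

lemma link_diagram_D: "link_diagram D"
proof -
  have *: "crossings D \<times> {1, 2::nat} \<union> crossings D \<times> {0, 3::nat} = ends D"
    unfolding ends_def by auto
  have disj: "crossings D \<times> {1, 2::nat} \<inter> crossings D \<times> {0, 3::nat} = {}" by auto
  note arcs = arcs_of_bij[OF bij_above disj, folded arcs_above, unfolded *]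
  have "finite (crossings D)" by (simp add: torus_link_eq braid_closure_def)
  moreover have "crossings D \<noteq> {}" using card_crossings m q by auto
  moreover have "card (arcs D) = 2 * (q * m)"
    using arcs(3) by (simp add: card_cartesian_product card_crossings)
  ultimately show ?thesis unfolding link_diagram_def
    using arcs(1,2) joined_all card_regions card_crossings by auto
qed

text \<open>The two colourings colour the columns of even and odd index, respectively.\<close>

definition black :: "bool \<Rightarrow> (nat \<times> int) set" where
  "black b = {l \<in> pts. even (fst l) = b}"

section \<open>The checkerboard colourings\<close>

lemma fst_pt: "fst (pt i a) = i"
  by (simp add: pt_def)

lemma pt_in_pts: "i \<le> p \<Longrightarrow> pt i a \<in> pts"
  unfolding pts_def by blast

lemma reg_pt_in_black:
  "i \<le> p \<Longrightarrow> reg (pt i a) \<in> reg ` black b \<longleftrightarrow> even i = b"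
  using inj_on_image_mem_iff[OF inj_on_reg pt_in_pts, of i "black b" a] pt_in_pts[of i a]
  by (auto simp: black_def fst_pt)

lemma region_of_cr:
  assumes "0 < i" "i < p"
  shows "region_of D (cr i a, 0) = reg (pt (i + 1) (a - 1))" "region_of D (cr i a, 1) = reg (pt i a)"
    "region_of D (cr i a, 2) = reg (pt (i - 1) a)" "region_of D (cr i a, 3) = reg (pt i (a - 1))"
  using assms region_of_D[OF end_eq_cr[OF assms]] lab_cr[OF assms] by auto

text \<open>The colour of column 0 spreads to the right, since the left and top corners of a
  crossing differ in colour; the last column is reached through a right corner.\<close>

lemma checkerboard_iff: "checkerboard D B \<longleftrightarrow> (\<exists>b. B = reg ` black b)"
proof
  assume B: "checkerboard D B"
  then have sub: "B \<subseteq> reg ` pts"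
    and alt: "\<And>c k. (c, k) \<in> ends D \<Longrightarrow> region_of D (c, k) \<in> B \<longleftrightarrow> region_of D (c, (k + 1) mod 4) \<notin> B"
    unfolding checkerboard_def regions_D by auto
  define b where "b \<longleftrightarrow> reg (pt 0 0) \<in> B"
  have row: "reg (pt i a) \<in> B \<longleftrightarrow> even i = b" if "i < p" for i a
    using that
  proof (induction i)
    case 0
    then show ?case by (simp add: b_def pt_0[of a])
  next
    case (Suc i)
    have "region_of D (cr (Suc i) a, 1) \<in> B \<longleftrightarrow> region_of D (cr (Suc i) a, 2) \<notin> B"
      using alt[OF end_eq_cr[of "Suc i" 1 a]] Suc.prems by (simp add: numeral_2_eq_2)
    then show ?case using Suc region_of_cr[of "Suc i" a] by auto
  qed
  have *: "reg (pt i a) \<in> B \<longleftrightarrow> even i = b" if "i \<le> p" for i a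
  proof (cases "i < p")
    case False
    then have "i = p" using that by simp
    moreover have "even p \<longleftrightarrow> odd m" using m(2) by (metis even_Suc)
    ultimately show ?thesis using alt[OF end_eq_cr[of m 0 "a + 1"]] region_of_cr[of m "a + 1"] row[of m "a + 1"] m
      by auto
  qed (rule row)
  have eq: "R \<in> B \<longleftrightarrow> R \<in> reg ` black b" if "R \<in> reg ` pts" for R
  proof -
    from that obtain i a where "i \<le> p" "R = reg (pt i a)" unfolding pts_def by blast
    with * show ?thesis by (simp add: reg_pt_in_black)
  qed
  have sub': "reg ` black b \<subseteq> reg ` pts" by (auto simp: black_def)
  have "B = reg ` black b"
  proof (rule Set.set_eqI)
    fix R show "R \<in> B \<longleftrightarrow> R \<in> reg ` black b"
      using eq[of R] subsetD[OF sub, of R] subsetD[OF sub', of R] by argo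
  qed
  then show "\<exists>b. B = reg ` black b" ..
next
  assume "\<exists>b. B = reg ` black b"
  then obtain b where B: "B = reg ` black b" ..
  have "region_of D (c, k) \<in> B \<longleftrightarrow> region_of D (c, (k + 1) mod 4) \<notin> B" if "(c, k) \<in> ends D" for c k
  proof -
    from that obtain i a where i: "c = cr i a" "0 < i" "i < p" "k < 4" unfolding ends_D by auto
    have col: "region_of D (cr i a, 0) \<in> B \<longleftrightarrow> even (i + 1) = b" "region_of D (cr i a, 1) \<in> B \<longleftrightarrow> even i = b"
      "region_of D (cr i a, 2) \<in> B \<longleftrightarrow> even (i - 1) = b" "region_of D (cr i a, 3) \<in> B \<longleftrightarrow> even i = b"
      unfolding B region_of_cr[OF i(2,3)] using i(2,3) by (simp_all add: reg_pt_in_black)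
    have i1: "even (i - 1) \<longleftrightarrow> odd i" using i(2) by simp
    have "k = 0 \<or> k = 1 \<or> k = 2 \<or> k = 3" using i(4) by linarith
    then show ?thesis
    proof (elim disjE)
      assume "k = 0"
      then show ?thesis unfolding i(1) using col by auto
    next
      assume "k = 1"
      moreover have "(1 + 1) mod 4 = (2::nat)" by simp
      ultimately show ?thesis unfolding i(1) using col i1 by metis
    next
      assume "k = 2"
      moreover have "(2 + 1) mod 4 = (3::nat)" by simp
      ultimately show ?thesis unfolding i(1) using col i1 by metis
    next
      assume "k = 3"
      then show ?thesis unfolding i(1) using col by auto
    qed
  qed
  moreover have "B \<subseteq> regions D" unfolding B regions_D black_def by auto
  ultimately show "checkerboard D B" unfolding checkerboard_def by auto
qed

section \<open>The Goeritz invariant of a torus link\<close>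

lemma black_pt: "black b = {pt i a | i a. i \<le> p \<and> even i = b}"
  unfolding black_def pts_def by (auto simp: fst_pt)

lemma pt_in_black: "pt i a \<in> black b \<longleftrightarrow> i \<le> p \<and> even i = b"
  unfolding black_pt by (auto simp: pt_def)

lemma finite_black: "finite (black b)"
  unfolding black_def using finite_pts by simp

text \<open>The two black corners at a crossing.\<close>

definition tip1 :: "bool \<Rightarrow> nat \<Rightarrow> nat \<times> int" where
  "tip1 b c = lab (c, if even (c mod m + 1) = b then 1 else 0)"

definition tip2 :: "bool \<Rightarrow> nat \<Rightarrow> nat \<times> int" where
  "tip2 b c = lab (c, if even (c mod m + 1) = b then 3 else 2)"

section \<open>The Goeritz matrix as a Laplacian over the crossings\<close>

lemma tips_cr:
  assumes "0 < i" "i < p"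
  shows "tip1 b (cr i a) = (if even i = b then pt i a else pt (i + 1) (a - 1))"
    "tip2 b (cr i a) = (if even i = b then pt i (a - 1) else pt (i - 1) a)"
proof -
  have "cr i a mod m + 1 = i" using cr_mod_eq[OF assms] assms by simp
  then show "tip1 b (cr i a) = (if even i = b then pt i a else pt (i + 1) (a - 1))"
    "tip2 b (cr i a) = (if even i = b then pt i (a - 1) else pt (i - 1) a)"
    unfolding tip1_def tip2_def using lab_cr[OF assms] by simp_all
qed

lemma goeritz_sign_cr:
  assumes "0 < i" "i < p"
  shows "goeritz_sign D (reg ` black b) (cr i a) = (if even i = b then 1 else - 1)"
  unfolding goeritz_sign_def region_of_cr(2)[OF assms] using assms by (simp add: reg_pt_in_black)

text \<open>The other two corners lie in columns of the opposite parity and so cannot carry a black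
  label.\<close>

lemma corner_in_reg:
  assumes c: "c \<in> crossings D" and l: "l \<in> black b"
  shows "(\<exists>k. (c, k) \<in> reg l) \<longleftrightarrow> l = tip1 b c \<or> l = tip2 b c"
proof -
  obtain i a where i: "c = cr i a" "0 < i" "i < p" using c unfolding crossings_D by blast
  have "(\<exists>k. (c, k) \<in> reg l) \<longleftrightarrow> (\<exists>k<4. lab (c, k) = l)"
    using c by (auto simp: reg_def ends_def)
  also have "\<dots> \<longleftrightarrow> lab (c, 0) = l \<or> lab (c, 1) = l \<or> lab (c, 2) = l \<or> lab (c, 3) = l"
    by (auto simp: numeral_eq_Suc less_Suc_eq)
  also have "\<dots> \<longleftrightarrow> pt (i + 1) (a - 1) = l \<or> pt i a = l \<or> pt (i - 1) a = l \<or> pt i (a - 1) = l"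
    unfolding i(1) lab_cr[OF i(2,3)] by simp
  also have "\<dots> \<longleftrightarrow> l = tip1 b c \<or> l = tip2 b c"
  proof -
    have *: "even j = b" if "pt j d = l" for j d using l that pt_in_black by blast
    have "even (i - 1) \<longleftrightarrow> odd i" using i(2) by simp
    then show ?thesis
      unfolding i(1) tips_cr[OF i(2,3)] using *[of "i + 1" "a - 1"] *[of i a] *[of "i - 1" a] *[of i "a - 1"]
      by auto
  qed
  finally show ?thesis .
qed

lemma tips_black: "c \<in> crossings D \<Longrightarrow> tip1 b c \<in> black b \<and> tip2 b c \<in> black b"
proof -
  assume "c \<in> crossings D"
  then obtain i a where i: "c = cr i a" "0 < i" "i < p" unfolding crossings_D by blast
  then have "even (i - 1) \<longleftrightarrow> odd i" by simp
  then show ?thesis unfolding i(1) tips_cr[OF i(2,3)] using i by (auto simp: pt_in_black)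
qed

text \<open>Two regions can share several crossings: for \<open>p = 2\<close> the outer regions meet
  at all of them, and for \<open>q = 2\<close> the neighbours above and below coincide. Rearranging
  into a sum over crossings, each contributing to the equations at its two tips, avoids these
  cases.\<close>

lemma laplacian_crossings:
  assumes vs: "distinct vs" "set vs = black b" and i: "i < length vs"
  shows "mat_act (goeritz_matrix D (map reg vs)) (\<lambda>j. \<xi> (vs ! j)) i =
    (\<Sum>c\<in>crossings D. zmul (goeritz_sign D (reg ` black b) c)
      ((if tip1 b c = vs ! i then \<xi> (tip2 b c) - \<xi> (vs ! i) else 0) +
       (if tip2 b c = vs ! i then \<xi> (tip1 b c) - \<xi> (vs ! i) else 0)))"
proof -
  define u where "u = vs ! i"
  define sg where "sg = goeritz_sign D (reg ` black b)"
  define hits where "hits c l \<longleftrightarrow> l = tip1 b c \<or> l = tip2 b c" for c l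
  have u: "u \<in> black b" using nth_mem[OF i] by (simp only: u_def vs(2))
  have fin: "finite (crossings D)" by (simp add: torus_link_eq braid_closure_def)
  have hits: "(\<exists>k. (c, k) \<in> reg l) \<longleftrightarrow> hits c l" if "c \<in> crossings D" "l \<in> black b" for c l
    unfolding hits_def by (rule corner_in_reg[OF that])
  have entry: "goeritz_entry D (reg ` black b) (reg u) (reg v) =
      (\<Sum>c\<in>crossings D. if hits c u \<and> hits c v then sg c else 0)" if "v \<in> black b" for v
  proof -
    have "{c. c \<in> crossings D \<and> meet_at (reg u) (reg v) c} = {c \<in> crossings D. hits c u \<and> hits c v}"
      using hits u that by (simp add: meet_at_def cong: conj_cong)
    then show ?thesis unfolding goeritz_entry_def sg_def by (simp only: sum.inter_filter[OF fin])
  qed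
  have inner: "(\<Sum>v\<in>black b - {u}. if hits c u \<and> hits c v then zmul (sg c) (\<xi> v - \<xi> u) else 0) =
      zmul (sg c) ((if tip1 b c = u then \<xi> (tip2 b c) - \<xi> u else 0) + (if tip2 b c = u then \<xi> (tip1 b c) - \<xi> u else 0))"
    if c: "c \<in> crossings D" for c
  proof -
    have delta: "(\<Sum>v\<in>black b - {u}. if v = t then zmul (sg c) (\<xi> v - \<xi> u) else 0) = zmul (sg c) (\<xi> t - \<xi> u)"
      if "t \<in> black b" for t
      using that finite_black[of b] by (cases "t = u") (auto simp: sum.delta)
    show ?thesis
    proof (cases "tip1 b c = u")
      case True
      then have "(\<Sum>v\<in>black b - {u}. if hits c u \<and> hits c v then zmul (sg c) (\<xi> v - \<xi> u) else 0) =
          (\<Sum>v\<in>black b - {u}. if v = tip2 b c then zmul (sg c) (\<xi> v - \<xi> u) else 0)"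
        by (intro sum.cong) (auto simp: hits_def)
      then show ?thesis using delta[of "tip2 b c"] tips_black[OF c] True by auto
    next
      case False
      then have "(\<Sum>v\<in>black b - {u}. if hits c u \<and> hits c v then zmul (sg c) (\<xi> v - \<xi> u) else 0) =
          (\<Sum>v\<in>black b - {u}. if tip2 b c = u \<and> v = tip1 b c then zmul (sg c) (\<xi> v - \<xi> u) else 0)"
        by (intro sum.cong) (auto simp: hits_def)
      then show ?thesis using delta[of "tip1 b c"] tips_black[OF c] False
        by (cases "tip2 b c = u") auto
    qed
  qed
  have inj: "inj_on ((!) vs) ({..<length vs} - {i})"
    using vs(1) by (auto simp: inj_on_def nth_eq_iff_index_eq)
  have img: "(!) vs ` ({..<length vs} - {i}) = black b - {u}"
  proof -
    have "(!) vs ` {..<length vs} = set vs" by (auto simp: set_conv_nth)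
    moreover have "inj_on ((!) vs) {..<length vs}" using vs(1) by (auto simp: inj_on_def nth_eq_iff_index_eq)
    ultimately show ?thesis
      using inj_on_image_set_diff[of "(!) vs" "{..<length vs}" "{..<length vs}" "{i}"] vs(2) i by (simp add: u_def)
  qed
  have "mat_act (goeritz_matrix D (map reg vs)) (\<lambda>j. \<xi> (vs ! j)) i =
      (\<Sum>j\<in>{..<length vs} - {i}. zmul (goeritz_entry D (reg ` black b) (reg u) (reg (vs ! j))) (\<xi> (vs ! j) - \<xi> u))"
    using mat_act_goeritz_matrix[of i "map reg vs" D] i vs(2)
    by (simp add: u_def del: set_map) (simp add: vs(2))
  also have "\<dots> = (\<Sum>v\<in>black b - {u}. zmul (goeritz_entry D (reg ` black b) (reg u) (reg v)) (\<xi> v - \<xi> u))"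
    unfolding img[symmetric] by (subst sum.reindex[OF inj]) simp
  also have "\<dots> = (\<Sum>v\<in>black b - {u}. \<Sum>c\<in>crossings D. if hits c u \<and> hits c v then zmul (sg c) (\<xi> v - \<xi> u) else 0)"
    by (rule sum.cong) (auto simp: entry zmul.scale_sum_left if_distrib[of "\<lambda>x. zmul x _"] intro!: sum.cong)
  also have "\<dots> = (\<Sum>c\<in>crossings D. \<Sum>v\<in>black b - {u}. if hits c u \<and> hits c v then zmul (sg c) (\<xi> v - \<xi> u) else 0)"
    by (rule sum.swap)
  also have "\<dots> = (\<Sum>c\<in>crossings D. zmul (sg c) ((if tip1 b c = u then \<xi> (tip2 b c) - \<xi> u else 0) +
      (if tip2 b c = u then \<xi> (tip1 b c) - \<xi> u else 0)))"
    by (rule sum.cong) (simp_all add: inner)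
  finally show ?thesis unfolding u_def sg_def .
qed

lemma sum_crossings:
  "(\<Sum>c\<in>crossings D. F c) = (\<Sum>i\<in>{0<..<p}. \<Sum>j<q. F (cr i (int j)))"
proof -
  have "bij_betw (\<lambda>(i, j). cr i (int j)) ({0<..<p} \<times> {..<q}) (crossings D)"
  proof (rule bij_betw_imageI)
    show "inj_on (\<lambda>(i, j). cr i (int j)) ({0<..<p} \<times> {..<q})"
      by (auto simp: inj_on_def cr_eq_iff)
    show "(\<lambda>(i, j). cr i (int j)) ` ({0<..<p} \<times> {..<q}) = crossings D"
    proof (intro equalityI subsetI)
      fix c assume "c \<in> crossings D"
      then obtain i a where i: "c = cr i a" "0 < i" "i < p" unfolding crossings_D by blast
      have "0 \<le> a mod int q" "a mod int q < int q" using q by auto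
      then have "(i, nat (a mod int q)) \<in> {0<..<p} \<times> {..<q}" "c = cr i (int (nat (a mod int q)))"
        using i by (auto simp: cr_mod nat_less_iff)
      then show "c \<in> (\<lambda>(i, j). cr i (int j)) ` ({0<..<p} \<times> {..<q})" by force
    qed (auto simp: crossings_D)
  qed
  from sum.reindex_bij_betw[OF this, of F]
  show ?thesis by (simp add: sum.cartesian_product case_prod_unfold)
qed

definition at_pt :: "(nat \<times> int \<Rightarrow> qmodz) \<Rightarrow> nat \<Rightarrow> int \<Rightarrow> qmodz" where
  "at_pt \<xi> i a = \<xi> (pt i a)"

lemma at_pt_periodic: "at_pt \<xi> i (a + int q) = at_pt \<xi> i a" "at_pt \<xi> i (a + int q - 1) = at_pt \<xi> i (a - 1)"
  using at_pt_def pt_mod(1)[of i "a + int q"] pt_mod(1)[of i a] pt_mod(1)[of i "a + int q - 1"] pt_mod(1)[of i "a - 1"]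
  by (simp_all add: pt_def mod_diff_left_eq[of "a + int q" "int q" 1, symmetric] mod_diff_left_eq[of a])

text \<open>The contribution of the crossings in the column \<open>i\<close> to the equation at the region \<open>u\<close>.\<close>

definition strip :: "bool \<Rightarrow> (nat \<times> int \<Rightarrow> qmodz) \<Rightarrow> nat \<times> int \<Rightarrow> nat \<Rightarrow> qmodz" where
  "strip b \<xi> u i =
    (if even i = b then (\<Sum>j<q. if pt i (int j) = u then at_pt \<xi> i (int j - 1) - \<xi> u else 0) +
         (\<Sum>j<q. if pt i (int j - 1) = u then at_pt \<xi> i (int j) - \<xi> u else 0)
     else - (\<Sum>j<q. if pt (i + 1) (int j - 1) = u then at_pt \<xi> (i - 1) (int j) - \<xi> u else 0) -
         (\<Sum>j<q. if pt (i - 1) (int j) = u then at_pt \<xi> (i + 1) (int j - 1) - \<xi> u else 0))"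

lemma laplacian_strip:
  fixes \<xi> :: "nat \<times> int \<Rightarrow> qmodz"
  assumes "0 < i" "i < p"
  shows "(\<Sum>j<q. zmul (goeritz_sign D (reg ` black b) (cr i (int j)))
      ((if tip1 b (cr i (int j)) = u then \<xi> (tip2 b (cr i (int j))) - \<xi> u else 0) +
       (if tip2 b (cr i (int j)) = u then \<xi> (tip1 b (cr i (int j))) - \<xi> u else 0))) =
    strip b \<xi> u i"
proof (cases "even i = b")
  case True
  have "(\<Sum>j<q. zmul (goeritz_sign D (reg ` black b) (cr i (int j)))
      ((if tip1 b (cr i (int j)) = u then \<xi> (tip2 b (cr i (int j))) - \<xi> u else 0) +
       (if tip2 b (cr i (int j)) = u then \<xi> (tip1 b (cr i (int j))) - \<xi> u else 0))) =
      (\<Sum>j<q. (if pt i (int j) = u then at_pt \<xi> i (int j - 1) - \<xi> u else 0) +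
         (if pt i (int j - 1) = u then at_pt \<xi> i (int j) - \<xi> u else 0))"
    unfolding goeritz_sign_cr[OF assms] tips_cr[OF assms] at_pt_def if_P[OF True] by simp
  then show ?thesis using True by (simp add: strip_def sum.distrib)
next
  case False
  have "(\<Sum>j<q. zmul (goeritz_sign D (reg ` black b) (cr i (int j)))
      ((if tip1 b (cr i (int j)) = u then \<xi> (tip2 b (cr i (int j))) - \<xi> u else 0) +
       (if tip2 b (cr i (int j)) = u then \<xi> (tip1 b (cr i (int j))) - \<xi> u else 0))) =
      (\<Sum>j<q. - (if pt (i + 1) (int j - 1) = u then at_pt \<xi> (i - 1) (int j) - \<xi> u else 0) -
         (if pt (i - 1) (int j) = u then at_pt \<xi> (i + 1) (int j - 1) - \<xi> u else 0))"
    unfolding goeritz_sign_cr[OF assms] tips_cr[OF assms] at_pt_def using False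
    by (intro sum.cong) (simp_all add: zmul.scale_right_distrib)
  then show ?thesis using False by (simp only: strip_def sum_subtractf sum_negf if_False)
qed

lemma laplacian_sum:
  "(\<Sum>c\<in>crossings D. zmul (goeritz_sign D (reg ` black b) c)
      ((if tip1 b c = u then \<xi> (tip2 b c) - \<xi> u else 0) +
       (if tip2 b c = u then \<xi> (tip1 b c) - \<xi> u else 0))) =
    (\<Sum>i\<in>{0<..<p}. strip b \<xi> u i)"
  unfolding sum_crossings by (rule sum.cong) (simp_all only: laplacian_strip greaterThanLessThan_iff)

lemma pt_delta:
  fixes F :: "int \<Rightarrow> qmodz"
  assumes "0 < i0" "i0 < p" "\<And>a. F (a + int q) = F a"
  shows "(\<Sum>j<q. if pt i (int j) = pt i0 a0 then F (int j) else 0) = (if i = i0 then F a0 else 0)"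
    and "(\<Sum>j<q. if pt i (int j - 1) = pt i0 a0 then F (int j) else 0) = (if i = i0 then F (a0 + 1) else 0)"
proof -
  have q0: "q > 0" using q by simp
  have eq: "pt i a = pt i0 a0 \<longleftrightarrow> i = i0 \<and> a mod int q = a0 mod int q" for a
    using pt_eq_iff[OF assms(1,2), of a0 i a] by auto
  show "(\<Sum>j<q. if pt i (int j) = pt i0 a0 then F (int j) else 0) = (if i = i0 then F a0 else 0)"
    unfolding eq using sum_periodic_delta[of q F a0] q0 assms(3) by (cases "i = i0") simp_all
  show "(\<Sum>j<q. if pt i (int j - 1) = pt i0 a0 then F (int j) else 0) = (if i = i0 then F (a0 + 1) else 0)"
    unfolding eq using sum_periodic_delta_pred[of q F a0] q0 assms(3) by (cases "i = i0") simp_all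
qed

text \<open>Three columns of crossings touch the region: its own, with sign 1 and neighbours in the
  same column, and the two adjacent ones, with sign -1 and neighbours two columns away.\<close>

lemma laplacian_inner:
  assumes i0: "0 < i0" "i0 < p" "even i0 = b"
  shows "(\<Sum>i\<in>{0<..<p}. strip b \<xi> (pt i0 a0) i) =
    at_pt \<xi> i0 (a0 - 1) - at_pt \<xi> i0 a0 + (at_pt \<xi> i0 (a0 + 1) - at_pt \<xi> i0 a0) -
        (if i0 + 1 < p then at_pt \<xi> (i0 + 2) (a0 - 1) - at_pt \<xi> i0 a0 else 0) -
        (if 1 < i0 then at_pt \<xi> (i0 - 2) (a0 + 1) - at_pt \<xi> i0 a0 else 0)"
proof -
  define Z where "Z = at_pt \<xi> i0 a0"
  have Z: "\<xi> (pt i0 a0) = Z" by (simp add: Z_def at_pt_def)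
  define A where "A = at_pt \<xi> i0 (a0 - 1) - Z + (at_pt \<xi> i0 (a0 + 1) - Z)"
  define B where "B = at_pt \<xi> (i0 + 2) (a0 - 1) - Z"
  define C where "C = at_pt \<xi> (i0 - 2) (a0 + 1) - Z"
  have per: "at_pt \<xi> i (a + int q) - Z = at_pt \<xi> i a - Z" "at_pt \<xi> i (a + int q - 1) - Z = at_pt \<xi> i (a - 1) - Z" for i a
    by (simp_all add: at_pt_periodic)
  have "(\<Sum>i\<in>{0<..<p}. strip b \<xi> (pt i0 a0) i) =
     (\<Sum>i\<in>{0<..<p}. (if i = i0 then A else 0) - (if i = i0 + 1 then B else 0) - (if i = i0 - 1 then C else 0))"
  proof (rule sum.cong)
    fix i assume i: "i \<in> {0<..<p}"
    have par: "even i \<noteq> b" if "i + 1 = i0 \<or> i - 1 = i0"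
      using that i i0 by auto
    show "strip b \<xi> (pt i0 a0) i =
       (if i = i0 then A else 0) - (if i = i0 + 1 then B else 0) - (if i = i0 - 1 then C else 0)"
    proof (cases "even i = b")
      case True
      then have "i \<noteq> i0 + 1" "i \<noteq> i0 - 1" using par i0 by auto
      then show ?thesis unfolding strip_def Z using True
        pt_delta(1)[OF i0(1,2), where F = "\<lambda>a. at_pt \<xi> i (a - 1) - Z" and i = i and ?a0.0 = a0]
        pt_delta(2)[OF i0(1,2), where F = "\<lambda>a. at_pt \<xi> i a - Z" and i = i and ?a0.0 = a0] per
        by (simp add: A_def)
    next
      case False
      then have "i \<noteq> i0" using i0 by auto
      moreover have "i + 1 = i0 \<longleftrightarrow> i = i0 - 1" "i - 1 = i0 \<longleftrightarrow> i = i0 + 1" using i i0 by auto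
      ultimately show ?thesis unfolding strip_def Z using False
        pt_delta(2)[OF i0(1,2), where F = "\<lambda>a. at_pt \<xi> (i - 1) a - Z" and i = "i + 1" and ?a0.0 = a0]
        pt_delta(1)[OF i0(1,2), where F = "\<lambda>a. at_pt \<xi> (i + 1) (a - 1) - Z" and i = "i - 1" and ?a0.0 = a0] per
        by (auto simp: B_def C_def numeral_2_eq_2)
    qed
  qed simp
  also have "\<dots> = A - (if i0 + 1 < p then B else 0) - (if 1 < i0 then C else 0)"
  proof -
    have "i0 - 1 < p" "0 < i0 - 1 \<longleftrightarrow> 1 < i0" using i0 by auto
    then show ?thesis unfolding sum_subtractf using i0 by (simp add: sum.delta)
  qed
  finally show ?thesis unfolding Z A_def B_def C_def Z_def by (simp cong: if_cong)
qed

lemma laplacian_left: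
  assumes b
  shows "(\<Sum>i\<in>{0<..<p}. strip b \<xi> (pt 0 0) i) =
    - (\<Sum>j<q. at_pt \<xi> 2 (int j - 1) - at_pt \<xi> 0 0)"
proof -
  have z: "pt i a = pt 0 0 \<longleftrightarrow> i = 0" for i a by (auto simp: pt_def)
  have "(\<Sum>i\<in>{0<..<p}. strip b \<xi> (pt 0 0) i) =
    (\<Sum>i\<in>{0<..<p}. if i = 1 then - (\<Sum>j<q. at_pt \<xi> 2 (int j - 1) - at_pt \<xi> 0 0) else 0)"
  proof (rule sum.cong)
    fix i assume "i \<in> {0<..<p}"
    then consider "i = 1" | "i > 1" by force
    then show "strip b \<xi> (pt 0 0) i =
      (if i = 1 then - (\<Sum>j<q. at_pt \<xi> 2 (int j - 1) - at_pt \<xi> 0 0) else 0)"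
      unfolding strip_def z by cases (use assms in \<open>auto simp: at_pt_def numeral_2_eq_2\<close>)
  qed simp
  then show ?thesis using p by (simp add: sum.delta)
qed

lemma laplacian_right:
  assumes "even p = b"
  shows "(\<Sum>i\<in>{0<..<p}. strip b \<xi> (pt p 0) i) =
    - (\<Sum>j<q. at_pt \<xi> (p - 2) (int j) - at_pt \<xi> p 0)"
proof -
  have z: "pt i a = pt p 0 \<longleftrightarrow> i = p" for i a by (auto simp: pt_def)
  have "(\<Sum>i\<in>{0<..<p}. strip b \<xi> (pt p 0) i) =
    (\<Sum>i\<in>{0<..<p}. if i = p - 1 then - (\<Sum>j<q. at_pt \<xi> (p - 2) (int j) - at_pt \<xi> p 0) else 0)"
  proof (rule sum.cong)
    fix i assume i: "i \<in> {0<..<p}"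
    have ne: "i \<noteq> p" "i - 1 \<noteq> p" using i by auto
    have e: "i + 1 = p \<longleftrightarrow> i = p - 1" using i by auto
    have par: "even i \<noteq> b" if "i = p - 1" using that assms p by (auto simp: even_diff_nat)
    have i2: "i - 1 = p - 2" if "i = p - 1" using that by simp
    show "strip b \<xi> (pt p 0) i =
      (if i = p - 1 then - (\<Sum>j<q. at_pt \<xi> (p - 2) (int j) - at_pt \<xi> p 0) else 0)"
      unfolding strip_def z e using ne par i2 by (cases "i = p - 1") (simp_all add: at_pt_def)
  qed simp
  then show ?thesis using p by (simp add: sum.delta)
qed

lemma laplacian_zero_iff:
  assumes vs: "distinct vs" "set vs = black b"
  shows "(\<forall>i<length vs. mat_act (goeritz_matrix D (map reg vs)) (\<lambda>j. \<xi> (vs ! j)) i = 0) \<longleftrightarrow>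
    kirchhoff p q b (at_pt \<xi>)"
proof -
  define lap where "lap u = (\<Sum>c\<in>crossings D. zmul (goeritz_sign D (reg ` black b) c)
      ((if tip1 b c = u then \<xi> (tip2 b c) - \<xi> u else 0) +
       (if tip2 b c = u then \<xi> (tip1 b c) - \<xi> u else 0)))" for u
  have "(\<forall>i<length vs. mat_act (goeritz_matrix D (map reg vs)) (\<lambda>j. \<xi> (vs ! j)) i = 0) \<longleftrightarrow>
      (\<forall>i<length vs. lap (vs ! i) = 0)"
  proof -
    have "mat_act (goeritz_matrix D (map reg vs)) (\<lambda>j. \<xi> (vs ! j)) i = lap (vs ! i)" if "i < length vs" for i
      unfolding lap_def by (rule laplacian_crossings[OF vs that])
    then show ?thesis by simp
  qed
  also have "\<dots> \<longleftrightarrow> (\<forall>u\<in>black b. lap u = 0)"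
    unfolding vs(2)[symmetric] by (simp only: all_set_conv_all_nth)
  also have "\<dots> \<longleftrightarrow> (\<forall>i a. i \<le> p \<and> even i = b \<longrightarrow> lap (pt i a) = 0)"
    unfolding black_pt by blast
  also have "\<dots> \<longleftrightarrow> (\<forall>i a. 0 < i \<and> i < p \<and> even i = b \<longrightarrow> lap (pt i a) = 0) \<and>
      (b \<longrightarrow> lap (pt 0 0) = 0) \<and> (even p = b \<longrightarrow> lap (pt p 0) = 0)" (is "?L \<longleftrightarrow> ?R")
  proof
    assume R: ?R
    show ?L
    proof (intro allI impI)
      fix i a assume i: "i \<le> p \<and> even i = b"
      then consider "i = 0" | "i = p" | "0 < i" "i < p" by linarith
      then show "lap (pt i a) = 0"
        by cases (use R i pt_0[of a] pt_p[of a] in auto)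
    qed
  qed auto
  also have "\<dots> \<longleftrightarrow> kirchhoff p q b (at_pt \<xi>)"
  proof -
    have inner: "lap (pt i a) = at_pt \<xi> i (a - 1) - at_pt \<xi> i a + (at_pt \<xi> i (a + 1) - at_pt \<xi> i a) -
        (if i + 1 < p then at_pt \<xi> (i + 2) (a - 1) - at_pt \<xi> i a else 0) -
        (if 1 < i then at_pt \<xi> (i - 2) (a + 1) - at_pt \<xi> i a else 0)" if "0 < i \<and> i < p \<and> even i = b" for i a
      unfolding lap_def laplacian_sum by (rule laplacian_inner) (use that in auto)
    have left: "lap (pt 0 0) = - (\<Sum>j<q. at_pt \<xi> 2 (int j - 1) - at_pt \<xi> 0 0)" if b
      unfolding lap_def laplacian_sum using that by (rule laplacian_left)
    have right: "lap (pt p 0) = - (\<Sum>j<q. at_pt \<xi> (p - 2) (int j) - at_pt \<xi> p 0)" if "even p = b"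
      unfolding lap_def laplacian_sum using that by (rule laplacian_right)
    show ?thesis
      unfolding kirchhoff_def
    proof (intro conj_cong iff_allI imp_cong refl)
      show "lap (pt 0 0) = 0 \<longleftrightarrow> (\<Sum>j<q. at_pt \<xi> 2 (int j - 1) - at_pt \<xi> 0 0) = 0" if b
        unfolding left[OF that] by (rule neg_equal_0_iff_equal)
      show "lap (pt p 0) = 0 \<longleftrightarrow> (\<Sum>j<q. at_pt \<xi> (p - 2) (int j) - at_pt \<xi> p 0) = 0" if "even p = b"
        unfolding right[OF that] by (rule neg_equal_0_iff_equal)
    qed (simp only: inner)
  qed
  finally show ?thesis .
qed

section \<open>Solutions of the Goeritz equations as potentials of sequences\<close>

definition potential :: "(int \<Rightarrow> qmodz) \<Rightarrow> nat \<times> int \<Rightarrow> qmodz" where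
  "potential y l = alt_sum (fst l) (antidiff q y) (snd l)"

text \<open>The junk row 0 of the outer columns is harmless: the alternating sum of length 0
  vanishes and that of length \<open>p\<close> is constant.\<close>

lemma potential_pt:
  assumes "y \<in> sequences p q k" "i \<le> p"
  shows "potential y (pt i a) = alt_sum i (antidiff q y) a"
proof -
  consider "i = 0" | "i = p" | "0 < i" "i < p" using assms(2) by linarith
  then show ?thesis
  proof cases
    case 2
    then show ?thesis using alt_sum_antidiff_const[OF p _ assms(1), of a] q by (simp add: potential_def pt_def)
  next
    case 3
    have "alt_sum i (antidiff q y) (a mod int q) = alt_sum i (antidiff q y) a"
      by (rule periodic_mod) (intro alt_sum_periodic antidiff_periodic)
    then show ?thesis using 3 by (simp add: potential_def pt_def)
  qed (simp add: potential_def pt_def)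
qed

lemma kirchhoff_potential:
  assumes "y \<in> sequences p q k"
  shows "kirchhoff p q b (at_pt (potential y))"
proof (rule kirchhoff_cong[OF p])
  show "kirchhoff p q b (\<lambda>i. alt_sum i (antidiff q y))"
    using kirchhoff_alt_sum_antidiff[OF p _ assms] q by simp
qed (simp add: at_pt_def potential_pt[OF assms])

lemma potential_torsion:
  assumes "y \<in> sequences p q k"
  shows "zmul k (potential y l) = 0"
  unfolding potential_def antidiff_def
  by (rule alt_sum_torsion, rule sum_zmul_zero) (use assms in \<open>simp add: sequences_def\<close>)

text \<open>Recovers \<open>y\<close> from differences between regions of one colour, for either
  colouring, so \<open>y\<close> is determined by the solution modulo constants.\<close>

lemma potential_diff:
  assumes "y \<in> sequences p q k"
  shows "y a = (if b then potential y (pt 2 (a - 1)) - potential y (pt 0 0) else potential y (pt 1 a) - potential y (pt 1 (a - 1)))"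
  using sequences_antidiff[OF p _ assms, of a] q p by (simp add: potential_pt[OF assms] numeral_2_eq_2)

text \<open>The map \<open>\<phi>\<close> evaluates the potential and normalises it to 0 at the
  deleted column. It is injective by \<open>potential_diff\<close>, and surjective because a kernel
  vector lifts to a solution of all equations, which is a potential plus a constant.\<close>

lemma card_torsion_kernel_goeritz:
  assumes vs: "distinct vs" "set vs = black b" and ij: "i < length vs" "j < length vs"
  shows "card (torsion_kernel (mat_delete (goeritz_matrix D (map reg vs)) i j) k) = card (sequences p q k)"
proof -
  define n where "n = length vs"
  define A where "A = goeritz_matrix D (map reg vs)"
  define \<phi> where "\<phi> y = (\<lambda>l. if l < n - 1 then potential y (vs ! insert_index j l) - potential y (vs ! j) else 0)" for y
  have A: "A \<in> carrier_mat n n" using goeritz_matrix_carrier[of D "map reg vs"] by (simp add: A_def n_def)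
  have rows: "(\<Sum>h<n. A $$ (l, h)) = 0" and cols: "(\<Sum>h<n. A $$ (h, l)) = 0" if "l < n" for l
    using goeritz_matrix_row_sum[of l "map reg vs" D] goeritz_matrix_col_sum[of l "map reg vs" D] that
    by (simp_all add: A_def n_def)
  have ker_iff: "(\<forall>l<n. mat_act A (\<lambda>h. \<xi> (vs ! h)) l = 0) \<longleftrightarrow> kirchhoff p q b (at_pt \<xi>)" for \<xi>
    using laplacian_zero_iff[OF vs] by (simp add: A_def n_def)
  have "bij_betw \<phi> (sequences p q k) (torsion_kernel (mat_delete A i j) k)"
  proof (rule bij_betw_imageI)
    show "inj_on \<phi> (sequences p q k)"
    proof (rule inj_onI)
      fix y z assume y: "y \<in> sequences p q k" and z: "z \<in> sequences p q k" and eq: "\<phi> y = \<phi> z"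
      have diff: "potential y u - potential y (vs ! j) = potential z u - potential z (vs ! j)" if u: "u \<in> black b" for u
      proof -
        obtain h where h: "h < n" "u = vs ! h" using u vs(2) by (metis in_set_conv_nth n_def)
        show ?thesis
        proof (cases "h = j")
          case True
          then show ?thesis using h by simp
        next
          case False
          then have "h \<in> insert_index j ` {0..<n - 1}"
            using insert_index_image[of j "n - 1"] h ij by (auto simp: n_def)
          then obtain l where "h = insert_index j l" "l < n - 1" by auto
          then show ?thesis using fun_cong[OF eq, of l] h by (simp add: \<phi>_def)
        qed
      qed
      have diff2: "potential y u - potential y v = potential z u - potential z v" if "u \<in> black b" "v \<in> black b" for u v
        using diff[OF that(1)] diff[OF that(2)] by (metis diff_diff_eq2 diff_add_cancel)
      show "y = z"
      proof
        fix a
        show "y a = z a"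
          unfolding potential_diff[OF y, of a b] potential_diff[OF z, of a b]
          using diff2[of "pt 2 (a - 1)" "pt 0 0"] diff2[of "pt 1 a" "pt 1 (a - 1)"] p
          by (auto simp: pt_in_black)
      qed
    qed
    show "\<phi> ` sequences p q k = torsion_kernel (mat_delete A i j) k"
    proof (intro equalityI subsetI)
      fix z assume "z \<in> \<phi> ` sequences p q k"
      then obtain y where y: "y \<in> sequences p q k" "z = \<phi> y" by blast
      have "\<forall>l<n. mat_act A (\<lambda>h. potential y (vs ! h)) l = 0"
        unfolding ker_iff by (rule kirchhoff_potential) (rule y(1))
      then show "z \<in> torsion_kernel (mat_delete A i j) k"
        unfolding y(2) \<phi>_def
        using torsion_kernel_delete_mem[OF A rows, of i j k "\<lambda>h. potential y (vs ! h)"] ij potential_torsion[OF y(1)]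
        by (simp add: n_def)
    next
      fix z assume "z \<in> torsion_kernel (mat_delete A i j) k"
      then obtain x where x: "\<And>l. zmul k (x l) = 0" "\<And>l. l < n \<Longrightarrow> mat_act A x l = 0"
        "z = (\<lambda>l. if l < n - 1 then x (insert_index j l) - x j else 0)"
        using torsion_kernel_delete_lift[OF A cols, of i j z k] ij unfolding n_def by metis
      \<comment> \<open>The lifted vector is indexed by positions in \<open>vs\<close>;
        \<open>\<xi>\<close> carries it over to labels.\<close>
      define \<xi> where "\<xi> u = x (inv_into {..<n} ((!) vs) u)" for u
      have "inj_on ((!) vs) {..<n}" using vs(1) by (auto simp: inj_on_def nth_eq_iff_index_eq n_def)
      then have \<xi>: "\<xi> (vs ! h) = x h" if "h < n" for h using that by (simp add: \<xi>_def)
      have "mat_act A (\<lambda>h. \<xi> (vs ! h)) l = mat_act A x l" for l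
        unfolding mat_act_def using A by (intro sum.cong) (auto simp: \<xi>)
      then have K: "kirchhoff p q b (at_pt \<xi>)" using ker_iff[of \<xi>] x(2) by simp
      obtain y c where y: "y \<in> sequences p q k"
        "\<And>i a. i \<le> p \<Longrightarrow> even i = b \<Longrightarrow> at_pt \<xi> i a = alt_sum i (antidiff q y) a + c"
      proof (rule kirchhoff_imp_alt_sum_antidiff[OF p _ K, where k = k])
        show "at_pt \<xi> 0 a = at_pt \<xi> 0 0" for a by (simp add: at_pt_def pt_0[of a])
        show "at_pt \<xi> p a = at_pt \<xi> p 0" for a by (simp add: at_pt_def pt_p[of a])
        show "zmul k (at_pt \<xi> i a) = 0" for i a by (simp add: at_pt_def \<xi>_def x(1))
      qed (use q at_pt_periodic in auto)
      have "x h = potential y (vs ! h) + c" if h: "h < n" for h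
      proof -
        have "vs ! h \<in> black b" using h vs(2) nth_mem unfolding n_def by blast
        then obtain i' a where i': "i' \<le> p" "even i' = b" "vs ! h = pt i' a" unfolding black_pt by blast
        then show ?thesis using y(2)[OF i'(1,2), of a] \<xi>[OF h] potential_pt[OF y(1) i'(1)] by (simp add: at_pt_def)
      qed
      moreover have "insert_index j l < n" if "l < n - 1" for l
        using that ij by (auto simp: insert_index_def n_def)
      ultimately have "z = \<phi> y" using x(3) ij by (auto simp: \<phi>_def n_def fun_eq_iff)
      with y(1) show "z \<in> \<phi> ` sequences p q k" by blast
    qed
  qed
  then show ?thesis unfolding A_def by (rule bij_betw_same_card[symmetric])
qed

lemma goeritz_invariant_torus_link:
  assumes ds: "divisor_chain ds" "1 \<notin> set ds"
    and card: "\<And>k. k > 0 \<Longrightarrow> int (card (sequences p q k)) = (\<Prod>d\<leftarrow>ds. gcd d k)"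
  shows "goeritz_invariant D ds"
  unfolding goeritz_invariant_def
proof (intro conjI allI impI)
  show "link_diagram D" by (rule link_diagram_D)
  obtain vs where vs: "set vs = black False" "distinct vs"
    using finite_distinct_list[OF finite_black] by blast
  have "pt 1 0 \<in> set vs" using p by (simp add: vs pt_in_black)
  then have "0 < length vs" by (rule length_pos_if_in_set)
  moreover have "inj_on reg (set vs)"
    using inj_on_reg by (rule inj_on_subset) (auto simp: vs black_def)
  ultimately have "irreducible_goeritz_matrix D (mat_delete (goeritz_matrix D (map reg vs)) 0 0)"
    unfolding irreducible_goeritz_matrix_def using vs
    by (intro exI[of _ "map reg vs"] exI[of _ 0]) (auto simp: distinct_map checkerboard_iff)
  then show "\<exists>G. irreducible_goeritz_matrix D G" ..
next
  fix G assume "irreducible_goeritz_matrix D G"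
  then obtain Rs i j where Rs: "distinct Rs" "checkerboard D (set Rs)" "i < length Rs" "j < length Rs"
    and G: "G = mat_delete (goeritz_matrix D Rs) i j"
    unfolding irreducible_goeritz_matrix_def by blast
  obtain b where b: "set Rs = reg ` black b" using Rs(2) unfolding checkerboard_iff by blast
  \<comment> \<open>An arbitrary enumeration of black regions is turned into an enumeration of their
    labels.\<close>
  define vs where "vs = map (inv_into pts reg) Rs"
  have sub: "black b \<subseteq> pts" by (auto simp: black_def)
  have "R \<in> reg ` pts" if "R \<in> set Rs" for R using that b sub by auto
  then have map: "map reg vs = Rs" unfolding vs_def by (simp add: map_idI f_inv_into_f)
  then have dist: "distinct vs" using Rs(1) by (metis distinct_map)
  have "set vs = inv_into pts reg ` reg ` black b" by (simp add: vs_def b)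
  also have "\<dots> = black b" by (rule inv_into_image_cancel[OF inj_on_reg sub])
  finally have set: "set vs = black b" .
  have len: "length vs = length Rs" by (simp add: vs_def)
  show "elementary_divisors G ds"
  proof (rule elementary_divisors_of_card_torsion_kernel)
    show "G \<in> carrier_mat (length Rs - 1) (length Rs - 1)"
      unfolding G by (rule mat_delete_carrier) (rule goeritz_matrix_carrier)
    fix k :: int assume "k > 0"
    then show "int (card (torsion_kernel G k)) = (\<Prod>d\<leftarrow>ds. gcd d k)"
      using card_torsion_kernel_goeritz[OF dist set, of i j k] Rs(3,4) card len unfolding G map by simp
  qed (use ds in auto)
qed

end

theorem theorem1p1:
  fixes p q r p' q' :: nat
  assumes "p > 1" and "q > 1"
    and "r = gcd p q" and "p = p' * r" and "q = q' * r"
  shows "(odd p \<and> odd q \<longrightarrow>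
            goeritz_invariant (torus_link p q) (replicate (r - 1) 2)) \<and>
         (odd p \<and> even q \<longrightarrow>
            goeritz_invariant (torus_link p q) (removeAll 1 (int p' # replicate (r - 1) 0))) \<and>
         (even p \<and> even q \<longrightarrow>
            goeritz_invariant (torus_link p q) (int (2 * p' * q') # replicate (r - 2) 0))"
proof -
  interpret torus_diagram p q by unfold_locales (rule assms(1), rule assms(2))
  have pos: "p > 0" "q > 0" using assms(1,2) by simp_all
  have eqs: "p = p' * gcd p q" "q = q' * gcd p q"
    using assms(4,5) unfolding assms(3) .
  have odd_odd: "goeritz_invariant (torus_link p q) (replicate (r - 1) 2)" if "odd p" "odd q"
  proof (rule goeritz_invariant_torus_link)
    fix k :: int assume k: "k > 0"
    show "int (card (sequences p q k)) = (\<Prod>d\<leftarrow>replicate (r - 1) 2. gcd d k)"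
      unfolding card_sequences_odd_odd[OF that k] assms(3) by simp
  qed (auto simp: divisor_chain_def)
  have odd_even: "goeritz_invariant (torus_link p q) (removeAll 1 (int p' # replicate (r - 1) 0))"
    if "odd p" "even q"
  proof (rule goeritz_invariant_torus_link)
    have "removeAll 1 (replicate (r - 1) (0 :: int)) = replicate (r - 1) 0"
      by (rule removeAll_id) simp
    \<comment> \<open>Only the head can be struck, as the other entries are 0; for
      \<open>p' = 1\<close> its factor \<open>gcd 1 k\<close> is 1, so the product does not
      change.\<close>
    then have ds: "removeAll 1 (int p' # replicate (r - 1) 0) =
        (if p' = 1 then replicate (r - 1) 0 else int p' # replicate (r - 1) 0)" by simp
    show "divisor_chain (removeAll 1 (int p' # replicate (r - 1) 0))"
      unfolding ds by (auto simp: divisor_chain_def nth_Cons split: nat.splits)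
    fix k :: int assume k: "k > 0"
    then show "int (card (sequences p q k)) = (\<Prod>d\<leftarrow>removeAll 1 (int p' # replicate (r - 1) 0). gcd d k)"
      unfolding card_sequences_odd_even[OF that pos(2) k eqs(1)] ds assms(3) by simp
  qed auto
  have even_even: "goeritz_invariant (torus_link p q) (int (2 * p' * q') # replicate (r - 2) 0)"
    if "even p" "even q"
  proof (rule goeritz_invariant_torus_link)
    show "divisor_chain (int (2 * p' * q') # replicate (r - 2) 0)"
      by (auto simp: divisor_chain_def nth_Cons split: nat.splits)
    have "2 * p' * q' \<noteq> 1" by (metis dvd_triv_left mult.assoc odd_one)
    then have "int (2 * p' * q') \<noteq> 1" by (metis of_nat_eq_1_iff)
    then show "1 \<notin> set (int (2 * p' * q') # replicate (r - 2) 0)" by auto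
    fix k :: int assume k: "k > 0"
    then show "int (card (sequences p q k)) = (\<Prod>d\<leftarrow>int (2 * p' * q') # replicate (r - 2) 0. gcd d k)"
      unfolding card_sequences_even_even[OF that pos(1) k eqs] assms(3) by simp
  qed
  show ?thesis using odd_odd odd_even even_even by blast
qed

end
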